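(* Let $d\in\{1,2\}$, let $\xi,\xi_1,\xi_2,\dots$ be i.i.d. $\mathbb{Z}^d$-valued random variables, $S(n)=\xi_1+\cdots+\xi_n$, $R(n)=\{S(1),\dots,S(n)\}$, $l(n,x)=\sum_{j=1}^n\mathbf{1}\{S(j)=x\}$ for $x\in\mathbb{Z}^d$, and let $\mathcal{F}$ be the $\sigma$-algebra generated by $(\xi_n)_{n\ge1}$. Let $Y_n$ be a point chosen uniformly at random from $R(n)$, that is, $\mathbb{P}[Y_n=x\mid\mathcal{F}]=\mathbf{1}\{x\in R(n)\}/\#R(n)$. Then for every $u\ge0$: (i) if A1 holds (so $d=1$), then $$\mathbb{P}\Big[\pi\gamma\,\frac{l(n,Y_n)}{\log n}\ge u\,\Big|\,\mathcal{F}\Big]\to e^{-u}\quad\text{almost surely as }n\to\infty;$$ (ii) if A2 or A2' holds (so $d=2$), then $$\mathbb{P}\Big[2\pi\sqrt{\det(\Sigma)}\,\frac{l(n,Y_n)}{\log n}\ge u\,\Big|\,\mathcal{F}\Big]\to e^{-u}\quad\text{almost surely as }n\to\infty.$$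
   Context: Assumptions on $\xi$, with $\phi_\xi(t)=\mathbb{E}(e^{it\cdot\xi})$: - A1: $d=1$, $\phi_\xi(t)=1-\gamma|t|+o(|t|)$ as $t\to0$ for some $\gamma>0$, and $\xi$ is strongly aperiodic. - A2: $d=2$, $\mathbb{E}|\xi|^2<\infty$, $\mathbb{E}\xi=0$, the covariance matrix $\Sigma$ of $\xi$ is non-singular, and $\xi$ is strongly aperiodic. - A2' (simple random walk): $d=2$ and $\mathbb{P}[\xi=e]=1/4$ for each $e\in\mathbb{Z}^2$ with $|e|=1$; here $\sqrt{\det(\Sigma)}=1/2$. Strongly aperiodic means: there is no proper subgroup $L$ of $\mathbb{Z}^d$ such that $\mathbb{P}(\xi-x\in L)=1$ for some $x\in\mathbb{Z}^d$. *)

theory Defs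
  imports "HOL-Probability.Probability" "HOL-Library.Landau_Symbols"
begin

text \<open>
  The lattice of dimension d is the type \<open>int ^ 'd\<close> with \<open>CARD('d) = d\<close>; it always carries the
  discrete sigma-algebra \<open>count_space UNIV\<close>.
\<close>

definition real_vec :: "int ^ 'd \<Rightarrow> real ^ 'd" where
  "real_vec x = (\<chi> i. real_of_int (x $ i))"

definition char_fun :: "'w measure \<Rightarrow> ('w \<Rightarrow> int ^ 'd) \<Rightarrow> real ^ 'd \<Rightarrow> complex" where
  "char_fun M \<xi> t = (\<integral>\<omega>. exp (\<i> * of_real (t \<bullet> real_vec (\<xi> \<omega>))) \<partial>M)"

definition mean :: "'w measure \<Rightarrow> ('w \<Rightarrow> int ^ 'd) \<Rightarrow> real ^ 'd" where
  "mean M \<xi> = (\<integral>\<omega>. real_vec (\<xi> \<omega>) \<partial>M)"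

definition covariance_matrix :: "'w measure \<Rightarrow> ('w \<Rightarrow> int ^ 'd) \<Rightarrow> real ^ 'd ^ 'd" where
  "covariance_matrix M \<xi> =
     (\<chi> i j. \<integral>\<omega>. (real_vec (\<xi> \<omega>) $ i - mean M \<xi> $ i) * (real_vec (\<xi> \<omega>) $ j - mean M \<xi> $ j) \<partial>M)"

definition additive_subgroup :: "'a::ab_group_add set \<Rightarrow> bool" where
  "additive_subgroup L \<longleftrightarrow> 0 \<in> L \<and> (\<forall>x\<in>L. \<forall>y\<in>L. x + y \<in> L) \<and> (\<forall>x\<in>L. - x \<in> L)"

definition strongly_aperiodic :: "'w measure \<Rightarrow> ('w \<Rightarrow> int ^ 'd) \<Rightarrow> bool" where
  "strongly_aperiodic M \<xi> \<longleftrightarrow>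
     \<not> (\<exists>L. additive_subgroup L \<and> L \<noteq> UNIV \<and>
            (\<exists>x. measure M {\<omega> \<in> space M. \<xi> \<omega> - x \<in> L} = 1))"

text \<open>In dimension one \<open>norm\<close> on \<open>real ^ 'd\<close> is the absolute value of the single coordinate.\<close>

definition assumption_A1 :: "'w measure \<Rightarrow> ('w \<Rightarrow> int ^ 'd) \<Rightarrow> real \<Rightarrow> bool" where
  "assumption_A1 M \<xi> \<gamma> \<longleftrightarrow>
     CARD('d) = 1 \<and> \<gamma> > 0 \<and>
     (\<lambda>t. char_fun M \<xi> t - (1 - of_real (\<gamma> * norm t))) \<in> o[at 0](\<lambda>t. of_real (norm t)) \<and>
     strongly_aperiodic M \<xi>"

definition assumption_A2 :: "'w measure \<Rightarrow> ('w \<Rightarrow> int ^ 'd) \<Rightarrow> bool" where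
  "assumption_A2 M \<xi> \<longleftrightarrow>
     CARD('d) = 2 \<and>
     integrable M (\<lambda>\<omega>. (norm (real_vec (\<xi> \<omega>)))\<^sup>2) \<and>
     mean M \<xi> = 0 \<and>
     invertible (covariance_matrix M \<xi>) \<and>
     strongly_aperiodic M \<xi>"

definition assumption_A2' :: "'w measure \<Rightarrow> ('w \<Rightarrow> int ^ 'd) \<Rightarrow> bool" where
  "assumption_A2' M \<xi> \<longleftrightarrow>
     CARD('d) = 2 \<and>
     (\<forall>e :: int ^ 'd. norm (real_vec e) = 1 \<longrightarrow> measure M {\<omega> \<in> space M. \<xi> \<omega> = e} = 1 / 4)"

text \<open>
  The increments are \<open>X 1, X 2, \<dots>\<close>; the value \<open>X 0\<close> is never used.
\<close>

definition walk :: "(nat \<Rightarrow> 'w \<Rightarrow> int ^ 'd) \<Rightarrow> nat \<Rightarrow> 'w \<Rightarrow> int ^ 'd" where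
  "walk X n \<omega> = (\<Sum>j=1..n. X j \<omega>)"

definition walk_range :: "(nat \<Rightarrow> 'w \<Rightarrow> int ^ 'd) \<Rightarrow> nat \<Rightarrow> 'w \<Rightarrow> (int ^ 'd) set" where
  "walk_range X n \<omega> = (\<lambda>j. walk X j \<omega>) ` {1..n}"

definition local_time :: "(nat \<Rightarrow> 'w \<Rightarrow> int ^ 'd) \<Rightarrow> nat \<Rightarrow> int ^ 'd \<Rightarrow> 'w \<Rightarrow> nat" where
  "local_time X n x \<omega> = (\<Sum>j=1..n. of_bool (walk X j \<omega> = x))"

definition walk_algebra :: "'w measure \<Rightarrow> (nat \<Rightarrow> 'w \<Rightarrow> int ^ 'd) \<Rightarrow> 'w measure" where
  "walk_algebra M X = sigma (space M) {X j -` A \<inter> space M | j A. j \<ge> 1}"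

definition cond_probability :: "'w measure \<Rightarrow> 'w measure \<Rightarrow> ('w \<Rightarrow> bool) \<Rightarrow> 'w \<Rightarrow> real" where
  "cond_probability M F P = real_cond_exp M F (indicator {\<omega> \<in> space M. P \<omega>})"

text \<open>
  The range is empty for \<open>n = 0\<close>, so no uniform point exists there and only \<open>n \<ge> 1\<close> is constrained.
  The space may carry more randomness than the walk, which is where \<open>Y n\<close> gets its own.
\<close>

definition uniform_on_range ::
    "'w measure \<Rightarrow> (nat \<Rightarrow> 'w \<Rightarrow> int ^ 'd) \<Rightarrow> (nat \<Rightarrow> 'w \<Rightarrow> int ^ 'd) \<Rightarrow> bool" where
  "uniform_on_range M X Y \<longleftrightarrow>
     (\<forall>n\<ge>1. Y n \<in> M \<rightarrow>\<^sub>M count_space UNIV \<and>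
       (\<forall>x. AE \<omega> in M. cond_probability M (walk_algebra M X) (\<lambda>\<omega>'. Y n \<omega>' = x) \<omega> =
          indicator (walk_range X n \<omega>) x / real (card (walk_range X n \<omega>))))"

end

(* The number N_m(n) of points visited at least m times in n steps satisfies a renewal equation in m,
   so E N_m(n) is about (1 - p_n)^(m-1) E N_1(n), where p_n is the probability of no return to the
   starting point within n steps. Decomposing at the last visit gives p_n ~ c / ln n from the
   asymptotics G_n ~ ln n / c of the Green function, and m ~ u ln n / c then produces the factor exp(-u).
   Cutting a walk of length 2n in the middle changes N_m only by the number of points common to the two
   halves. Its second moment is at most four times the squared sum of the squared hitting
   probabilities, which is O(n^2 / ln^4 n) as P(S_n = x) <= C / n. Hence Var N_m(n) / (E N_1(n))^2 is
   summable along n = s 2^j, uniformly in m, and monotonicity of N_m(n) fills the gaps as s grows.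
   The estimates on P(S_n = x) come from Fourier inversion, and for the periodic simple random walk of
   the plane from Wallis' product. *)
theory Submission
  imports Defs "HOL-Real_Asymp.Real_Asymp"
begin

section \<open>Visits along a list of increments\<close>

text \<open>The second moment of N_m(n) is never computed exactly. Doubling n about doubles the
  variance but quadruples the squared mean, so the normalised variance contracts by 5/6 = (5/2)/3
  per doubling, up to a collision term of order 1/ln^2 n, that is 1/j^2 at n = s 2^j. The bound has
  to hold for all m at once: the recursion compares the same m at n and 2n, while the threshold m ~
  u ln n / c moves with n. Stopping times are avoided: walks are finite lists of increments, and
  decompositions at a first or last visit are proved by induction on the first step. One Fourier
  argument serves A1 and A2, because in both cases the characteristic function is 1 - Q(t) +
  o(|t|^d) with Q homogeneous of degree d, so the scale n^(-1/d) yields P(S_n = 0) ~ const / n in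
  either dimension. The simple random walk escapes it: its characteristic function has modulus 1
  also at (pi, pi). Given the walk, the event for Y_n has probability N_m(n) / N_1(n), so only a
  quotient of two almost sure limits is needed.\<close>

primrec visits :: "'a::ab_group_add list \<Rightarrow> 'a \<Rightarrow> nat" where
  "visits [] x = 0"
| "visits (e # es) x = of_bool (x = e) + visits es (x - e)"

text \<open>The starting point 0 is included, whereas \<open>visits\<close> counts times from 1 on.
  Including it makes the trail symmetric under time reversal (\<open>mem_trail_rev\<close>);
  \<open>mem_trail_iff\<close> records the difference.\<close>

primrec trail :: "'a::ab_group_add list \<Rightarrow> 'a set" where
  "trail [] = {0}"
| "trail (e # es) = insert 0 ((+) e ` trail es)"

text \<open>This is N_m(n). For m = 0 the set is the whole group, whose \<open>card\<close> is 0 if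
  it is infinite; hence the condition m >= 1 in the lemmas about it.\<close>

definition popular :: "nat \<Rightarrow> 'a::ab_group_add list \<Rightarrow> nat" where
  "popular m es = card {x. visits es x \<ge> m}"

text \<open>Common points are recorded by their displacement \<open>z\<close> from the cut, so that
  the second half and the reversed first half can both be read as walks started at 0.\<close>

definition collisions :: "'a::ab_group_add list \<Rightarrow> 'a list \<Rightarrow> nat" where
  "collisions xs ys = card {z \<in> trail ys. sum_list xs + z \<in> trail xs}"

lemma mem_trail_Cons: "x \<in> trail (e # es) \<longleftrightarrow> x = 0 \<or> x - e \<in> trail es"
  by (auto simp: image_iff algebra_simps intro: bexI[of _ "x - e"])

lemma zero_mem_trail [simp]: "0 \<in> trail es"
  by (cases es) auto

lemma finite_trail [simp]: "finite (trail es)"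
  by (induction es) auto

lemma card_trail_le: "card (trail es) \<le> Suc (length es)"
proof (induction es)
  case (Cons e es)
  have "card (trail (e # es)) \<le> Suc (card ((+) e ` trail es))"
    by (simp add: card_insert_if)
  also have "\<dots> \<le> Suc (card (trail es))" by (simp add: card_image_le)
  finally show ?case using Cons by simp
qed auto

lemma trail_append: "trail (xs @ ys) = trail xs \<union> (+) (sum_list xs) ` trail ys"
proof (induction xs)
  case (Cons a xs)
  have "trail ((a # xs) @ ys) = insert 0 ((+) a ` (trail xs \<union> (+) (sum_list xs) ` trail ys))"
    using Cons by simp
  then show ?case by (auto simp: image_Un image_image add.assoc)
qed auto

lemma mem_trail_rev: "x \<in> trail (rev es) \<longleftrightarrow> sum_list es - x \<in> trail es"
proof (induction es arbitrary: x)
  case (Cons e es)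
  have "x \<in> trail (rev (e # es)) \<longleftrightarrow> x \<in> trail (rev es) \<or> x = sum_list es + e"
    by (auto simp: trail_append sum_list_rev) (metis Cons.IH add.commute add_diff_cancel_left' diff_zero zero_mem_trail diff_self)+
  also have "\<dots> \<longleftrightarrow> sum_list (e # es) - x \<in> trail (e # es)"
    unfolding mem_trail_Cons Cons.IH by (auto simp: algebra_simps)
  finally show ?case .
qed auto

lemma visits_pos_imp_trail: "visits es x > 0 \<Longrightarrow> x \<in> trail es"
proof (induction es arbitrary: x)
  case (Cons e es)
  then show ?case
    unfolding mem_trail_Cons by (cases "x = e") auto
qed auto

lemma mem_trail_iff: "x \<in> trail es \<longleftrightarrow> x = 0 \<or> visits es x > 0"
proof (induction es arbitrary: x)
  case (Cons e es)
  then show ?case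
    unfolding mem_trail_Cons by auto
qed auto

lemma visits_append: "visits (xs @ ys) x = visits xs x + visits ys (x - sum_list xs)"
  by (induction xs arbitrary: x) (auto simp: algebra_simps)

lemma finite_popular: "m \<ge> 1 \<Longrightarrow> finite {x. visits es x \<ge> m}"
  by (rule finite_subset[OF _ finite_trail[of es]]) (auto intro!: visits_pos_imp_trail)

text \<open>A step put in front translates all positions by \<open>e\<close> and adds a single
  visit, to the starting point of the old walk. Only that point can change status, and it does so
  exactly if it had \<open>m - 1\<close> visits. Prepending rather than appending yields a count of
  returns to the start without time reversal.\<close>

lemma popular_Cons:
  assumes "m \<ge> 1"
  shows "popular m (e # es) = popular m es + of_bool (visits es 0 = m - 1)"
proof -
  have "{x. visits (e # es) x \<ge> m} = (+) e ` {z. of_bool (z = 0) + visits es z \<ge> m}"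
  proof (intro equalityI subsetI)
    fix x assume "x \<in> {x. visits (e # es) x \<ge> m}"
    then show "x \<in> (+) e ` {z. of_bool (z = 0) + visits es z \<ge> m}"
      by (intro image_eqI[of _ _ "x - e"]) auto
  qed auto
  then have "popular m (e # es) = card {z. of_bool (z = 0) + visits es z \<ge> m}"
    unfolding popular_def by (simp add: card_image)
  also have "{z. of_bool (z = 0) + visits es z \<ge> m} =
      {z. visits es z \<ge> m} \<union> (if visits es 0 = m - 1 then {0} else {})"
    using assms by (auto simp: of_bool_def split: if_splits)
  also have "card \<dots> = popular m es + of_bool (visits es 0 = m - 1)"
    unfolding popular_def using assms finite_popular[OF assms, of es] by (subst card_Un_disjoint) auto
  finally show ?thesis .
qed

lemma popular_le: "m \<ge> 1 \<Longrightarrow> popular m es \<le> length es"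
  by (induction es) (auto simp: popular_Cons, auto simp: popular_def)

lemma popular_antimono: "1 \<le> m \<Longrightarrow> m \<le> m' \<Longrightarrow> popular m' es \<le> popular m es"
  unfolding popular_def by (intro card_mono finite_popular) auto

lemma popular_append_mono: "1 \<le> m \<Longrightarrow> popular m xs \<le> popular m (xs @ ys)"
  unfolding popular_def by (intro card_mono finite_popular) (auto simp: visits_append)

lemma collisions_le: "collisions xs ys \<le> Suc (length ys)"
proof -
  have "collisions xs ys \<le> card (trail ys)"
    unfolding collisions_def by (intro card_mono) auto
  then show ?thesis using card_trail_le[of ys] by simp
qed

text \<open>At a point met by at most one half the three indicators of having m visits cancel; at a
  point met by both halves their combination is -1, 0 or 1. So the common points bound the
  error.\<close>

lemma popular_append:
  assumes "m \<ge> 1"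
  shows "\<bar>real (popular m (xs @ ys)) - real (popular m xs) - real (popular m ys)\<bar> \<le> real (collisions xs ys)"
proof -
  define s where "s = sum_list xs"
  let ?A = "{x. visits (xs @ ys) x \<ge> m}" and ?B = "{x. visits xs x \<ge> m}"
    and ?C = "{x. visits ys (x - s) \<ge> m}"
  define D where "D = trail xs \<union> (+) s ` trail ys"
  define I where "I = {x \<in> D. visits xs x > 0 \<and> visits ys (x - s) > 0}"
  have fin: "finite D" by (simp add: D_def)
  have mem: "x \<in> D" if "visits xs x > 0 \<or> visits ys (x - s) > 0" for x
    using that visits_pos_imp_trail[of xs x] visits_pos_imp_trail[of ys "x - s"]
    unfolding D_def by (auto simp: image_iff intro: bexI[of _ "x - s"])
  have C: "popular m ys = card ?C"
  proof -
    have "?C = (+) s ` {z. visits ys z \<ge> m}"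
      by (force simp: image_iff intro: exI[of _ "x - s" for x])
    then show ?thesis unfolding popular_def by (simp add: card_image)
  qed
  have count: "real (card S) = (\<Sum>x\<in>D. of_bool (x \<in> S))" if "S \<subseteq> D" for S
    using that fin by (simp add: of_bool_def sum.If_cases Int_absorb1)
  have S: "?A \<subseteq> D" "?B \<subseteq> D" "?C \<subseteq> D" "I \<subseteq> D"
    using mem assms by (force simp: visits_append s_def I_def)+
  have "\<bar>real (popular m (xs @ ys)) - real (popular m xs) - real (popular m ys)\<bar> =
     \<bar>\<Sum>x\<in>D. (of_bool (x \<in> ?A) - of_bool (x \<in> ?B) - of_bool (x \<in> ?C) :: real)\<bar>"
    unfolding sum_subtractf count[OF S(1), symmetric] count[OF S(2), symmetric] count[OF S(3), symmetric] C
    by (simp add: popular_def)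
  also have "\<dots> \<le> (\<Sum>x\<in>D. \<bar>of_bool (x \<in> ?A) - of_bool (x \<in> ?B) - of_bool (x \<in> ?C) :: real\<bar>)"
    by (rule sum_abs)
  also have "\<dots> \<le> (\<Sum>x\<in>D. of_bool (x \<in> I))"
    using assms by (intro sum_mono) (auto simp: I_def visits_append s_def of_bool_def)
  also have "\<dots> = real (card I)" using count[OF S(4)] by simp
  also have "card I \<le> collisions xs ys"
  proof -
    have "card I = card ((\<lambda>x. x - s) ` I)" by (simp add: card_image inj_on_def)
    also have "\<dots> \<le> collisions xs ys" unfolding collisions_def
      by (intro card_mono) (auto simp: I_def s_def intro!: visits_pos_imp_trail)
    finally show ?thesis .
  qed
  finally show ?thesis by simp
qed

section \<open>First and last visits\<close>

locale random_walk =
  fixes mu :: "'a::{ab_group_add,countable} pmf"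
begin

abbreviation E :: "nat \<Rightarrow> ('a list \<Rightarrow> real) \<Rightarrow> real" where
  "E n F \<equiv> measure_pmf.expectation (replicate_pmf n mu) F"

abbreviation E1 :: "('a \<Rightarrow> real) \<Rightarrow> real" where
  "E1 f \<equiv> measure_pmf.expectation mu f"

lemma AE_length: "AE es in measure_pmf (replicate_pmf n mu). length es = n"
  by (auto simp: AE_measure_pmf_iff set_replicate_pmf)

lemma integrable_walk:
  fixes F :: "'a list \<Rightarrow> real"
  assumes "\<And>es. length es = n \<Longrightarrow> \<bar>F es\<bar> \<le> B"
  shows "integrable (measure_pmf (replicate_pmf n mu)) F"
  by (rule measure_pmf.integrable_const_bound[where B = B])
     (use AE_length[of n] assms in \<open>auto elim!: eventually_mono\<close>)

lemma integrable_step: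
  fixes f :: "'a \<Rightarrow> real"
  assumes "\<And>e. \<bar>f e\<bar> \<le> B"
  shows "integrable (measure_pmf mu) f"
  by (rule measure_pmf.integrable_const_bound[where B = B]) (use assms in auto)

lemma E_mono:
  assumes "\<And>es. length es = n \<Longrightarrow> F es \<le> G es"
    and "\<And>es. length es = n \<Longrightarrow> \<bar>F es\<bar> \<le> B" and "\<And>es. length es = n \<Longrightarrow> \<bar>G es\<bar> \<le> B'"
  shows "E n F \<le> E n G"
proof (rule integral_mono_AE)
  show "integrable (measure_pmf (replicate_pmf n mu)) F" by (rule integrable_walk) fact
  show "integrable (measure_pmf (replicate_pmf n mu)) G" by (rule integrable_walk) fact
qed (use AE_length[of n] assms(1) in \<open>auto elim!: eventually_mono\<close>)

lemma E_cong:
  assumes "\<And>es. length es = n \<Longrightarrow> F es = G es"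
  shows "E n F = E n G"
  by (rule integral_cong_AE) (use AE_length[of n] assms in \<open>auto elim!: eventually_mono\<close>)

lemma E_nonneg: "(\<And>es. length es = n \<Longrightarrow> F es \<ge> 0) \<Longrightarrow> E n F \<ge> 0"
  by (rule integral_nonneg_AE) (use AE_length[of n] in \<open>auto elim!: eventually_mono\<close>)

lemma E_0 [simp]: "E 0 F = F []"
  by simp

lemma E_const [simp]: "E n (\<lambda>_. c) = c"
  by simp

lemma replicate_pmf_append:
  "replicate_pmf (m + n) p = bind_pmf (replicate_pmf m p) (\<lambda>xs. map_pmf ((@) xs) (replicate_pmf n p))"
  by (simp add: replicate_pmf_distrib map_pmf_def)

text \<open>Independence of the first m increments from the following n.\<close>

lemma E_append:
  assumes "\<And>es. length es = m + n \<Longrightarrow> \<bar>F es\<bar> \<le> B"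
  shows "E (m + n) F = E m (\<lambda>xs. E n (\<lambda>ys. F (xs @ ys)))"
proof -
  \<comment> \<open>The formula for integrals over a bind wants one bound for all lists, but
    \<open>F\<close> is bounded only on lists of length \<open>m + n\<close>; elsewhere it is
    replaced by 0.\<close>
  define G where "G es = (if length es = m + n then F es else 0)" for es
  have "B \<ge> 0" using assms[of "replicate (m + n) 0"] by simp
  then have G: "\<bar>G es\<bar> \<le> B" for es using assms by (auto simp: G_def)
  have "E (m + n) F = E (m + n) G" by (rule E_cong) (simp add: G_def)
  also have "\<dots> = E m (\<lambda>xs. E n (\<lambda>ys. G (xs @ ys)))"
    unfolding replicate_pmf_append
    unfolding measure_pmf_bind
    by (subst integral_bind[where K = "count_space UNIV" and B = B and B' = 1])
       (use G in \<open>auto simp: measure_pmf.emeasure_space_1 space_subprob_algebra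
          intro!: subprob_space_measure_pmf measure_pmf.finite_measure_axioms\<close>)
  also have "\<dots> = E m (\<lambda>xs. E n (\<lambda>ys. F (xs @ ys)))"
    by (intro E_cong) (simp add: G_def)
  finally show ?thesis .
qed

lemma E_Suc:
  assumes "\<And>es. length es = Suc n \<Longrightarrow> \<bar>F es\<bar> \<le> B"
  shows "E (Suc n) F = E1 (\<lambda>e. E n (\<lambda>ys. F (e # ys)))"
proof -
  have "E (1 + n) F = E 1 (\<lambda>xs. E n (\<lambda>ys. F (xs @ ys)))"
    by (rule E_append) (use assms in simp)
  also have "E 1 (\<lambda>xs. E n (\<lambda>ys. F (xs @ ys))) = E1 (\<lambda>e. E n (\<lambda>ys. F (e # ys)))"
    unfolding replicate_pmf_1 by simp
  finally show ?thesis by simp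
qed

section \<open>Point, hitting and return probabilities\<close>

definition u :: "nat \<Rightarrow> 'a \<Rightarrow> real" where
  "u n x = E n (\<lambda>es. of_bool (sum_list es = x))"

definition hit :: "nat \<Rightarrow> 'a \<Rightarrow> real" where
  "hit n x = E n (\<lambda>es. of_bool (x \<in> trail es))"

text \<open>Since \<open>visits\<close> ignores time 0, \<open>q r n 0\<close> is the probability of
  exactly r returns to the start, and \<open>p n\<close> below is the escape probability
  p_n.\<close>

definition q :: "nat \<Rightarrow> nat \<Rightarrow> 'a \<Rightarrow> real" where
  "q r n x = E n (\<lambda>es. of_bool (visits es x = r))"

definition p :: "nat \<Rightarrow> real" where
  "p n = q 0 n 0"

text \<open>The Green function truncated at time n. Its term j = 0 counts the visit made at the very
  moment of arrival, as \<open>hit_mult_G_le\<close> requires.\<close>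

definition G :: "nat \<Rightarrow> 'a \<Rightarrow> real" where
  "G n x = (\<Sum>j\<le>n. u j x)"

lemma E_of_bool_bounds: "0 \<le> E n (\<lambda>es. of_bool (P es))" "E n (\<lambda>es. of_bool (P es)) \<le> 1"
proof -
  have "E n (\<lambda>es. of_bool (P es)) \<le> E n (\<lambda>_. 1)"
    by (rule E_mono[where B = 1 and B' = 1]) auto
  then show "E n (\<lambda>es. of_bool (P es)) \<le> 1" by simp
qed (rule E_nonneg, simp)

lemma u_bounds: "0 \<le> u n x" "u n x \<le> 1"
  and hit_bounds: "0 \<le> hit n x" "hit n x \<le> 1"
  and q_bounds: "0 \<le> q r n x" "q r n x \<le> 1"
  unfolding u_def hit_def q_def by (rule E_of_bool_bounds)+

lemma p_bounds: "0 \<le> p n" "p n \<le> 1"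
  unfolding p_def by (rule q_bounds)+

lemma G_nonneg: "0 \<le> G n x"
  unfolding G_def by (intro sum_nonneg u_bounds)

lemma u_0: "u 0 x = of_bool (x = 0)"
  by (auto simp: u_def)

lemma u_Suc: "u (Suc n) x = E1 (\<lambda>e. u n (x - e))"
proof -
  have eq: "(sum_list (e # ys) = x) = (sum_list ys = x - e)" for e ys
    by (auto simp: algebra_simps)
  show ?thesis
    unfolding u_def by (subst E_Suc[where B = 1]) (simp_all only: eq, simp)
qed

lemma hit_0: "hit 0 x = of_bool (x = 0)"
  by (simp add: hit_def)

lemma hit_zero [simp]: "hit n 0 = 1"
  by (simp add: hit_def)

lemma hit_Suc: "x \<noteq> 0 \<Longrightarrow> hit (Suc n) x = E1 (\<lambda>e. hit n (x - e))"
  unfolding hit_def by (subst E_Suc[where B = 1]) (simp_all add: mem_trail_Cons del: trail.simps)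

lemma q_0: "q r 0 x = of_bool (r = 0)"
  by (auto simp: q_def)

lemma q_Suc_0: "q 0 (Suc n) x = E1 (\<lambda>e. if e = x then 0 else q 0 n (x - e))"
  unfolding q_def
  by (subst E_Suc[where B = 1]) (auto intro!: Bochner_Integration.integral_cong)

lemma q_Suc_Suc:
  "q (Suc r) (Suc n) x = E1 (\<lambda>e. if e = x then q r n 0 else q (Suc r) n (x - e))"
  unfolding q_def
  by (subst E_Suc[where B = 1]) (auto intro!: Bochner_Integration.integral_cong)

text \<open>After the first step \<open>e\<close>, a visit to \<open>x\<close> at some time from 1
  on means that \<open>x - e\<close> lies on the trail of the remaining steps; the point 0 of that
  trail accounts for a visit at time 1.\<close>

lemma q_Suc_0_hit: "q 0 (Suc n) x = 1 - E1 (\<lambda>e. hit n (x - e))"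
proof -
  have "q 0 (Suc n) x = E1 (\<lambda>e. E n (\<lambda>ys. of_bool (visits (e # ys) x = 0)))"
    unfolding q_def by (rule E_Suc[where B = 1]) auto
  also have "\<dots> = E1 (\<lambda>e. E n (\<lambda>ys. 1 - of_bool (x - e \<in> trail ys)))"
    by (intro Bochner_Integration.integral_cong refl) (auto simp: mem_trail_iff)
  also have "\<dots> = E1 (\<lambda>e. 1 - hit n (x - e))"
    by (subst Bochner_Integration.integral_diff)
       (auto simp: hit_def intro!: integrable_walk[where B = 1])
  also have "\<dots> = 1 - E1 (\<lambda>e. hit n (x - e))"
    by (subst Bochner_Integration.integral_diff)
       (use hit_bounds in \<open>auto intro!: integrable_step[where B = 1]\<close>)
  finally show ?thesis .
qed

lemma hit_eq_1_minus_q: "x \<noteq> 0 \<Longrightarrow> hit n x = 1 - q 0 n x"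
  by (cases n) (simp_all add: hit_0 q_0 hit_Suc q_Suc_0_hit)

text \<open>Splits by the time j of the last visit to \<open>x\<close>: the walk is at
  \<open>x\<close> at time j and does not come back during the remaining n - j steps. In the
  induction on the first step, the term j = 0 supplies the missing \<open>p (Suc n)\<close> exactly
  when x = 0.\<close>

lemma last_exit: "(\<Sum>j\<le>n. u j x * p (n - j)) = hit n x"
proof (induction n arbitrary: x)
  case 0
  then show ?case by (simp add: u_0 hit_0 p_def q_0)
next
  case (Suc n)
  have "(\<Sum>j\<le>Suc n. u j x * p (Suc n - j)) = u 0 x * p (Suc n) + (\<Sum>j\<le>n. u (Suc j) x * p (n - j))"
    by (subst sum.atMost_Suc_shift) simp
  also have "(\<Sum>j\<le>n. u (Suc j) x * p (n - j)) = E1 (\<lambda>e. \<Sum>j\<le>n. u j (x - e) * p (n - j))"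
    by (subst Bochner_Integration.integral_sum)
       (use u_bounds in \<open>auto simp: u_Suc intro!: integrable_step[where B = 1]\<close>)
  also have "\<dots> = 1 - q 0 (Suc n) x"
    unfolding Suc.IH q_Suc_0_hit by simp
  finally show ?case
    by (cases "x = 0") (simp_all add: u_0 p_def hit_eq_1_minus_q)
qed

lemma p_antimono: "m \<le> n \<Longrightarrow> p n \<le> p m"
proof -
  assume "m \<le> n"
  then obtain k where k: "n = m + k" using le_Suc_ex by blast
  have "q 0 (m + k) 0 = E m (\<lambda>xs. E k (\<lambda>ys. of_bool (visits (xs @ ys) 0 = 0)))"
    unfolding q_def by (rule E_append[where B = 1]) simp
  also have "\<dots> \<le> E m (\<lambda>xs. of_bool (visits xs 0 = 0))"
  proof (rule E_mono[where B = 1 and B' = 1])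
    fix xs :: "'a list"
    have "E k (\<lambda>ys. of_bool (visits (xs @ ys) 0 = 0)) \<le> E k (\<lambda>_. of_bool (visits xs 0 = 0))"
      by (rule E_mono[where B = 1 and B' = 1]) (auto simp: visits_append)
    then show "E k (\<lambda>ys. of_bool (visits (xs @ ys) 0 = 0)) \<le> of_bool (visits xs 0 = 0)" by simp
  qed (use E_of_bool_bounds in auto)
  finally show "p n \<le> p m" by (simp add: p_def k q_def)
qed

text \<open>\<open>last_exit\<close> at 0 has sum 1, and each factor \<open>p (n - j)\<close> there
  is at least \<open>p n\<close>.\<close>

lemma p_G_le: "p n * G n 0 \<le> 1"
proof -
  have "p n * G n 0 = (\<Sum>j\<le>n. u j 0 * p n)" by (simp add: G_def sum_distrib_left mult.commute)
  also have "\<dots> \<le> (\<Sum>j\<le>n. u j 0 * p (n - j))"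
    by (intro sum_mono mult_left_mono p_antimono u_bounds) simp
  finally show ?thesis using last_exit[of 0 n] by simp
qed

text \<open>\<open>last_exit\<close> at horizon n + K. Up to time K at least n steps remain, so the
  escape factor is at most \<open>p n\<close>; after K it is bounded by 1, at the cost of an
  increment of the Green function. K is left free and chosen in \<open>p_asymp\<close> so that this
  cost vanishes.\<close>

lemma p_G_ge: "1 \<le> p n * G K 0 + (G (n + K) 0 - G K 0)"
proof -
  have split: "(\<Sum>j\<le>n + K. f j) = (\<Sum>j\<le>K. f j) + (\<Sum>j\<in>{K<..n + K}. f j)" for f :: "nat \<Rightarrow> real"
    by (subst sum.union_disjoint[symmetric]) (auto intro!: sum.cong)
  have "1 = (\<Sum>j\<le>n + K. u j 0 * p (n + K - j))" using last_exit[of 0 "n + K"] by simp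
  also have "\<dots> \<le> (\<Sum>j\<le>K. u j 0 * p n) + (\<Sum>j\<in>{K<..n + K}. u j 0 * 1)"
    unfolding split
    by (intro add_mono sum_mono mult_left_mono p_antimono p_bounds u_bounds) simp
  also have "\<dots> = p n * G K 0 + (G (n + K) 0 - G K 0)"
    unfolding G_def split by (simp add: sum_distrib_left mult.commute)
  finally show ?thesis .
qed

lemma G_Suc: "G (Suc n) x = of_bool (x = 0) + E1 (\<lambda>e. G n (x - e))"
  unfolding G_def
  by (subst sum.atMost_Suc_shift, subst Bochner_Integration.integral_sum)
     (use u_bounds in \<open>auto simp: u_0 u_Suc intro!: integrable_step[where B = 1]\<close>)

lemma G_mono: "m \<le> n \<Longrightarrow> G m x \<le> G n x"
  unfolding G_def by (intro sum_mono2 u_bounds) auto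

lemma G_le: "G n x \<le> real (Suc n)"
  unfolding G_def using sum_mono[of "{..n}" "\<lambda>j. u j x" "\<lambda>_. 1"] u_bounds by simp

lemma hit_mono_Suc: "hit n x \<le> hit (Suc n) x"
proof (induction n arbitrary: x)
  case 0
  then show ?case using hit_bounds[of "Suc 0" x] by (cases "x = 0") (auto simp: hit_0)
next
  case (Suc n)
  then show ?case
    by (cases "x = 0")
       (use hit_bounds in \<open>auto simp: hit_Suc intro!: integral_mono integrable_step[where B = 1]\<close>)
qed

text \<open>Once \<open>x\<close> is reached within n steps, at least m further steps remain before
  n + m, and these bring \<open>G m 0\<close> expected visits. Induction on the first step replaces
  the strong Markov property.\<close>

lemma hit_mult_G_le: "hit n x * G m 0 \<le> G (n + m) x"
proof (induction n arbitrary: x)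
  case 0
  then show ?case using G_nonneg by (auto simp: hit_0)
next
  case (Suc n)
  show ?case
  proof (cases "x = 0")
    case True
    then show ?thesis by (auto intro: G_mono)
  next
    case False
    have "hit (Suc n) x * G m 0 = E1 (\<lambda>e. hit n (x - e) * G m 0)"
      using False by (simp add: hit_Suc)
    also have "\<dots> \<le> E1 (\<lambda>e. G (n + m) (x - e))"
    proof (intro integral_mono)
      show "integrable (measure_pmf mu) (\<lambda>e. hit n (x - e) * G m 0)"
        by (intro integrable_mult_left integrable_step[where B = 1]) (use hit_bounds in auto)
      show "integrable (measure_pmf mu) (\<lambda>e. G (n + m) (x - e))"
        by (rule integrable_step[where B = "real (Suc (n + m))"])
           (use G_nonneg G_le in \<open>auto simp del: of_nat_Suc\<close>)
    qed (use Suc.IH in auto)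
    also have "\<dots> = G (Suc n + m) x" using False by (simp add: G_Suc)
    finally show ?thesis .
  qed
qed

text \<open>One of the two points is reached first, and the other then has to be reached from there;
  the two summands are the two possible orders.\<close>

lemma hit_pair_le:
  "E n (\<lambda>es. of_bool (x \<in> trail es \<and> y \<in> trail es)) \<le> hit n x * hit n (y - x) + hit n y * hit n (x - y)"
proof (induction n arbitrary: x y)
  case 0
  then show ?case by (auto simp: hit_0)
next
  case (Suc n)
  consider "x = 0" | "y = 0" | "x \<noteq> 0" "y \<noteq> 0" by blast
  then show ?case
  proof cases
    case 1
    then show ?thesis using hit_bounds[of "Suc n"] by (simp add: hit_def[symmetric] del: replicate_pmf.simps)
  next
    case 2
    then show ?thesis using hit_bounds[of "Suc n"] by (simp add: hit_def[symmetric] del: replicate_pmf.simps)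
  next
    case 3
    have eq: "(x \<in> trail (e # es) \<and> y \<in> trail (e # es)) = (x - e \<in> trail es \<and> y - e \<in> trail es)" for e es
      using 3 by (simp add: mem_trail_Cons del: trail.simps)
    have int: "integrable (measure_pmf mu) (\<lambda>e. hit n (x - e) * c)" for x c
      by (intro integrable_mult_left integrable_step[where B = 1]) (use hit_bounds in auto)
    have "E (Suc n) (\<lambda>es. of_bool (x \<in> trail es \<and> y \<in> trail es))
        = E1 (\<lambda>e. E n (\<lambda>es. of_bool (x - e \<in> trail es \<and> y - e \<in> trail es)))"
      by (subst E_Suc[where B = 1]) (simp_all only: eq, simp)
    also have "\<dots> \<le> E1 (\<lambda>e. hit n (x - e) * hit n (y - x) + hit n (y - e) * hit n (x - y))"
    proof (intro integral_mono Bochner_Integration.integrable_add int)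
      show "integrable (measure_pmf mu) (\<lambda>e. E n (\<lambda>es. of_bool (x - e \<in> trail es \<and> y - e \<in> trail es)))"
        by (rule integrable_step[where B = 1]) (use E_of_bool_bounds in auto)
      fix e
      have "y - e - (x - e) = y - x" "x - e - (y - e) = x - y" by simp_all
      then show "E n (\<lambda>es. of_bool (x - e \<in> trail es \<and> y - e \<in> trail es))
          \<le> hit n (x - e) * hit n (y - x) + hit n (y - e) * hit n (x - y)"
        using Suc.IH[of "x - e" "y - e"] by simp
    qed
    also have "\<dots> = hit (Suc n) x * hit n (y - x) + hit (Suc n) y * hit n (x - y)"
      using 3 by (subst Bochner_Integration.integral_add) (use int in \<open>auto simp: hit_Suc\<close>)
    also have "\<dots> \<le> hit (Suc n) x * hit (Suc n) (y - x) + hit (Suc n) y * hit (Suc n) (x - y)"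
      by (intro add_mono mult_left_mono hit_mono_Suc hit_bounds)
    finally show ?thesis .
  qed
qed

text \<open>The difference \<open>q 0 t x - q 0 (Suc t) x\<close> is the probability that the first
  visit to \<open>x\<close> happens at time t + 1. The other r visits are then returns to the start
  of a walk of k - (t + 1) steps.\<close>

lemma first_passage:
  "q (Suc r) k x = (\<Sum>t<k. (q 0 t x - q 0 (Suc t) x) * q r (k - Suc t) 0)"
proof (induction k arbitrary: x)
  case 0
  then show ?case by (simp add: q_0)
next
  case (Suc k)
  let ?g = "\<lambda>t e. if e = x then 0 else q 0 t (x - e)"
  have int: "integrable (measure_pmf mu) (?g t)" for t
    by (rule integrable_step[where B = 1]) (use q_bounds in auto)
  have int': "integrable (measure_pmf mu) (\<lambda>e. of_bool (e = x) :: real)"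
    by (rule integrable_step[where B = 1]) auto
  have one: "q 0 (Suc 0) x = 1 - E1 (\<lambda>e. of_bool (e = x))"
  proof -
    have "q 0 (Suc 0) x = E1 (\<lambda>e. 1 - of_bool (e = x))"
      unfolding q_Suc_0 by (intro Bochner_Integration.integral_cong) (auto simp: q_0)
    then show ?thesis
      using int' by (simp add: Bochner_Integration.integral_diff)
  qed
  have "q (Suc r) (Suc k) x = E1 (\<lambda>e. of_bool (e = x) * q r k 0
      + (\<Sum>t<k. (?g t e - ?g (Suc t) e) * q r (k - Suc t) 0))"
    unfolding q_Suc_Suc by (intro Bochner_Integration.integral_cong) (auto simp: Suc.IH)
  also have "\<dots> = E1 (\<lambda>e. of_bool (e = x)) * q r k 0
      + (\<Sum>t<k. (E1 (?g t) - E1 (?g (Suc t))) * q r (k - Suc t) 0)"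
    using int int'
    by (subst Bochner_Integration.integral_add)
       (simp_all add: Bochner_Integration.integral_sum Bochner_Integration.integral_diff)
  also have "\<dots> = (\<Sum>t<Suc k. (q 0 t x - q 0 (Suc t) x) * q r (Suc k - Suc t) 0)"
    by (subst sum.lessThan_Suc_shift) (simp add: q_Suc_0[symmetric] one, simp add: q_0)
  finally show ?case .
qed

section \<open>Expected number of points visited at least m times\<close>

definition A :: "nat \<Rightarrow> nat \<Rightarrow> real" where
  "A m n = E n (\<lambda>es. real (popular m es))"

lemma A_0: "m \<ge> 1 \<Longrightarrow> A m 0 = 0"
  by (simp add: A_def popular_def)

lemma A_Suc: "m \<ge> 1 \<Longrightarrow> A m (Suc n) = A m n + q (m - 1) n 0"
proof -
  assume m: "m \<ge> 1"
  have *: "\<bar>real (popular m es)\<bar> \<le> real (length es)" for es :: "'a list"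
    using popular_le[OF m, of es] by simp
  have "A m (Suc n) = E1 (\<lambda>e. E n (\<lambda>ys. real (popular m (e # ys))))"
    unfolding A_def by (rule E_Suc[where B = "real (Suc n)"]) (use * in metis)
  also have "\<dots> = E n (\<lambda>ys. real (popular m ys) + of_bool (visits ys 0 = m - 1))"
    using m by (simp add: popular_Cons)
  also have "\<dots> = A m n + q (m - 1) n 0"
    unfolding A_def q_def
  proof (rule Bochner_Integration.integral_add)
    show "integrable (measure_pmf (replicate_pmf n mu)) (\<lambda>es. real (popular m es))"
      by (rule integrable_walk[where B = "real n"]) (use * in metis)
    show "integrable (measure_pmf (replicate_pmf n mu)) (\<lambda>es. of_bool (visits es 0 = m - 1) :: real)"
      by (rule integrable_walk[where B = 1]) simp
  qed
  finally show ?thesis .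
qed

lemma A_nonneg: "0 \<le> A m n"
  unfolding A_def by (rule E_nonneg) simp

lemma A_mono: "m \<ge> 1 \<Longrightarrow> k \<le> n \<Longrightarrow> A m k \<le> A m n"
proof -
  assume m: "m \<ge> 1" and "k \<le> n"
  have "A m i \<le> A m (Suc i)" for i using A_Suc[OF m] q_bounds by simp
  then show ?thesis using \<open>k \<le> n\<close> lift_Suc_mono_le[of "A m"] by blast
qed

lemma A_1: "A 1 n = (\<Sum>k<n. p k)"
  by (induction n) (use A_0[of 1] A_Suc[of 1] in \<open>auto simp: p_def\<close>)

text \<open>The renewal equation: \<open>p t - p (Suc t)\<close> is the probability of a first
  return at time t + 1. Both sides vanish at n = 0, and their increments in n agree by
  \<open>A_Suc\<close> and \<open>first_passage\<close>.\<close>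

lemma A_convolution:
  assumes "m \<ge> 1"
  shows "A (Suc m) n = (\<Sum>t<n. (p t - p (Suc t)) * A m (n - Suc t))"
proof (induction n)
  case 0
  then show ?case by (simp add: A_0)
next
  case (Suc n)
  obtain r where m: "m = Suc r" using assms by (cases m) auto
  have "A (Suc m) (Suc n) = A (Suc m) n + q (Suc r) n 0"
    by (subst A_Suc) (simp_all add: m)
  also have "\<dots> = (\<Sum>t<n. (p t - p (Suc t)) * (A m (n - Suc t) + q r (n - Suc t) 0))"
    unfolding Suc.IH first_passage p_def
    by (simp add: sum.distrib[symmetric] algebra_simps)
  also have "\<dots> = (\<Sum>t<n. (p t - p (Suc t)) * A m (Suc n - Suc t))"
  proof (intro sum.cong refl)
    fix t assume "t \<in> {..<n}"
    then have "Suc n - Suc t = Suc (n - Suc t)" by auto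
    then show "(p t - p (Suc t)) * (A m (n - Suc t) + q r (n - Suc t) 0)
        = (p t - p (Suc t)) * A m (Suc n - Suc t)"
      using A_Suc[OF assms, of "n - Suc t"] by (simp add: m)
  qed
  also have "\<dots> = (\<Sum>t<Suc n. (p t - p (Suc t)) * A m (Suc n - Suc t))"
    using assms by (simp add: A_0)
  finally show ?case .
qed

lemma sum_p_diff: "(\<Sum>t<n. p t - p (Suc t)) = 1 - p n"
  by (induction n) (auto simp: p_def q_0)

text \<open>In the renewal equation every remaining time is at most n, and the weights telescope to
  \<open>1 - p n\<close>.\<close>

lemma A_Suc_le:
  assumes "m \<ge> 1"
  shows "A (Suc m) n \<le> (1 - p n) * A m n"
proof -
  have "A (Suc m) n \<le> (\<Sum>t<n. (p t - p (Suc t)) * A m n)"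
    unfolding A_convolution[OF assms]
    by (intro sum_mono mult_left_mono A_mono assms) (auto simp: p_antimono)
  then show ?thesis by (simp add: sum_distrib_right[symmetric] sum_p_diff)
qed

text \<open>Only first returns within k steps are kept; each leaves at least n - k steps. For k > n
  the truncated subtraction makes the left side 0.\<close>

lemma A_Suc_ge:
  assumes "m \<ge> 1"
  shows "(1 - p k) * A m (n - k) \<le> A (Suc m) n"
proof (cases "k \<le> n")
  case True
  have "(1 - p k) * A m (n - k) = (\<Sum>t<k. (p t - p (Suc t)) * A m (n - k))"
    by (simp add: sum_distrib_right[symmetric] sum_p_diff)
  also have "\<dots> \<le> (\<Sum>t<k. (p t - p (Suc t)) * A m (n - Suc t))"
    by (intro sum_mono mult_left_mono A_mono assms) (auto simp: p_antimono)
  also have "\<dots> \<le> (\<Sum>t<n. (p t - p (Suc t)) * A m (n - Suc t))"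
    by (intro sum_mono2) (use True in \<open>auto simp: p_antimono A_nonneg\<close>)
  finally show ?thesis using A_convolution[OF assms] by simp
next
  case False
  then show ?thesis using A_0[OF assms] A_nonneg by simp
qed

lemma A_le_power: "A (Suc m) n \<le> (1 - p n) ^ m * A 1 n"
proof (induction m)
  case (Suc m)
  have "A (Suc (Suc m)) n \<le> (1 - p n) * A (Suc m) n" by (rule A_Suc_le) simp
  also have "\<dots> \<le> (1 - p n) * ((1 - p n) ^ m * A 1 n)"
    using Suc p_bounds[of n] by (intro mult_left_mono) auto
  finally show ?case by (simp add: mult_ac)
qed simp

text \<open>Granting k steps to each of m returns uses up m k steps. A small k wastes little time, a
  large one lowers \<open>p k\<close>; \<open>cutoff\<close> will balance the two.\<close>

lemma A_ge_power: "(1 - p k) ^ m * A 1 (n - m * k) \<le> A (Suc m) n"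
proof (induction m arbitrary: n)
  case (Suc m)
  have "(1 - p k) ^ Suc m * A 1 (n - Suc m * k) = (1 - p k) * ((1 - p k) ^ m * A 1 (n - k - m * k))"
    by (simp add: diff_diff_left mult_ac)
  also have "\<dots> \<le> (1 - p k) * A (Suc m) (n - k)"
    using Suc[of "n - k"] p_bounds[of k] by (intro mult_left_mono) simp_all
  also have "\<dots> \<le> A (Suc (Suc m)) n" by (rule A_Suc_ge) simp
  finally show ?case .
qed simp

lemma A_1_ge: "real n * p n \<le> A 1 n"
proof -
  have "(\<Sum>k<n. p n) \<le> (\<Sum>k<n. p k)" by (intro sum_mono p_antimono) simp
  then show ?thesis unfolding A_1 by simp
qed

lemma A_1_diff_le: "A 1 n - A 1 (n - j) \<le> real j"
proof -
  have "A 1 (k + j) \<le> A 1 k + real j" for k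
    unfolding A_1 by (induction j) (use p_bounds in \<open>auto intro: add_mono order.trans\<close>)
  from this[of "n - j"] show ?thesis
    using A_mono[of 1 n "n - j + j"] by (cases "j \<le> n") auto
qed

text \<open>\<open>A 1\<close> starts at 0 and has the decreasing increments \<open>p\<close>, so
  A_1(n) / n is nonincreasing. This compares neighbouring times when the gaps are filled.\<close>

lemma A_1_concave: "n \<le> n' \<Longrightarrow> real n * A 1 n' \<le> real n' * A 1 n"
proof (induction n' rule: dec_induct)
  case (step k)
  have "real n * p k \<le> A 1 n"
    using A_1_ge[of n] mult_left_mono[OF p_antimono[OF step(1)], of "real n"] by simp
  then show ?case using step.IH unfolding A_1 by (simp add: algebra_simps)
qed simp

end

section \<open>Variance of the number of popular points\<close>

lemma nn_integral_count_space_mult: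
  "(\<integral>\<^sup>+x. f x \<partial>count_space A) * (\<integral>\<^sup>+y. g y \<partial>count_space B)
   = (\<integral>\<^sup>+x. \<integral>\<^sup>+y. f x * g y \<partial>count_space B \<partial>count_space A)"
  by (simp add: nn_integral_cmult nn_integral_multc)

lemma nn_integral_count_space_minus:
  fixes f :: "'a::ab_group_add \<Rightarrow> ennreal"
  shows "(\<integral>\<^sup>+x. f (- x) \<partial>count_space UNIV) = (\<integral>\<^sup>+x. f x \<partial>count_space UNIV)"
  by (rule nn_integral_bij_count_space, rule bij_betwI[where g = uminus]) auto

lemma nn_integral_count_space_shift:
  fixes f :: "'a::ab_group_add \<Rightarrow> ennreal"
  shows "(\<integral>\<^sup>+x. f (x - a) \<partial>count_space UNIV) = (\<integral>\<^sup>+x. f x \<partial>count_space UNIV)"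
  by (rule nn_integral_bij_count_space[where g = "\<lambda>x. x - a"],
      rule bij_betwI[where g = "\<lambda>x. x + a"]) auto

lemma map_rev_replicate_pmf: "map_pmf rev (replicate_pmf n p) = replicate_pmf n p"
proof (induction n)
  case (Suc n)
  have "map_pmf rev (replicate_pmf (n + 1) p)
      = bind_pmf (replicate_pmf n p) (\<lambda>xs. map_pmf (\<lambda>x. x # rev xs) p)"
    unfolding replicate_pmf_distrib[of n 1 p] replicate_pmf_1
    by (simp add: map_bind_pmf map_pmf_def bind_assoc_pmf bind_return_pmf)
  also have "\<dots> = bind_pmf (map_pmf rev (replicate_pmf n p)) (\<lambda>xs. bind_pmf p (\<lambda>x. return_pmf (x # xs)))"
    by (simp add: bind_map_pmf map_pmf_def[of _ p])
  also have "\<dots> = replicate_pmf (Suc n) p"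
    unfolding Suc.IH by (subst bind_commute_pmf) (simp add: map_pmf_def)
  finally show ?case by simp
qed simp

context random_walk
begin

lemma E_of_bool_eq_prob: "E n (\<lambda>es. of_bool (P es)) = measure_pmf.prob (replicate_pmf n mu) {es. P es}"
proof -
  have "E n (\<lambda>es. of_bool (P es)) = E n (indicator {es. P es})"
    by (intro Bochner_Integration.integral_cong) (auto simp: indicator_def)
  then show ?thesis by simp
qed

lemma ennreal_E_of_bool:
  "ennreal (E n (\<lambda>es. of_bool (P es))) = (\<integral>\<^sup>+es. of_bool (P es) \<partial>measure_pmf (replicate_pmf n mu))"
proof -
  have "(\<integral>\<^sup>+es. of_bool (P es) \<partial>measure_pmf (replicate_pmf n mu))
      = (\<integral>\<^sup>+es. indicator {es. P es} es \<partial>measure_pmf (replicate_pmf n mu))"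
    by (intro nn_integral_cong) (auto simp: indicator_def)
  then show ?thesis
    by (simp add: E_of_bool_eq_prob measure_pmf.emeasure_eq_measure)
qed

lemma u_eq_pmf: "u n x = pmf (map_pmf sum_list (replicate_pmf n mu)) x"
  unfolding u_def E_of_bool_eq_prob pmf_map by (simp add: vimage_def)

lemma nn_integral_u: "(\<integral>\<^sup>+x. ennreal (u n x) \<partial>count_space UNIV) = 1"
  unfolding u_eq_pmf nn_integral_pmf by (simp add: measure_pmf.emeasure_space_1[simplified])

definition hit_pair :: "nat \<Rightarrow> 'a \<Rightarrow> 'a \<Rightarrow> real" where
  "hit_pair n x y = E n (\<lambda>es. of_bool (x \<in> trail es \<and> y \<in> trail es))"

text \<open>Taken in \<open>ennreal\<close>, so that sums over lattice points can be interchanged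
  before they are known to be finite.\<close>

definition hit_sq :: "nat \<Rightarrow> ennreal" where
  "hit_sq n = (\<integral>\<^sup>+x. ennreal ((hit n x)\<^sup>2) \<partial>count_space UNIV)"

definition I2 :: "nat \<Rightarrow> real" where
  "I2 n = E n (\<lambda>xs. E n (\<lambda>ys. (real (collisions xs ys))\<^sup>2))"

text \<open>Squaring the bound of \<open>hit_pair_le\<close> leaves two products, each with a factor
  2. Summing a product over the point reached second, a translation gives one
  \<open>hit_sq n\<close>, and the sum over the other point gives the second.\<close>

lemma nn_integral_hit_pair_sq_le:
  "(\<integral>\<^sup>+x. \<integral>\<^sup>+y. ennreal ((hit_pair n x y)\<^sup>2) \<partial>count_space UNIV \<partial>count_space UNIV) \<le> 4 * (hit_sq n)\<^sup>2"
proof -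
  define h where "h x = ennreal ((hit n x)\<^sup>2)" for x
  have "ennreal ((hit_pair n x y)\<^sup>2) \<le> 2 * (h x * h (y - x)) + 2 * (h y * h (x - y))" for x y
  proof -
    let ?a = "hit n x * hit n (y - x)" and ?b = "hit n y * hit n (x - y)"
    have "(hit_pair n x y)\<^sup>2 \<le> (?a + ?b)\<^sup>2"
      using hit_pair_le[where n = n and x = x and y = y] E_of_bool_bounds(1)
      unfolding hit_pair_def by (intro power_mono) auto
    also have "\<dots> \<le> 2 * ?a\<^sup>2 + 2 * ?b\<^sup>2"
      using zero_le_power2[of "?a - ?b"] by (simp add: power2_sum power2_diff)
    finally have "ennreal ((hit_pair n x y)\<^sup>2) \<le> ennreal (2 * ?a\<^sup>2 + 2 * ?b\<^sup>2)"
      by (rule ennreal_leI)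
    also have "\<dots> = 2 * (h x * h (y - x)) + 2 * (h y * h (x - y))"
      by (simp add: h_def ennreal_plus ennreal_mult' power_mult_distrib)
    finally show ?thesis .
  qed
  then have "(\<integral>\<^sup>+x. \<integral>\<^sup>+y. ennreal ((hit_pair n x y)\<^sup>2) \<partial>count_space UNIV \<partial>count_space UNIV)
      \<le> (\<integral>\<^sup>+x. \<integral>\<^sup>+y. 2 * (h x * h (y - x)) + 2 * (h y * h (x - y)) \<partial>count_space UNIV \<partial>count_space UNIV)"
    by (intro nn_integral_mono) auto
  also have "\<dots> = 2 * (\<integral>\<^sup>+x. \<integral>\<^sup>+y. h x * h (y - x) \<partial>count_space UNIV \<partial>count_space UNIV)
      + 2 * (\<integral>\<^sup>+x. \<integral>\<^sup>+y. h y * h (x - y) \<partial>count_space UNIV \<partial>count_space UNIV)"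
    by (simp add: nn_integral_add nn_integral_cmult)
  also have "(\<integral>\<^sup>+x. \<integral>\<^sup>+y. h y * h (x - y) \<partial>count_space UNIV \<partial>count_space UNIV)
      = (\<integral>\<^sup>+y. \<integral>\<^sup>+x. h y * h (x - y) \<partial>count_space UNIV \<partial>count_space UNIV)"
    by (rule nn_integral_count_space_nn_integral) auto
  also have "(\<integral>\<^sup>+x. \<integral>\<^sup>+y. h x * h (y - x) \<partial>count_space UNIV \<partial>count_space UNIV) = hit_sq n * hit_sq n"
    by (simp add: nn_integral_cmult nn_integral_multc nn_integral_count_space_shift[where f = h] hit_sq_def h_def[symmetric])
  also have "2 * (hit_sq n * hit_sq n) + 2 * (hit_sq n * hit_sq n) = 4 * (hit_sq n)\<^sup>2"
    by (simp add: power2_eq_square distrib_right[symmetric])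
  finally show ?thesis .
qed

lemma E_rev: "E n (\<lambda>es. F (rev es)) = E n F"
  by (subst (2) map_rev_replicate_pmf[symmetric]) simp

text \<open>The squared number of collisions is a double sum over displacements \<open>z\<close> and
  \<open>w\<close>. Reversing the first half turns the condition on the end point plus
  \<open>z\<close> into one on \<open>- z\<close>, and independence of the halves factors each term
  into \<open>hit_pair n (- z) (- w) * hit_pair n z w\<close>.\<close>

lemma I2_le: "ennreal (I2 n) \<le> 4 * (hit_sq n)\<^sup>2"
proof -
  define a :: "'a list \<Rightarrow> 'a \<Rightarrow> 'a \<Rightarrow> ennreal"
    where "a xs z w = of_bool (- z \<in> trail (rev xs) \<and> - w \<in> trail (rev xs))" for xs z w
  define b :: "'a list \<Rightarrow> 'a \<Rightarrow> 'a \<Rightarrow> ennreal"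
    where "b ys z w = of_bool (z \<in> trail ys \<and> w \<in> trail ys)" for ys z w
  have coll_sq: "ennreal ((real (collisions xs ys))\<^sup>2)
      = (\<integral>\<^sup>+z. \<integral>\<^sup>+w. a xs z w * b ys z w \<partial>count_space UNIV \<partial>count_space UNIV)" for xs ys
  proof -
    define Z where "Z = {z \<in> trail ys. - z \<in> trail (rev xs)}"
    have "collisions xs ys = card Z"
      by (simp add: collisions_def Z_def mem_trail_rev)
    moreover have "finite Z" by (simp add: Z_def)
    ultimately have "ennreal (real (collisions xs ys)) = (\<integral>\<^sup>+z. indicator Z z \<partial>count_space UNIV)"
      by (simp add: ennreal_of_nat_eq_real_of_nat)
    then have "ennreal ((real (collisions xs ys))\<^sup>2)
        = (\<integral>\<^sup>+z. indicator Z z \<partial>count_space UNIV) * (\<integral>\<^sup>+w. indicator Z w \<partial>count_space UNIV)"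
      by (simp add: power2_eq_square ennreal_mult' del: nn_integral_indicator)
    also have "\<dots> = (\<integral>\<^sup>+z. \<integral>\<^sup>+w. a xs z w * b ys z w \<partial>count_space UNIV \<partial>count_space UNIV)"
      unfolding nn_integral_count_space_mult
      by (intro nn_integral_cong) (auto simp: a_def b_def Z_def indicator_def)
    finally show ?thesis .
  qed
  let ?P = "measure_pmf (replicate_pmf n mu)"
  have swap: "(\<integral>\<^sup>+es. (\<integral>\<^sup>+z. \<integral>\<^sup>+w. g es z w \<partial>count_space UNIV \<partial>count_space UNIV) \<partial>?P)
      = (\<integral>\<^sup>+z. \<integral>\<^sup>+w. (\<integral>\<^sup>+es. g es z w \<partial>?P) \<partial>count_space UNIV \<partial>count_space UNIV)"
    for g :: "'a list \<Rightarrow> 'a \<Rightarrow> 'a \<Rightarrow> ennreal"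
  proof -
    have "(\<integral>\<^sup>+es. (\<integral>\<^sup>+z. \<integral>\<^sup>+w. g es z w \<partial>count_space UNIV \<partial>count_space UNIV) \<partial>?P)
        = (\<integral>\<^sup>+z. (\<integral>\<^sup>+es. \<integral>\<^sup>+w. g es z w \<partial>count_space UNIV \<partial>?P) \<partial>count_space UNIV)"
      by (rule nn_integral_count_space_nn_integral) auto
    also have "\<dots> = (\<integral>\<^sup>+z. \<integral>\<^sup>+w. (\<integral>\<^sup>+es. g es z w \<partial>?P) \<partial>count_space UNIV \<partial>count_space UNIV)"
      by (intro nn_integral_cong nn_integral_count_space_nn_integral) auto
    finally show ?thesis .
  qed
  have law_b: "(\<integral>\<^sup>+ys. b ys z w \<partial>?P) = ennreal (hit_pair n z w)" for z w
    unfolding b_def hit_pair_def ennreal_E_of_bool ..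
  have law_a: "(\<integral>\<^sup>+xs. a xs z w \<partial>?P) = ennreal (hit_pair n (- z) (- w))" for z w
    unfolding a_def hit_pair_def ennreal_E_of_bool[symmetric]
    by (subst E_rev[where F = "\<lambda>es. of_bool (- z \<in> trail es \<and> - w \<in> trail es)"]) (rule refl)
  have bd: "(real (collisions xs ys))\<^sup>2 \<le> (real (Suc n))\<^sup>2" if "length ys = n" for xs ys :: "'a list"
    using collisions_le[of xs ys] that by (intro power_mono) auto
  have inner: "ennreal (E n (\<lambda>ys. (real (collisions xs ys))\<^sup>2))
      = (\<integral>\<^sup>+ys. ennreal ((real (collisions xs ys))\<^sup>2) \<partial>?P)" for xs
    by (rule nn_integral_eq_integral[symmetric])
       (use bd in \<open>auto intro!: integrable_walk[where B = "(real (Suc n))\<^sup>2"] simp del: of_nat_Suc\<close>)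
  have "E n (\<lambda>ys. (real (collisions xs ys))\<^sup>2) \<le> E n (\<lambda>ys. (real (Suc n))\<^sup>2)" for xs
    by (rule E_mono[where B = "(real (Suc n))\<^sup>2" and B' = "(real (Suc n))\<^sup>2"])
       (use bd in \<open>auto simp del: of_nat_Suc\<close>)
  then have "E n (\<lambda>ys. (real (collisions xs ys))\<^sup>2) \<le> (real (Suc n))\<^sup>2" for xs by simp
  then have "ennreal (I2 n) = (\<integral>\<^sup>+xs. ennreal (E n (\<lambda>ys. (real (collisions xs ys))\<^sup>2)) \<partial>?P)"
    unfolding I2_def
    by (intro nn_integral_eq_integral[symmetric] integrable_walk[where B = "(real (Suc n))\<^sup>2"])
       (simp_all add: E_nonneg del: of_nat_Suc)
  also have "\<dots> = (\<integral>\<^sup>+xs. (\<integral>\<^sup>+ys. (\<integral>\<^sup>+z. \<integral>\<^sup>+w. a xs z w * b ys z w \<partial>count_space UNIV \<partial>count_space UNIV) \<partial>?P) \<partial>?P)"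
    by (simp only: inner coll_sq)
  also have "\<dots> = (\<integral>\<^sup>+xs. (\<integral>\<^sup>+z. \<integral>\<^sup>+w. (\<integral>\<^sup>+ys. a xs z w * b ys z w \<partial>?P) \<partial>count_space UNIV \<partial>count_space UNIV) \<partial>?P)"
    by (subst swap) (rule refl)
  also have "\<dots> = (\<integral>\<^sup>+z. \<integral>\<^sup>+w. (\<integral>\<^sup>+xs. \<integral>\<^sup>+ys. a xs z w * b ys z w \<partial>?P \<partial>?P) \<partial>count_space UNIV \<partial>count_space UNIV)"
    by (rule swap)
  also have "\<dots> = (\<integral>\<^sup>+z. \<integral>\<^sup>+w. (\<integral>\<^sup>+xs. a xs z w \<partial>?P) * (\<integral>\<^sup>+ys. b ys z w \<partial>?P) \<partial>count_space UNIV \<partial>count_space UNIV)"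
    by (simp add: nn_integral_cmult nn_integral_multc)
  also have "\<dots> = (\<integral>\<^sup>+z. \<integral>\<^sup>+w. ennreal (hit_pair n (- z) (- w)) * ennreal (hit_pair n z w) \<partial>count_space UNIV \<partial>count_space UNIV)"
    by (simp only: law_a law_b)
  \<comment> \<open>The walk is not assumed symmetric, so the two factors may differ. The inequality
    a b <= (a^2 + b^2) / 2 separates them, and reflecting both variables shows that the two
    resulting sums are equal.\<close>
  also have "\<dots> \<le> (\<integral>\<^sup>+z. \<integral>\<^sup>+w. ennreal (1/2) * ennreal ((hit_pair n (- z) (- w))\<^sup>2)
            + ennreal (1/2) * ennreal ((hit_pair n z w)\<^sup>2) \<partial>count_space UNIV \<partial>count_space UNIV)"
  proof (intro nn_integral_mono)
    fix z w
    let ?s = "hit_pair n (- z) (- w)" and ?t = "hit_pair n z w"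
    have "?s * ?t \<le> 1/2 * ?s\<^sup>2 + 1/2 * ?t\<^sup>2"
      using zero_le_power2[of "?s - ?t"] by (simp add: power2_diff)
    then have "ennreal (?s * ?t) \<le> ennreal (1/2 * ?s\<^sup>2 + 1/2 * ?t\<^sup>2)" by (rule ennreal_leI)
    moreover have "ennreal ?s * ennreal ?t = ennreal (?s * ?t)"
      by (rule ennreal_mult[symmetric]) (auto simp: hit_pair_def E_of_bool_bounds)
    moreover have "ennreal (1/2 * ?s\<^sup>2 + 1/2 * ?t\<^sup>2) = ennreal (1/2) * ennreal (?s\<^sup>2) + ennreal (1/2) * ennreal (?t\<^sup>2)"
      by (simp only: ennreal_mult[of "1/2", symmetric] ennreal_plus[symmetric] zero_le_power2 mult_nonneg_nonneg
          zero_le_divide_1_iff zero_le_numeral)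
    ultimately show "ennreal ?s * ennreal ?t \<le> ennreal (1/2) * ennreal (?s\<^sup>2) + ennreal (1/2) * ennreal (?t\<^sup>2)"
      using ennreal_leI by metis
  qed
  also have "\<dots> = ennreal (1/2) * (\<integral>\<^sup>+z. \<integral>\<^sup>+w. ennreal ((hit_pair n (- z) (- w))\<^sup>2) \<partial>count_space UNIV \<partial>count_space UNIV)
     + ennreal (1/2) * (\<integral>\<^sup>+z. \<integral>\<^sup>+w. ennreal ((hit_pair n z w)\<^sup>2) \<partial>count_space UNIV \<partial>count_space UNIV)"
    by (simp add: nn_integral_add nn_integral_cmult)
  also have "(\<integral>\<^sup>+z. \<integral>\<^sup>+w. ennreal ((hit_pair n (- z) (- w))\<^sup>2) \<partial>count_space UNIV \<partial>count_space UNIV)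
      = (\<integral>\<^sup>+z. \<integral>\<^sup>+w. ennreal ((hit_pair n z w)\<^sup>2) \<partial>count_space UNIV \<partial>count_space UNIV)"
    by (simp add: nn_integral_count_space_minus[where f = "\<lambda>w. ennreal ((hit_pair n z w)\<^sup>2)" for z]
        nn_integral_count_space_minus[where f = "\<lambda>z. \<integral>\<^sup>+w. ennreal ((hit_pair n z w)\<^sup>2) \<partial>count_space UNIV"])
  also have "ennreal (1/2) * K + ennreal (1/2) * K = K" for K
    by (simp only: distrib_right[symmetric] ennreal_plus[symmetric] zero_le_divide_1_iff zero_le_numeral) simp
  also note nn_integral_hit_pair_sq_le
  finally show ?thesis .
qed

definition V :: "nat \<Rightarrow> nat \<Rightarrow> real" where
  "V m n = E n (\<lambda>es. (real (popular m es) - A m n)\<^sup>2)"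

lemma I2_nonneg: "0 \<le> I2 n"
  unfolding I2_def by (intro E_nonneg) simp

lemma V_nonneg: "0 \<le> V m n"
  unfolding V_def by (intro E_nonneg) simp

lemma A_le: "m \<ge> 1 \<Longrightarrow> A m n \<le> real n"
proof -
  assume m: "m \<ge> 1"
  have "A m n \<le> E n (\<lambda>_. real n)"
    unfolding A_def by (rule E_mono[where B = "real n" and B' = "real n"]) (use popular_le[OF m] in force)+
  then show ?thesis by simp
qed

lemma popular_dev_le:
  assumes "m \<ge> 1" "length es = n"
  shows "\<bar>real (popular m es) - A m n\<bar> \<le> real n"
  using popular_le[OF assms(1), of es] A_le[OF assms(1), of n] A_nonneg[of m n] assms(2) by linarith

lemma E_dev:
  assumes "m \<ge> 1"
  shows "E n (\<lambda>es. real (popular m es) - A m n) = 0"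
  unfolding A_def
  by (subst Bochner_Integration.integral_diff)
     (use popular_le[OF assms] in \<open>auto intro!: integrable_walk[where B = "real n"]\<close>)

text \<open>The mean minimises the quadratic deviation. This allows a walk of length 2n to be
  centred at \<open>2 * A m n\<close> instead of its own mean.\<close>

lemma E_sq_shift_ge:
  assumes "m \<ge> 1"
  shows "V m n \<le> E n (\<lambda>es. (real (popular m es) - a)\<^sup>2)"
proof -
  define X where "X es = real (popular m es) - A m n" for es :: "'a list"
  define c where "c = A m n - a"
  have X: "\<bar>X es\<bar> \<le> real n" if "length es = n" for es
    using popular_dev_le[OF assms that] by (simp add: X_def)
  have X2: "(X es)\<^sup>2 \<le> (real n)\<^sup>2" if "length es = n" for es
    using power_mono[OF X[OF that], of 2] by simp
  have int: "integrable (measure_pmf (replicate_pmf n mu)) X"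
    "integrable (measure_pmf (replicate_pmf n mu)) (\<lambda>es. (X es)\<^sup>2)"
    by (rule integrable_walk[where B = "real n"], use X in simp)
       (rule integrable_walk[where B = "(real n)\<^sup>2"], use X2 in simp)
  have "E n (\<lambda>es. (real (popular m es) - a)\<^sup>2) = E n (\<lambda>es. (X es)\<^sup>2 + (2 * c * X es + c\<^sup>2))"
    by (intro Bochner_Integration.integral_cong) (auto simp: X_def c_def power2_eq_square algebra_simps)
  also have "\<dots> = V m n + (2 * c * E n X + c\<^sup>2)"
    using int by (simp add: V_def X_def[symmetric])
  also have "E n X = 0" using E_dev[OF assms] by (simp add: X_def[abs_def])
  finally show ?thesis by simp
qed

text \<open>The deviations of the two halves are independent and centred, so their sum has second
  moment twice \<open>V m n\<close>. The collision error is split off with weights 5/4 and 5; the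
  resulting factor 5/2 stays below the growth factor 3 in \<open>A_double\<close>.\<close>

lemma V_double:
  assumes "m \<ge> 1"
  shows "V m (n + n) \<le> 5/2 * V m n + 5 * I2 n"
proof -
  define X where "X es = real (popular m es) - A m n" for es :: "'a list"
  define c where "c xs ys = real (collisions xs ys)" for xs ys :: "'a list"
  have X: "\<bar>X es\<bar> \<le> real n" if "length es = n" for es
    using popular_dev_le[OF assms that] by (simp add: X_def)
  have X2: "(X es)\<^sup>2 \<le> (real n)\<^sup>2" if "length es = n" for es
    using power_mono[OF X[OF that], of 2] by simp
  have c2: "(c xs ys)\<^sup>2 \<le> (real (Suc n))\<^sup>2" if "length ys = n" for xs ys
    using collisions_le[of xs ys] that unfolding c_def by (intro power_mono) auto
  have int: "integrable (measure_pmf (replicate_pmf n mu)) X"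
    "integrable (measure_pmf (replicate_pmf n mu)) (\<lambda>es. (X es)\<^sup>2)"
    by (rule integrable_walk[where B = "real n"], use X in simp)
       (rule integrable_walk[where B = "(real n)\<^sup>2"], use X2 in simp)
  have intc: "integrable (measure_pmf (replicate_pmf n mu)) (\<lambda>ys. (c xs ys)\<^sup>2)" for xs
    by (rule integrable_walk[where B = "(real (Suc n))\<^sup>2"], use c2 in \<open>simp del: of_nat_Suc\<close>)
  have Ec: "E n (\<lambda>ys. (c xs ys)\<^sup>2) \<le> (real (Suc n))\<^sup>2" for xs
  proof -
    have "E n (\<lambda>ys. (c xs ys)\<^sup>2) \<le> E n (\<lambda>ys. (real (Suc n))\<^sup>2)"
      by (rule E_mono[where B = "(real (Suc n))\<^sup>2" and B' = "(real (Suc n))\<^sup>2"])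
         (use c2 in \<open>auto simp del: of_nat_Suc\<close>)
    then show ?thesis by simp
  qed
  have intEc: "integrable (measure_pmf (replicate_pmf n mu)) (\<lambda>xs. E n (\<lambda>ys. (c xs ys)\<^sup>2))"
    by (rule integrable_walk[where B = "(real (Suc n))\<^sup>2"]) (use Ec in \<open>simp add: E_nonneg del: of_nat_Suc\<close>)
  have EX: "E n X = 0" using E_dev[OF assms] by (simp add: X_def[abs_def])
  let ?F = "\<lambda>es. (real (popular m es) - 2 * A m n)\<^sup>2"
  have F: "?F es \<le> (2 * real n)\<^sup>2" if "length es = n + n" for es
  proof -
    have "\<bar>real (popular m es) - 2 * A m n\<bar> \<le> 2 * real n"
      using popular_le[OF assms, of es] A_le[OF assms, of n] A_nonneg[of m n] that by linarith
    from power_mono[OF this, of 2] show ?thesis by simp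
  qed
  have F': "?F (xs @ ys) \<le> (2 * real n)\<^sup>2" if "length xs = n" "length ys = n" for xs ys
    by (rule F) (simp add: that)
  let ?R = "\<lambda>xs ys. 5/4 * ((X xs)\<^sup>2 + 2 * X xs * X ys + (X ys)\<^sup>2) + 5 * (c xs ys)\<^sup>2"
  have pt: "?F (xs @ ys) \<le> ?R xs ys" for xs ys
  proof -
    define d where "d = real (popular m (xs @ ys)) - real (popular m xs) - real (popular m ys)"
    have "\<bar>d\<bar> \<le> c xs ys" using popular_append[OF assms, of xs ys] by (simp add: d_def c_def)
    then have d: "d\<^sup>2 \<le> (c xs ys)\<^sup>2" using power_mono[of "\<bar>d\<bar>" "c xs ys" 2] by simp
    define s where "s = X xs + X ys"
    have "?F (xs @ ys) = (s + d)\<^sup>2" by (simp add: d_def s_def X_def algebra_simps)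
    \<comment> \<open>This is (s / 2 - 2 d)^2 >= 0, expanded.\<close>
    also have "\<dots> \<le> 5/4 * s\<^sup>2 + 5 * d\<^sup>2"
      using zero_le_power2[of "s / 2 - 2 * d"] by (simp add: power2_eq_square algebra_simps)
    also have "\<dots> \<le> 5/4 * s\<^sup>2 + 5 * (c xs ys)\<^sup>2" using d by simp
    finally show ?thesis by (simp add: s_def power2_sum algebra_simps)
  qed
  have "V m (n + n) \<le> E (n + n) ?F" by (rule E_sq_shift_ge[OF assms])
  also have "\<dots> = E n (\<lambda>xs. E n (\<lambda>ys. ?F (xs @ ys)))"
    by (rule E_append[where B = "(2 * real n)\<^sup>2"]) (use F in simp)
  also have "\<dots> \<le> E n (\<lambda>xs. E n (\<lambda>ys. ?R xs ys))"
  proof (rule integral_mono_AE)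
    have bd: "E n (\<lambda>ys. ?F (xs @ ys)) \<le> E n (\<lambda>ys. (2 * real n)\<^sup>2)" if "length xs = n" for xs
      by (rule E_mono[where B = "(2 * real n)\<^sup>2" and B' = "(2 * real n)\<^sup>2"]) (use F' that in simp_all)
    show "integrable (measure_pmf (replicate_pmf n mu)) (\<lambda>xs. E n (\<lambda>ys. ?F (xs @ ys)))"
      by (rule integrable_walk[where B = "(2 * real n)\<^sup>2"]) (use bd in \<open>simp add: E_nonneg\<close>)
    show "integrable (measure_pmf (replicate_pmf n mu)) (\<lambda>xs. E n (\<lambda>ys. ?R xs ys))"
      using int intc intEc by simp
    show "AE xs in measure_pmf (replicate_pmf n mu). E n (\<lambda>ys. ?F (xs @ ys)) \<le> E n (\<lambda>ys. ?R xs ys)"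
      using AE_length
    proof (rule eventually_mono)
      fix xs :: "'a list" assume xs: "length xs = n"
      show "E n (\<lambda>ys. ?F (xs @ ys)) \<le> E n (\<lambda>ys. ?R xs ys)"
      proof (rule integral_mono)
        show "integrable (measure_pmf (replicate_pmf n mu)) (\<lambda>ys. ?F (xs @ ys))"
          by (rule integrable_walk[where B = "(2 * real n)\<^sup>2"]) (use F' xs in simp)
      qed (use int intc pt in auto)
    qed
  qed
  \<comment> \<open>The mixed term disappears because \<open>X\<close> has mean 0.\<close>
  also have "\<dots> = E n (\<lambda>xs. 5/4 * ((X xs)\<^sup>2 + V m n) + 5 * E n (\<lambda>ys. (c xs ys)\<^sup>2))"
    using int intc EX by (simp add: V_def X_def[symmetric])
  also have "\<dots> = 5/4 * (V m n + V m n) + 5 * I2 n"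
    using int intEc by (simp add: V_def X_def[symmetric] I2_def c_def)
  finally show ?thesis by simp
qed

end

section \<open>Collision moments under a uniform bound P(S_n = x) <= C / n\<close>

locale random_walk_bounded = random_walk mu for mu :: "'a::{ab_group_add,countable} pmf" +
  fixes C :: real
  assumes u_le: "n \<ge> 1 \<Longrightarrow> u n x \<le> C / real n"
begin

lemma C_nonneg: "C \<ge> 0"
  using u_le[of 1 0] u_bounds(1)[of 1 0] by simp

lemma nn_integral_G: "(\<integral>\<^sup>+x. ennreal (G n x) \<partial>count_space UNIV) = of_nat (Suc n)"
proof -
  have "(\<integral>\<^sup>+x. ennreal (G n x) \<partial>count_space UNIV) = (\<integral>\<^sup>+x. (\<Sum>j\<le>n. ennreal (u j x)) \<partial>count_space UNIV)"
    by (intro nn_integral_cong) (simp add: G_def u_bounds)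
  also have "\<dots> = of_nat (Suc n)"
    by (subst nn_integral_sum) (simp_all add: nn_integral_u)
  finally show ?thesis .
qed

text \<open>From n to n + 1 the square grows by at most 2 u_(n+1) G_(n+1) <= (2 C / (n + 1))
  G_(n+1). The total mass of G_(n+1) is n + 2 <= 2 (n + 1), so each step adds at most 4 C.\<close>

lemma nn_integral_G_sq: "(\<integral>\<^sup>+x. ennreal ((G n x)\<^sup>2) \<partial>count_space UNIV) \<le> ennreal (1 + 4 * C * real n)"
proof (induction n)
  case 0
  have "(\<integral>\<^sup>+x. ennreal ((G 0 x)\<^sup>2) \<partial>count_space UNIV) = (\<integral>\<^sup>+x. ennreal (u 0 x) \<partial>count_space UNIV)"
    by (intro nn_integral_cong) (simp add: G_def u_0)
  then show ?case by (simp add: nn_integral_u)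
next
  case (Suc n)
  let ?k = "2 * C / real (Suc n)"
  have "(G (Suc n) x)\<^sup>2 \<le> (G n x)\<^sup>2 + ?k * G (Suc n) x" for x
  proof -
    have eq: "G (Suc n) x = G n x + u (Suc n) x" by (simp add: G_def)
    have "(G (Suc n) x)\<^sup>2 \<le> (G n x)\<^sup>2 + 2 * u (Suc n) x * G (Suc n) x"
      unfolding eq by (simp add: power2_eq_square algebra_simps u_bounds)
    also have "\<dots> \<le> (G n x)\<^sup>2 + 2 * (C / real (Suc n)) * G (Suc n) x"
      by (intro add_left_mono mult_right_mono mult_left_mono u_le G_nonneg) auto
    finally show ?thesis by simp
  qed
  then have "(\<integral>\<^sup>+x. ennreal ((G (Suc n) x)\<^sup>2) \<partial>count_space UNIV)
      \<le> (\<integral>\<^sup>+x. ennreal ((G n x)\<^sup>2) + ennreal ?k * ennreal (G (Suc n) x) \<partial>count_space UNIV)"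
    by (intro nn_integral_mono)
       (simp add: ennreal_mult'[symmetric] ennreal_plus[symmetric] C_nonneg G_nonneg ennreal_leI del: ennreal_plus of_nat_Suc)
  also have "\<dots> = (\<integral>\<^sup>+x. ennreal ((G n x)\<^sup>2) \<partial>count_space UNIV) + ennreal ?k * of_nat (Suc (Suc n))"
    by (simp add: nn_integral_add nn_integral_cmult nn_integral_G del: of_nat_Suc)
  also have "\<dots> \<le> ennreal (1 + 4 * C * real n) + ennreal (?k * real (Suc (Suc n)))"
  proof (intro add_mono Suc)
    have "ennreal (?k * real (Suc (Suc n))) = ennreal ?k * ennreal (real (Suc (Suc n)))"
      by (rule ennreal_mult) (simp_all add: C_nonneg)
    then show "ennreal ?k * of_nat (Suc (Suc n)) \<le> ennreal (?k * real (Suc (Suc n)))"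
      by (simp only: ennreal_of_nat_eq_real_of_nat)
  qed
  also have "\<dots> \<le> ennreal (1 + 4 * C * real n + 4 * C)"
  proof -
    have "?k * real (Suc (Suc n)) \<le> 4 * C"
      using C_nonneg by (simp add: divide_simps algebra_simps)
    then show ?thesis
      using C_nonneg by (simp add: ennreal_plus[symmetric] ennreal_leI del: ennreal_plus)
  qed
  finally show ?case by (simp add: algebra_simps)
qed

lemma G_pos: "G n 0 \<ge> 1"
  using G_mono[of 0 n 0] by (simp add: G_def u_0)

text \<open>\<open>hit_mult_G_le\<close> with m = n bounds \<open>hit n x\<close> by
  \<open>G (n + n) x / G n 0\<close>. The sum of squares of the numerator is linear in n, and the
  denominator contributes the logarithms.\<close>

lemma hit_sq_le: "hit_sq n \<le> ennreal ((1 + 8 * C * real n) / (G n 0)\<^sup>2)"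
proof -
  have "(hit n x)\<^sup>2 \<le> (1 / (G n 0)\<^sup>2) * (G (n + n) x)\<^sup>2" for x
  proof -
    have "(hit n x * G n 0)\<^sup>2 \<le> (G (n + n) x)\<^sup>2"
      by (intro power_mono hit_mult_G_le mult_nonneg_nonneg hit_bounds G_nonneg)
    then show ?thesis using G_pos[of n] by (simp add: power_mult_distrib field_simps)
  qed
  then have "hit_sq n \<le> (\<integral>\<^sup>+x. ennreal (1 / (G n 0)\<^sup>2) * ennreal ((G (n + n) x)\<^sup>2) \<partial>count_space UNIV)"
    unfolding hit_sq_def by (intro nn_integral_mono) (simp add: ennreal_mult'[symmetric] ennreal_leI)
  also have "\<dots> = ennreal (1 / (G n 0)\<^sup>2) * (\<integral>\<^sup>+x. ennreal ((G (n + n) x)\<^sup>2) \<partial>count_space UNIV)"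
    by (simp add: nn_integral_cmult)
  also have "\<dots> \<le> ennreal (1 / (G n 0)\<^sup>2) * ennreal (1 + 4 * C * real (n + n))"
    by (intro mult_left_mono nn_integral_G_sq) simp
  also have "\<dots> = ennreal ((1 + 8 * C * real n) / (G n 0)\<^sup>2)"
    by (simp add: ennreal_mult'[symmetric] mult.assoc)
  finally show ?thesis .
qed

lemma I2_bound: "I2 n \<le> 4 * ((1 + 8 * C * real n) / (G n 0)\<^sup>2)\<^sup>2"
proof -
  have "ennreal (I2 n) \<le> 4 * (ennreal ((1 + 8 * C * real n) / (G n 0)\<^sup>2))\<^sup>2"
    using I2_le[of n] hit_sq_le[of n]
    by (meson mult_left_mono order.trans power_mono zero_le)
  also have "\<dots> = ennreal (4 * ((1 + 8 * C * real n) / (G n 0)\<^sup>2)\<^sup>2)"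
    using C_nonneg by (simp add: ennreal_power ennreal_mult')
  finally show ?thesis by simp
qed

end

section \<open>Asymptotics\<close>

text \<open>The logarithm of the power is -r x up to an error of order r x^2 = (r x) x, which tends
  to 0.\<close>

lemma power_one_minus_tendsto_exp:
  fixes x :: "nat \<Rightarrow> real" and r :: "nat \<Rightarrow> nat"
  assumes "x \<longlonglongrightarrow> 0" "\<And>n. x n \<ge> 0" "(\<lambda>n. real (r n) * x n) \<longlonglongrightarrow> v"
  shows "(\<lambda>n. (1 - x n) ^ r n) \<longlonglongrightarrow> exp (- v)"
proof (rule tendsto_sandwich)
  have ev: "eventually (\<lambda>n. x n \<le> 1/2) sequentially"
    using order_tendstoD(2)[OF assms(1), of "1/2"] by (auto elim!: eventually_mono)
  have pow: "(1 - x n) ^ r n = exp (real (r n) * ln (1 - x n))" if "x n \<le> 1/2" for n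
    using that by (simp add: exp_of_nat_mult)
  show "eventually (\<lambda>n. exp (- (real (r n) * x n) - 2 * (real (r n) * x n) * x n) \<le> (1 - x n) ^ r n) sequentially"
    using ev
  proof eventually_elim
    case (elim n)
    have "real (r n) * (- x n - 2 * (x n)\<^sup>2) \<le> real (r n) * ln (1 - x n)"
      using elim assms(2)[of n] by (intro mult_left_mono ln_one_minus_pos_lower_bound) auto
    then show ?case unfolding pow[OF elim] by (simp add: algebra_simps power2_eq_square)
  qed
  show "eventually (\<lambda>n. (1 - x n) ^ r n \<le> exp (- (real (r n) * x n))) sequentially"
    using ev
  proof eventually_elim
    case (elim n)
    have "real (r n) * ln (1 - x n) \<le> real (r n) * (- x n)"
      using elim assms(2)[of n] by (intro mult_left_mono ln_one_minus_pos_upper_bound) auto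
    then show ?case unfolding pow[OF elim] by simp
  qed
  show "(\<lambda>n. exp (- (real (r n) * x n) - 2 * (real (r n) * x n) * x n)) \<longlonglongrightarrow> exp (- v)"
    by (rule tendsto_eq_intros assms refl)+ simp
  show "(\<lambda>n. exp (- (real (r n) * x n))) \<longlonglongrightarrow> exp (- v)"
    by (intro tendsto_intros assms)
qed

text \<open>A partial sum S from some index J on satisfies S <= b_J + \<rho> S + T, where T is the
  tail sum of the errors. Moving \<rho> S to the left bounds S independently of the number of
  terms.\<close>

lemma summable_contracting_recursion:
  fixes b e :: "nat \<Rightarrow> real"
  assumes "\<And>j. b j \<ge> 0" "summable e" "\<And>j. e j \<ge> 0" "\<rho> < 1"
    and "eventually (\<lambda>j. b (Suc j) \<le> \<rho> * b j + e j) sequentially"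
  shows "summable b"
proof -
  obtain J where J: "\<And>j. j \<ge> J \<Longrightarrow> b (Suc j) \<le> \<rho> * b j + e j"
    using assms(5) unfolding eventually_sequentially by blast
  let ?T = "suminf (\<lambda>j. e (j + J))"
  have e: "summable (\<lambda>j. e (j + J))" using assms(2) by (simp add: summable_iff_shift)
  have bd: "(\<Sum>j<N. b (j + J)) \<le> (b J + ?T) / (1 - \<rho>)" for N
  proof -
    let ?S = "\<Sum>j<N. b (j + J)"
    have "?S \<le> (\<Sum>j<Suc N. b (j + J))" using assms(1) by simp
    also have "\<dots> = b J + (\<Sum>j<N. b (Suc (j + J)))" by (subst sum.lessThan_Suc_shift) simp
    also have "\<dots> \<le> b J + (\<Sum>j<N. \<rho> * b (j + J) + e (j + J))"
      by (intro add_left_mono sum_mono J) simp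
    also have "\<dots> = b J + \<rho> * ?S + (\<Sum>j<N. e (j + J))"
      by (simp add: sum.distrib sum_distrib_left)
    also have "(\<Sum>j<N. e (j + J)) \<le> ?T"
      by (rule sum_le_suminf[OF e]) (use assms(3) in auto)
    finally show ?thesis using assms(4) by (simp add: field_simps)
  qed
  have "summable (\<lambda>j. b (j + J))"
    by (rule summableI_nonneg_bounded[OF _ bd]) (use assms(1) in auto)
  then show ?thesis by (simp add: summable_iff_shift)
qed

section \<open>Asymptotics when the Green function at 0 grows like ln n / c\<close>

locale random_walk_log = random_walk_bounded mu C for mu :: "'a::{ab_group_add,countable} pmf" and C +
  fixes c :: real
  assumes c_pos: "c > 0" and G_asymp: "(\<lambda>n. G n 0 / ln (real n)) \<longlonglongrightarrow> 1 / c"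
begin

text \<open>The arithmetic of four estimates below, with N for n and L for ln n; stated over plain
  variables so that no rewriting of logarithms interferes.\<close>

lemma
  fixes N L P r a b G :: real
  assumes "N \<noteq> 0" "L \<noteq> 0"
  shows rescale_block_bound: "(N / L ^ 3 + N * P) * L / N = 1 / L ^ 2 + P * L"
    and rescale_overshoot: "a \<noteq> 0 \<Longrightarrow> r * (N / L ^ 3) / a = r / L * (1 / L) * (1 / (a * L / N))"
    and rescale_double: "P \<noteq> 0 \<Longrightarrow> a \<noteq> 0 \<Longrightarrow> (b * P / (N + N)) / (a * L / N) * (2 * L / P) = b / a"
    and rescale_collisions: "a \<noteq> 0 \<Longrightarrow> G \<noteq> 0 \<Longrightarrow> 4 * ((1 + 8 * P * N) / G\<^sup>2)\<^sup>2 / a\<^sup>2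
      = 4 * (1 / N + 8 * P)\<^sup>2 * (L / G) ^ 4 * (1 / (a * L / N))\<^sup>2 / L\<^sup>2"
  using assms by (simp_all add: field_simps power2_eq_square power3_eq_cube power4_eq_xxxx)

lemma ln_div_G: "(\<lambda>n. ln (real n) / G n 0) \<longlonglongrightarrow> c"
  using tendsto_inverse[OF G_asymp] c_pos by (simp add: field_simps)

lemma G_diff_le:
  assumes "K \<ge> 1"
  shows "G (n + K) 0 - G K 0 \<le> real n * C / real K"
proof -
  have "G (n + K) 0 = G K 0 + (\<Sum>j\<in>{K<..n + K}. u j 0)"
    unfolding G_def by (subst sum.union_disjoint[symmetric]) (auto intro!: sum.cong)
  moreover have "(\<Sum>j\<in>{K<..n + K}. u j 0) \<le> (\<Sum>j\<in>{K<..n + K}. C / real K)"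
  proof (rule sum_mono)
    fix j assume j: "j \<in> {K<..n + K}"
    then have "u j 0 \<le> C / real j" by (intro u_le) auto
    also have "\<dots> \<le> C / real K" using j assms C_nonneg by (intro divide_left_mono) auto
    finally show "u j 0 \<le> C / real K" .
  qed
  ultimately show ?thesis by simp
qed

lemma p_asymp: "(\<lambda>n. p n * ln (real n)) \<longlonglongrightarrow> c"
proof (rule tendsto_sandwich)
  \<comment> \<open>K is about n ln n. Then G(n + K) - G(K) <= n C / K <= C / ln n vanishes, while
    ln K ~ ln n, so \<open>G (K n) 0\<close> still behaves like ln n / c.\<close>
  define K where "K n = n * nat \<lceil>ln (real n)\<rceil>" for n :: nat
  have K_top: "filterlim K at_top sequentially"
  proof -
    have "eventually (\<lambda>n. n \<le> K n) sequentially"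
      using eventually_ge_at_top[of 3]
    proof eventually_elim
      case (elim n)
      have "exp 1 \<le> real n" using exp_le elim by linarith
      then have "1 \<le> ln (real n)" using elim by (subst ln_ge_iff) auto
      then have "1 \<le> nat \<lceil>ln (real n)\<rceil>" by linarith
      then show ?case unfolding K_def by simp
    qed
    then show ?thesis by (rule filterlim_at_top_mono[OF filterlim_ident])
  qed
  have lnK: "(\<lambda>n. ln (real n) / ln (real (K n))) \<longlonglongrightarrow> 1"
  proof (rule tendsto_sandwich)
    have ev: "eventually (\<lambda>n. 0 < ln (real n) \<and> ln (real n) \<le> ln (real (K n)) \<and>
        ln (real (K n)) \<le> ln (real n) + ln (ln (real n) + 1)) sequentially"
      using eventually_ge_at_top[of 3]
    proof eventually_elim
      case (elim n)
      have "exp 1 \<le> real n" using exp_le elim by linarith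
      then have 1: "1 \<le> ln (real n)" using elim by (subst ln_ge_iff) auto
      then have n: "1 \<le> real (nat \<lceil>ln (real n)\<rceil>)" by linarith
      have "ln (real (K n)) = ln (real n) + ln (real (nat \<lceil>ln (real n)\<rceil>))"
        unfolding K_def of_nat_mult using elim n by (intro ln_mult_pos) linarith+
      moreover have "ln (real (nat \<lceil>ln (real n)\<rceil>)) \<le> ln (ln (real n) + 1)"
        using n 1 by (subst ln_le_cancel_iff) linarith+
      ultimately show ?case using 1 n by simp
    qed
    show "eventually (\<lambda>n. ln (real n) / ln (real (K n)) \<le> 1) sequentially"
      using ev by eventually_elim (simp add: field_simps)
    show "eventually (\<lambda>n. ln (real n) / (ln (real n) + ln (ln (real n) + 1)) \<le> ln (real n) / ln (real (K n))) sequentially"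
      using ev by eventually_elim (auto intro!: divide_left_mono)
    show "(\<lambda>n. ln (real n) / (ln (real n) + ln (ln (real n) + 1))) \<longlonglongrightarrow> 1" by real_asymp
  qed simp
  have GK: "(\<lambda>n. ln (real (K n)) / G (K n) 0) \<longlonglongrightarrow> c"
    by (rule filterlim_compose[OF ln_div_G K_top])
  show "eventually (\<lambda>n. (1 - C / ln (real n)) * ((ln (real n) / ln (real (K n))) * (ln (real (K n)) / G (K n) 0)) \<le> p n * ln (real n)) sequentially"
    using eventually_ge_at_top[of 3]
  proof eventually_elim
    case (elim n)
    have "exp 1 \<le> real n" using exp_le elim by linarith
    then have 1: "1 \<le> ln (real n)" using elim by (subst ln_ge_iff) auto
    then have K1: "1 \<le> nat \<lceil>ln (real n)\<rceil>" by linarith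
    have KK: "K n \<ge> 3" using mult_le_mono[OF elim K1] by (simp add: K_def)
    have "G (n + K n) 0 - G (K n) 0 \<le> real n * C / real (K n)"
      using KK by (intro G_diff_le) auto
    also have "\<dots> = C / real (nat \<lceil>ln (real n)\<rceil>)" using elim by (simp add: K_def)
    also have "\<dots> \<le> C / ln (real n)" using 1 C_nonneg by (intro divide_left_mono) auto
    finally have "1 - C / ln (real n) \<le> p n * G (K n) 0" using p_G_ge[of n "K n"] by linarith
    then have "(1 - C / ln (real n)) * (ln (real n) / G (K n) 0) \<le> p n * G (K n) 0 * (ln (real n) / G (K n) 0)"
      using 1 G_nonneg by (intro mult_right_mono) auto
    moreover have "ln (real (K n)) > 0" using KK by simp
    ultimately show ?case using G_pos[of "K n"] by simp
  qed
  show "(\<lambda>n. (1 - C / ln (real n)) * ((ln (real n) / ln (real (K n))) * (ln (real (K n)) / G (K n) 0))) \<longlonglongrightarrow> c"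
  proof -
    have "(\<lambda>n. 1 - C / ln (real n)) \<longlonglongrightarrow> 1" by real_asymp
    from tendsto_mult[OF this tendsto_mult[OF lnK GK]] show ?thesis by simp
  qed
  show "eventually (\<lambda>n. p n * ln (real n) \<le> ln (real n) / G n 0) sequentially"
    using eventually_ge_at_top[of 1]
  proof eventually_elim
    case (elim n)
    have "p n \<le> 1 / G n 0" using p_G_le[of n] G_pos[of n] by (simp add: field_simps)
    from mult_right_mono[OF this, of "ln (real n)"] show ?case using elim by simp
  qed
qed (rule ln_div_G)

text \<open>Long enough that ln of it is asymptotic to ln n, so that \<open>p (cutoff n)\<close> ~ c
  / ln n; short enough that order ln n pieces of this length take only O(n / ln^2 n) steps,
  negligible against A_1(n) ~ c n / ln n.\<close>

definition cutoff :: "nat \<Rightarrow> nat" where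
  "cutoff n = nat \<lfloor>real n / ln (real n) ^ 3\<rfloor>"

lemma cutoff_le: "eventually (\<lambda>n. real (cutoff n) \<le> real n / ln (real n) ^ 3) sequentially"
  using eventually_ge_at_top[of 3]
  by eventually_elim (simp add: cutoff_def)

lemma p_cutoff: "(\<lambda>n. p (cutoff n) * ln (real n)) \<longlonglongrightarrow> c"
proof -
  have lower: "eventually (\<lambda>n. real n / ln (real n) ^ 3 - 1 \<le> real (cutoff n)) sequentially"
    unfolding cutoff_def by (intro always_eventually allI) linarith
  have "filterlim (\<lambda>n. real (cutoff n)) at_top sequentially"
    by (rule filterlim_at_top_mono[OF _ lower]) real_asymp
  then have top: "filterlim cutoff at_top sequentially"
    using filterlim_sequentially_iff_filterlim_real by blast
  have ratio: "(\<lambda>n. ln (real n) / ln (real (cutoff n))) \<longlonglongrightarrow> 1"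
  proof (rule tendsto_sandwich)
    have big: "eventually (\<lambda>n. real n / ln (real n) ^ 3 - 1 > 1) sequentially" by real_asymp
    have le: "eventually (\<lambda>n. real n / ln (real n) ^ 3 \<le> real n) sequentially" by real_asymp
    show "eventually (\<lambda>n. 1 \<le> ln (real n) / ln (real (cutoff n))) sequentially"
      using big le lower cutoff_le
    proof eventually_elim
      case (elim n)
      have "ln (real (cutoff n)) \<le> ln (real n)" using elim by (subst ln_le_cancel_iff) linarith+
      moreover have "0 < ln (real (cutoff n))" using elim by (intro ln_gt_zero) linarith
      ultimately show ?case by (subst le_divide_eq_1_pos) auto
    qed
    show "eventually (\<lambda>n. ln (real n) / ln (real (cutoff n)) \<le> ln (real n) / ln (real n / ln (real n) ^ 3 - 1)) sequentially"
      using big lower eventually_ge_at_top[of 1]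
    proof eventually_elim
      case (elim n)
      have "ln (real n / ln (real n) ^ 3 - 1) \<le> ln (real (cutoff n))"
        using elim by (subst ln_le_cancel_iff) linarith+
      moreover have "0 < ln (real n / ln (real n) ^ 3 - 1)" using elim by (intro ln_gt_zero) linarith
      moreover have "0 \<le> ln (real n)" using elim by simp
      ultimately show ?case by (intro divide_left_mono mult_pos_pos) linarith+
    qed
    show "(\<lambda>n. ln (real n) / ln (real n / ln (real n) ^ 3 - 1)) \<longlonglongrightarrow> 1" by real_asymp
  qed simp
  have "(\<lambda>n. p (cutoff n) * ln (real (cutoff n)) * (ln (real n) / ln (real (cutoff n)))) \<longlonglongrightarrow> c * 1"
    by (intro tendsto_mult ratio filterlim_compose[OF p_asymp top])
  moreover have "eventually (\<lambda>n. p (cutoff n) * ln (real (cutoff n)) * (ln (real n) / ln (real (cutoff n))) = p (cutoff n) * ln (real n)) sequentially"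
    using filterlim_at_top[THEN iffD1, OF top, rule_format, of 2] by eventually_elim simp
  ultimately show ?thesis by (simp add: tendsto_cong)
qed

text \<open>\<open>A 1 n\<close> is the sum of the decreasing p_k over k < n. All terms are at least
  \<open>p n\<close>; from above the first \<open>cutoff n\<close> terms are bounded by 1 and the
  others by \<open>p (cutoff n)\<close>.\<close>

lemma A_asymp: "(\<lambda>n. A 1 n * ln (real n) / real n) \<longlonglongrightarrow> c"
proof (rule tendsto_sandwich)
  show "eventually (\<lambda>n. p n * ln (real n) \<le> A 1 n * ln (real n) / real n) sequentially"
    using eventually_ge_at_top[of 1]
  proof eventually_elim
    case (elim n)
    have "p n * ln (real n) * real n \<le> A 1 n * ln (real n)"
      using mult_right_mono[OF A_1_ge[of n], of "ln (real n)"] elim by (simp add: mult_ac)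
    then show ?case using elim by (simp add: field_simps)
  qed
  have kn: "eventually (\<lambda>n. cutoff n \<le> n) sequentially"
  proof -
    have "eventually (\<lambda>n. real n / ln (real n) ^ 3 \<le> real n) sequentially" by real_asymp
    then show ?thesis using cutoff_le by eventually_elim linarith
  qed
  show "eventually (\<lambda>n. A 1 n * ln (real n) / real n \<le> 1 / ln (real n) ^ 2 + p (cutoff n) * ln (real n)) sequentially"
    using cutoff_le kn eventually_ge_at_top[of 3]
  proof eventually_elim
    case (elim n)
    have n: "n = cutoff n + (n - cutoff n)" using elim by simp
    have "A 1 (cutoff n + j) \<le> real (cutoff n) + real j * p (cutoff n)" for j
    proof (induction j)
      case 0
      show ?case using A_le[of 1 "cutoff n"] by simp
    next
      case (Suc j)
      then show ?case using p_antimono[of "cutoff n" "cutoff n + j"] by (simp add: A_1[simplified] algebra_simps)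
    qed
    from this[of "n - cutoff n"] have "A 1 n \<le> real (cutoff n) + real (n - cutoff n) * p (cutoff n)" using n by simp
    also have "\<dots> \<le> real n / ln (real n) ^ 3 + real n * p (cutoff n)"
      using elim p_bounds by (intro add_mono mult_right_mono) auto
    finally have "A 1 n * ln (real n) / real n \<le> (real n / ln (real n) ^ 3 + real n * p (cutoff n)) * ln (real n) / real n"
      using elim by (intro divide_right_mono mult_right_mono) auto
    also have "\<dots> = 1 / ln (real n) ^ 2 + p (cutoff n) * ln (real n)"
      by (rule rescale_block_bound) (use elim in auto)
    finally show ?case .
  qed
  have "(\<lambda>n. 1 / ln (real n) ^ 2) \<longlonglongrightarrow> 0" by real_asymp
  from tendsto_add[OF this p_cutoff] show "(\<lambda>n. 1 / ln (real n) ^ 2 + p (cutoff n) * ln (real n)) \<longlonglongrightarrow> c" by simp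
qed (rule p_asymp)

lemma A_1_pos: "n \<ge> 1 \<Longrightarrow> A 1 n \<ge> 1"
  using A_mono[of 1 1 n] by (simp add: A_1[simplified] p_def q_0)

text \<open>For ln n > 0 this is the least m >= 1 with c m / ln n >= v. The maximum with 1 covers v
  = 0, where every point of the range qualifies.\<close>

definition thr :: "real \<Rightarrow> nat \<Rightarrow> nat" where
  "thr v n = max 1 (nat \<lceil>v * ln (real n) / c\<rceil>)"

lemma thr_asymp:
  assumes "v \<ge> 0"
  shows "(\<lambda>n. real (thr v n - 1) / ln (real n)) \<longlonglongrightarrow> v / c"
proof (rule tendsto_sandwich)
  show "eventually (\<lambda>n. (v * ln (real n) / c - 1) / ln (real n) \<le> real (thr v n - 1) / ln (real n)) sequentially"
    using eventually_ge_at_top[of 3]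
    by eventually_elim (auto intro!: divide_right_mono simp: thr_def, linarith)
  show "eventually (\<lambda>n. real (thr v n - 1) / ln (real n) \<le> (v * ln (real n) / c) / ln (real n)) sequentially"
    using eventually_ge_at_top[of 3]
  proof eventually_elim
    case (elim n)
    have "0 \<le> v * ln (real n) / c" using assms c_pos elim by simp
    then have "real (thr v n - 1) \<le> v * ln (real n) / c" unfolding thr_def by linarith
    then show ?case using elim by (intro divide_right_mono) auto
  qed
  have ev: "eventually (\<lambda>n::nat. ln (real n) \<noteq> 0) sequentially"
    using eventually_ge_at_top[of 3] by eventually_elim simp
  have "(\<lambda>n. v / c - 1 / ln (real n)) \<longlonglongrightarrow> v / c - 0" by (intro tendsto_diff tendsto_const) real_asymp
  then show "(\<lambda>n. (v * ln (real n) / c - 1) / ln (real n)) \<longlonglongrightarrow> v / c"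
    by (subst tendsto_cong[where g = "\<lambda>n. v / c - 1 / ln (real n)"])
       (rule eventually_mono[OF ev], simp_all add: diff_divide_distrib)
  show "(\<lambda>n. (v * ln (real n) / c) / ln (real n)) \<longlonglongrightarrow> v / c"
    by (subst tendsto_cong[where g = "\<lambda>n. v / c"]) (rule eventually_mono[OF ev], simp_all)
qed

text \<open>With r = \<open>thr v n - 1\<close> the ratio lies between powers (1 - p)^r, taken with
  p = \<open>p n\<close> above (\<open>A_le_power\<close>) and p = \<open>p (cutoff n)\<close> below
  (\<open>A_ge_power\<close>). Both satisfy p ln n -> c, and r ~ v ln n / c, so both powers tend to
  exp(-v).\<close>

lemma A_ratio:
  assumes v: "v \<ge> 0"
  shows "(\<lambda>n. A (thr v n) n / A 1 n) \<longlonglongrightarrow> exp (- v)"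
proof (rule tendsto_sandwich)
  define r where "r n = thr v n - 1" for n
  have thr: "thr v n = Suc (r n)" for n by (simp add: r_def thr_def)
  have r: "(\<lambda>n. real (r n) / ln (real n)) \<longlonglongrightarrow> v / c" unfolding r_def by (rule thr_asymp[OF v])
  have inv: "(\<lambda>n. 1 / ln (real n)) \<longlonglongrightarrow> 0" by real_asymp
  have lim: "(\<lambda>n. (1 - p (f n)) ^ r n) \<longlonglongrightarrow> exp (- v)" if f: "(\<lambda>n. p (f n) * ln (real n)) \<longlonglongrightarrow> c" for f
  proof (rule power_one_minus_tendsto_exp)
    have ev: "eventually (\<lambda>n. ln (real n) \<noteq> 0) sequentially"
      using eventually_ge_at_top[of 3] by eventually_elim simp
    have "(\<lambda>n. p (f n) * ln (real n) * (1 / ln (real n))) \<longlonglongrightarrow> c * 0" by (intro tendsto_mult f inv)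
    then show "(\<lambda>n. p (f n)) \<longlonglongrightarrow> 0"
      using ev by (subst (asm) tendsto_cong[where g = "\<lambda>n. p (f n)"]) (auto elim!: eventually_mono)
    have "(\<lambda>n. real (r n) / ln (real n) * (p (f n) * ln (real n))) \<longlonglongrightarrow> v / c * c" by (intro tendsto_mult f r)
    moreover have "eventually (\<lambda>n. real (r n) / ln (real n) * (p (f n) * ln (real n)) = real (r n) * p (f n)) sequentially"
      using ev by eventually_elim simp
    ultimately show "(\<lambda>n. real (r n) * p (f n)) \<longlonglongrightarrow> v"
      using c_pos by (simp add: tendsto_cong)
  qed (rule p_bounds)
  show "eventually (\<lambda>n. A (thr v n) n / A 1 n \<le> (1 - p n) ^ r n) sequentially"
    using eventually_ge_at_top[of 1]
  proof eventually_elim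
    case (elim n)
    then show ?case using A_le_power[of "r n" n] A_1_pos[of n] by (simp add: thr field_simps)
  qed
  \<comment> \<open>Relative loss from shortening the walk by r times \<open>cutoff n\<close> steps,
    each worth at most 1 in \<open>A 1\<close>. Its order is ln n (n / ln^3 n) / (n / ln n) = 1 / ln
    n.\<close>
  let ?e = "\<lambda>n. real (r n * cutoff n) / A 1 n"
  have e: "?e \<longlonglongrightarrow> 0"
  proof (rule tendsto_sandwich[where f = "\<lambda>_. 0"])
    show "eventually (\<lambda>n. ?e n \<le> real (r n) / ln (real n) * (1 / ln (real n)) * (1 / (A 1 n * ln (real n) / real n))) sequentially"
      using cutoff_le eventually_ge_at_top[of 3]
    proof eventually_elim
      case (elim n)
      have "?e n \<le> real (r n) * (real n / ln (real n) ^ 3) / A 1 n"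
        using elim A_1_pos[of n] by (intro divide_right_mono) (auto intro: mult_left_mono simp del: times_divide_eq_right)
      also have "\<dots> = real (r n) / ln (real n) * (1 / ln (real n)) * (1 / (A 1 n * ln (real n) / real n))"
        by (rule rescale_overshoot) (use elim A_1_pos[of n] in auto)
      finally show ?case .
    qed
    have "(\<lambda>n. real (r n) / ln (real n) * (1 / ln (real n)) * (1 / (A 1 n * ln (real n) / real n))) \<longlonglongrightarrow> v / c * 0 * (1 / c)"
      by (intro tendsto_mult r inv tendsto_divide tendsto_const A_asymp) (use c_pos in simp)
    then show "(\<lambda>n. real (r n) / ln (real n) * (1 / ln (real n)) * (1 / (A 1 n * ln (real n) / real n))) \<longlonglongrightarrow> 0"
      by simp
    show "eventually (\<lambda>n. 0 \<le> ?e n) sequentially"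
      using A_nonneg by (simp add: always_eventually)
  qed simp
  have "(\<lambda>n. (1 - p (cutoff n)) ^ r n * (1 - ?e n)) \<longlonglongrightarrow> exp (- v) * (1 - 0)"
    by (rule tendsto_mult[OF lim[OF p_cutoff] tendsto_diff[OF tendsto_const e]])
  then have lower: "(\<lambda>n. (1 - p (cutoff n)) ^ r n * (1 - ?e n)) \<longlonglongrightarrow> exp (- v)" by simp
  show "eventually (\<lambda>n. (1 - p (cutoff n)) ^ r n * (1 - ?e n) \<le> A (thr v n) n / A 1 n) sequentially"
    using eventually_ge_at_top[of 1]
  proof eventually_elim
    case (elim n)
    have "(1 - p (cutoff n)) ^ r n * (A 1 n - real (r n * cutoff n)) \<le> (1 - p (cutoff n)) ^ r n * A 1 (n - r n * cutoff n)"
      using A_1_diff_le[of n "r n * cutoff n"] p_bounds by (intro mult_left_mono) auto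
    also have "\<dots> \<le> A (thr v n) n" unfolding thr by (rule A_ge_power)
    finally have "(1 - p (cutoff n)) ^ r n * (A 1 n - real (r n * cutoff n)) / A 1 n \<le> A (thr v n) n / A 1 n"
      using A_1_pos[OF elim] by (intro divide_right_mono) auto
    moreover have "(A 1 n - real (r n * cutoff n)) / A 1 n = 1 - ?e n"
      using A_1_pos[OF elim] by (simp add: field_simps)
    ultimately show ?case by (metis times_divide_eq_right)
  qed
  show "(\<lambda>n. (1 - p (cutoff n)) ^ r n * (1 - ?e n)) \<longlonglongrightarrow> exp (- v)" by (rule lower)
  show "(\<lambda>n. (1 - p n) ^ r n) \<longlonglongrightarrow> exp (- v)" by (rule lim[OF p_asymp])
qed

text \<open>The ratio of \<open>A 1\<close> at 2n and at n tends to 2. The value 9/5 lies below 2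
  and its square 81/25 above 3; what matters is that 3 exceeds the 5/2 of
  \<open>V_double\<close>.\<close>

lemma A_double: "eventually (\<lambda>n. 3 * (A 1 n)\<^sup>2 \<le> (A 1 (n + n))\<^sup>2) sequentially"
proof -
  have top: "filterlim (\<lambda>n::nat. n + n) at_top sequentially"
    by (rule filterlim_at_top_mono[OF filterlim_ident]) simp
  have "(\<lambda>n. (A 1 (n + n) * ln (real (n + n)) / real (n + n)) / (A 1 n * ln (real n) / real n)
      * (2 * ln (real n) / ln (real (n + n)))) \<longlonglongrightarrow> c / c * 2"
  proof (intro tendsto_mult tendsto_divide A_asymp)
    show "(\<lambda>n. A 1 (n + n) * ln (real (n + n)) / real (n + n)) \<longlonglongrightarrow> c"
      by (rule filterlim_compose[OF A_asymp top])
    show "(\<lambda>n. 2 * ln (real n) / ln (real (n + n))) \<longlonglongrightarrow> 2" by real_asymp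
  qed (use c_pos in simp)
  then have "eventually (\<lambda>n. (A 1 (n + n) * ln (real (n + n)) / real (n + n)) / (A 1 n * ln (real n) / real n)
      * (2 * ln (real n) / ln (real (n + n))) > 9/5) sequentially"
    by (rule order_tendstoD) (use c_pos in simp)
  then show ?thesis using eventually_ge_at_top[of 3]
  proof eventually_elim
    case (elim n)
    have "(A 1 (n + n) * ln (real (n + n)) / real (n + n)) / (A 1 n * ln (real n) / real n)
      * (2 * ln (real n) / ln (real (n + n))) = A 1 (n + n) / A 1 n"
      unfolding of_nat_add by (rule rescale_double) (use elim A_1_pos[of n] in auto)
    then have "9/5 * A 1 n \<le> A 1 (n + n)" using elim A_1_pos[of n] by (simp add: field_simps)
    from power_mono[OF this, of 2] have "81/25 * (A 1 n)\<^sup>2 \<le> (A 1 (n + n))\<^sup>2"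
      using A_1_pos[of n] elim by (simp add: power_mult_distrib power_divide)
    then show ?case using zero_le_power2[of "A 1 n"] by linarith
  qed
qed

text \<open>\<open>I2_bound\<close> is O(n^2 / ln^4 n) once \<open>G n 0\<close> ~ ln n / c, and
  A_1(n)^2 is of order n^2 / ln^2 n.\<close>

lemma I2_ratio: "\<exists>D \<ge> 0. eventually (\<lambda>n. I2 n / (A 1 n)\<^sup>2 \<le> D / (ln (real n))\<^sup>2) sequentially"
proof -
  let ?f = "\<lambda>n. 4 * (1 / real n + 8 * C)\<^sup>2 * (ln (real n) / G n 0) ^ 4 * (1 / (A 1 n * ln (real n) / real n))\<^sup>2"
  let ?L = "4 * (0 + 8 * C)\<^sup>2 * c ^ 4 * (1 / c)\<^sup>2"
  have "(\<lambda>n. 1 / real n) \<longlonglongrightarrow> 0" by real_asymp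
  then have "?f \<longlonglongrightarrow> ?L"
    using c_pos by (intro tendsto_intros ln_div_G A_asymp) auto
  then have "eventually (\<lambda>n. ?f n < ?L + 1) sequentially" by (rule order_tendstoD) simp
  then have "eventually (\<lambda>n. I2 n / (A 1 n)\<^sup>2 \<le> (?L + 1) / (ln (real n))\<^sup>2) sequentially"
    using eventually_ge_at_top[of 3]
  proof eventually_elim
    case (elim n)
    have "I2 n / (A 1 n)\<^sup>2 \<le> 4 * ((1 + 8 * C * real n) / (G n 0)\<^sup>2)\<^sup>2 / (A 1 n)\<^sup>2"
      by (intro divide_right_mono I2_bound) simp
    also have "\<dots> = ?f n / (ln (real n))\<^sup>2"
      by (rule rescale_collisions) (use elim G_pos[of n] A_1_pos[of n] in auto)
    also have "\<dots> \<le> (?L + 1) / (ln (real n))\<^sup>2"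
      using elim by (intro divide_right_mono) auto
    finally show ?case .
  qed
  then show ?thesis by (intro exI[of _ "?L + 1"]) simp
qed

text \<open>Dividing \<open>V_double\<close> by the squared mean at 2n, which is at least 3 times
  that at n, gives a contraction by 5/6 with an error that is summable in j.\<close>

lemma V_ratio_summable:
  assumes s: "s \<ge> 1"
  shows "\<exists>b. summable b \<and> (\<forall>j. \<forall>m\<ge>1. V m (s * 2 ^ j) / (A 1 (s * 2 ^ j))\<^sup>2 \<le> b j)"
proof -
  define N where "N j = s * 2 ^ j" for j :: nat
  \<comment> \<open>A majorant of \<open>V m (N j)\<close> that does not depend on m: it starts from
    the trivial bound s^2 and obeys the recursion of \<open>V_double\<close> with equality.\<close>
  define B where "B = rec_nat ((real s)\<^sup>2) (\<lambda>j x. 5/2 * x + 5 * I2 (N j))"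
  have B: "B 0 = (real s)\<^sup>2" "B (Suc j) = 5/2 * B j + 5 * I2 (N j)" for j
    by (simp_all add: B_def)
  have N_Suc: "N (Suc j) = N j + N j" for j by (simp add: N_def)
  have N1: "N j \<ge> 1" for j using s by (simp add: N_def)
  have V: "V m (N j) \<le> B j" if "m \<ge> 1" for m j
  proof (induction j)
    case 0
    have sq: "(real (popular m es) - A m s)\<^sup>2 \<le> (real s)\<^sup>2" if "length es = s" for es :: "'a list"
      using power_mono[OF popular_dev_le[OF \<open>m \<ge> 1\<close> that], of 2] by simp
    have "V m s \<le> E s (\<lambda>_. (real s)\<^sup>2)"
      unfolding V_def by (rule E_mono[where B = "(real s)\<^sup>2" and B' = "(real s)\<^sup>2"]) (use sq in auto)
    then show ?case by (simp add: B N_def)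
  next
    case (Suc j)
    then show ?case using V_double[OF that, of "N j"] by (simp add: B N_Suc)
  qed
  have B_nonneg: "B j \<ge> 0" for j using order.trans[OF V_nonneg V[of 1 j]] by simp
  define b where "b j = B j / (A 1 (N j))\<^sup>2" for j
  obtain D where D: "D \<ge> 0" "eventually (\<lambda>n. I2 n / (A 1 n)\<^sup>2 \<le> D / (ln (real n))\<^sup>2) sequentially"
    using I2_ratio by blast
  have "j \<le> N j" for j
    using s by (metis N_def less_exp less_imp_le_nat mult_le_mono nat_mult_1)
  then have top: "filterlim N at_top sequentially"
    by (intro filterlim_at_top_mono[OF filterlim_ident] always_eventually) auto
  let ?e = "\<lambda>j. 5 * D / (ln 2)\<^sup>2 * inverse (real j ^ 2)"
  have "eventually (\<lambda>j. b (Suc j) \<le> 5/6 * b j + ?e j) sequentially"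
    using eventually_compose_filterlim[OF A_double top] eventually_compose_filterlim[OF D(2) top]
      eventually_ge_at_top[of 1]
  proof eventually_elim
    case (elim j)
    let ?a = "(A 1 (N j))\<^sup>2" and ?a' = "(A 1 (N j + N j))\<^sup>2"
    have a: "?a > 0" using A_1_pos[OF N1[of j]] by simp
    have a': "3 * ?a \<le> ?a'" using elim by simp
    have "b (Suc j) = (5/2 * B j + 5 * I2 (N j)) / ?a'" by (simp add: b_def B N_Suc)
    also have "\<dots> \<le> (5/2 * B j + 5 * I2 (N j)) / (3 * ?a)"
      using a a' B_nonneg[of j] I2_nonneg[of "N j"]
      by (intro divide_left_mono mult_pos_pos add_nonneg_nonneg mult_nonneg_nonneg) linarith+
    also have "\<dots> = 5/6 * b j + 5/3 * (I2 (N j) / ?a)"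
      using a by (simp add: b_def field_simps)
    also have "5/3 * (I2 (N j) / ?a) \<le> 5 * (I2 (N j) / ?a)"
      using I2_nonneg[of "N j"] a by (intro mult_right_mono) auto
    also have "\<dots> \<le> 5 * (D / (ln (real (N j)))\<^sup>2)" using elim by simp
    \<comment> \<open>Since ln (s 2^j) >= j ln 2, the error 1 / ln^2 becomes a multiple of 1 /
      j^2.\<close>
    also have "\<dots> \<le> 5 * (D / (real j * ln 2)\<^sup>2)"
    proof -
      have "real j * ln 2 \<le> ln (real (N j))"
        using s by (simp add: N_def ln_mult ln_realpow)
      then have "(real j * ln 2)\<^sup>2 \<le> (ln (real (N j)))\<^sup>2" by (intro power_mono) auto
      moreover have "real j * ln 2 > 0" using elim by simp
      ultimately show ?thesis
        using D(1) zero_less_power[of "real j * ln 2" 2]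
        by (intro mult_left_mono divide_left_mono mult_pos_pos) linarith+
    qed
    also have "\<dots> = ?e j" by (simp add: power_mult_distrib field_simps)
    finally show ?case by simp
  qed
  then have "summable b"
    by (rule summable_contracting_recursion[rotated 4])
       (use D(1) B_nonneg in \<open>auto simp: b_def intro!: summable_mult inverse_power_summable\<close>)
  moreover have "V m (N j) / (A 1 (N j))\<^sup>2 \<le> b j" if "m \<ge> 1" for m j
    unfolding b_def by (intro divide_right_mono V that) simp
  ultimately show ?thesis unfolding N_def by blast
qed

end

lemma pmf_replicate_pmf:
  "pmf (replicate_pmf n p) es = (if length es = n then (\<Prod>i<n. pmf p (es ! i)) else 0)"
proof (cases "length es = n")
  case True
  then show ?thesis
  proof (induction n arbitrary: es)
    case (Suc n)
    then obtain e es' where es: "es = e # es'" by (cases es) auto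
    have eq: "replicate_pmf (Suc n) p = map_pmf (\<lambda>(x, xs). x # xs) (pair_pmf p (replicate_pmf n p))"
      by (simp add: pair_pmf_def map_bind_pmf)
    have "pmf (replicate_pmf (Suc n) p) es = pmf (pair_pmf p (replicate_pmf n p)) (e, es')"
      unfolding eq es
      using pmf_map_inj'[of "\<lambda>(x, xs). x # xs" "pair_pmf p (replicate_pmf n p)" "(e, es')"]
      by (simp add: inj_on_def)
    also have "\<dots> = (\<Prod>i<Suc n. pmf p (es ! i))"
      using Suc by (simp add: pmf_pair es prod.lessThan_Suc_shift del: prod.lessThan_Suc)
    finally show ?case using Suc.prems by simp
  qed simp
next
  case False
  then have "es \<notin> set_pmf (replicate_pmf n p)" by (auto simp: set_replicate_pmf)
  then show ?thesis using False by (simp add: set_pmf_eq)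
qed

lemma visits_snoc: "visits (xs @ [e]) x = visits xs x + of_bool (x = sum_list xs + e)"
  by (auto simp: visits_append algebra_simps)

section \<open>From the times s 2^j to all times\<close>

context random_walk_log
begin

lemma thr_mono: "v * ln (real n) \<le> v' * ln (real n') \<Longrightarrow> thr v n \<le> thr v' n'"
  unfolding thr_def using c_pos
  by (intro max.mono order.refl nat_mono ceiling_mono divide_right_mono) auto

lemma thr_0: "thr 0 n = 1"
  by (simp add: thr_def)

lemma thr_ge_1: "thr v n \<ge> 1"
  by (simp add: thr_def)

text \<open>A deterministic statement, applied later to a single path with N m n the number of
  points visited m times. A time n lies between s 2^j and (s + 1) 2^j with s >= Q, whose ratio is at
  most 1 + 1/Q, and \<open>A_1_concave\<close> transfers this to \<open>A 1\<close>. The thresholds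
  at n and at an endpoint are compared by moving w to a nearby rational v, since the logarithms
  differ by at most ln 2. Only rational v are assumed, so that countably many null sets
  suffice.\<close>

lemma exp_limit_interpolation:
  fixes N :: "nat \<Rightarrow> nat \<Rightarrow> nat"
  assumes anti: "\<And>m m' n. 1 \<le> m \<Longrightarrow> m \<le> m' \<Longrightarrow> N m' n \<le> N m n"
    and mono: "\<And>m n n'. 1 \<le> m \<Longrightarrow> n \<le> n' \<Longrightarrow> N m n \<le> N m n'"
    and lim: "\<And>s v. s \<ge> 1 \<Longrightarrow> v \<in> \<rat> \<Longrightarrow> v \<ge> 0 \<Longrightarrow>
      (\<lambda>j. real (N (thr v (s * 2 ^ j)) (s * 2 ^ j)) / A 1 (s * 2 ^ j)) \<longlonglongrightarrow> exp (- v)"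
    and w: "w \<ge> 0"
  shows "(\<lambda>n. real (N (thr w n) n) / A 1 n) \<longlonglongrightarrow> exp (- w)"
proof -
  define f where "f v n = real (N (thr v n) n) / A 1 n" for v n
  have block: "eventually (\<lambda>n. \<exists>s j. Q \<le> s \<and> s * 2 ^ j \<le> n \<and> n < (s + 1) * 2 ^ j \<and>
      P (s * 2 ^ j) \<and> P ((s + 1) * 2 ^ j)) sequentially"
    if P: "\<And>s. s \<ge> 1 \<Longrightarrow> eventually (\<lambda>j. P (s * 2 ^ j)) sequentially" and Q: "Q \<ge> 1" for P and Q :: nat
  proof -
    \<comment> \<open>Finitely many s suffice: with j the largest index such that Q 2^j <= n, the
      quotient s of n by 2^j satisfies Q <= s < 2 Q, so s and s + 1 both lie in this range.\<close>
    have "eventually (\<lambda>j. \<forall>s\<in>{Q..2 * Q}. P (s * 2 ^ j)) sequentially"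
      using P Q by (intro eventually_ball_finite) auto
    then obtain J where J: "\<And>j s. j \<ge> J \<Longrightarrow> s \<in> {Q..2 * Q} \<Longrightarrow> P (s * 2 ^ j)"
      unfolding eventually_sequentially by blast
    show ?thesis
      using eventually_ge_at_top[of "Q * 2 ^ J"]
    proof eventually_elim
      case (elim n)
      define j where "j = (GREATEST j. Q * 2 ^ j \<le> n)"
      have bd: "\<forall>j. Q * 2 ^ j \<le> n \<longrightarrow> j \<le> n"
      proof (intro allI impI)
        fix j :: nat assume "Q * 2 ^ j \<le> n"
        then have "1 * 2 ^ j \<le> n" using Q mult_le_mono1[of 1 Q "2 ^ j"] by linarith
        then show "j \<le> n" using less_exp[of j] by linarith
      qed
      have j1: "Q * 2 ^ j \<le> n" unfolding j_def
        by (rule GreatestI_nat[where P = "\<lambda>j. Q * 2 ^ j \<le> n" and k = J and b = n]) (use elim bd in auto)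
      have max: "i \<le> j" if "Q * 2 ^ i \<le> n" for i unfolding j_def
        by (rule Greatest_le_nat[where P = "\<lambda>j. Q * 2 ^ j \<le> n" and b = n]) (use that bd in auto)
      have j2: "J \<le> j" by (rule max[OF elim])
      have j3: "n < Q * 2 ^ Suc j"
        using max[of "Suc j"] by (meson Suc_n_not_le_n not_le)
      define s where "s = n div 2 ^ j"
      have s1: "Q \<le> s" unfolding s_def using j1 by (simp add: less_eq_div_iff_mult_less_eq)
      have s2: "s < 2 * Q" unfolding s_def using j3 by (simp add: div_less_iff_less_mult mult_ac)
      have s3: "s * 2 ^ j \<le> n" "n < (s + 1) * 2 ^ j"
        unfolding s_def using dividend_less_div_times[of "2 ^ j" n] by (auto simp: algebra_simps)
      show ?case
        using s1 s2 s3 J[OF j2, of s] J[OF j2, of "s + 1"] by (intro exI[of _ s] exI[of _ j]) auto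
    qed
  qed
  have ln_cmp: "eventually (\<lambda>n. v * (ln (real n) + ln 2) \<le> v' * ln (real n)) sequentially" if "v < v'" for v v' :: real
  proof -
    have "filterlim (\<lambda>n::nat. ln (real n)) at_top sequentially" by real_asymp
    then have "eventually (\<lambda>n. ln (real n) \<ge> v * ln 2 / (v' - v)) sequentially"
      by (simp add: filterlim_at_top)
    then show ?thesis
      by eventually_elim (use that in \<open>simp add: field_simps\<close>)
  qed
  have ln2: "ln (real n') \<le> ln (real n) + ln 2" if "1 \<le> n" "1 \<le> n'" "n' \<le> 2 * n" for n n'
  proof -
    have "ln (real n') \<le> ln (real n * 2)" using that by (subst ln_le_cancel_iff) auto
    then show ?thesis using that by (simp add: ln_mult)
  qed
  \<comment> \<open>Compares with the right endpoint n' >= n. A threshold for v < w at n' is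
    eventually at most the one for w at n. For w = 0 there is no smaller v >= 0, and v = 0 serves
    because its threshold is always 1.\<close>
  have upper: "eventually (\<lambda>n. f w n \<le> (1 + 1 / real Q) * (exp (- v) + 1 / real Q)) sequentially"
    if v: "v \<in> \<rat>" "v \<ge> 0" "v < w \<or> v = 0" and Q: "Q \<ge> 1" for v and Q :: nat
  proof -
    have P: "eventually (\<lambda>j. f v (s * 2 ^ j) < exp (- v) + 1 / real Q) sequentially" if "s \<ge> 1" for s
      using lim[OF that v(1,2)] Q unfolding f_def by (intro order_tendstoD(2)) auto
    have cmp: "eventually (\<lambda>n. v * (ln (real n) + ln 2) \<le> w * ln (real n)) sequentially"
    proof (cases "v = 0")
      case True
      show ?thesis using eventually_ge_at_top[of 1] by eventually_elim (use w True in simp)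
    qed (use v ln_cmp in auto)
    have "eventually (\<lambda>n. \<exists>s j. Q \<le> s \<and> s * 2 ^ j \<le> n \<and> n < (s + 1) * 2 ^ j \<and>
        f v (s * 2 ^ j) < exp (- v) + 1 / real Q \<and> f v ((s + 1) * 2 ^ j) < exp (- v) + 1 / real Q) sequentially"
      by (rule block[where P = "\<lambda>n. f v n < exp (- v) + 1 / real Q"]) (fact P, fact Q)
    then show ?thesis
      using cmp eventually_ge_at_top[of 1]
    proof eventually_elim
      case (elim n)
      then obtain s j where sj: "Q \<le> s" "s * 2 ^ j \<le> n" "n < (s + 1) * 2 ^ j"
        "f v ((s + 1) * 2 ^ j) < exp (- v) + 1 / real Q" by blast
      define n' where "n' = (s + 1) * 2 ^ j"
      have nn': "n \<le> n'" using sj by (simp add: n'_def)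
      have "(s + 1) * 2 ^ j \<le> 2 * s * 2 ^ j" using sj Q by (intro mult_le_mono1) auto
      then have n'2: "n' \<le> 2 * n" using sj unfolding n'_def by linarith
      have "v * ln (real n') \<le> v * (ln (real n) + ln 2)"
        using v elim nn' n'2 by (intro mult_left_mono ln2) auto
      then have thr: "thr v n' \<le> thr w n" using elim by (intro thr_mono) linarith
      have "real (N (thr w n) n) \<le> real (N (thr v n') n')"
        using anti[OF thr_ge_1 thr, of n'] mono[OF thr_ge_1 nn', of w n] by linarith
      also have "\<dots> \<le> (exp (- v) + 1 / real Q) * A 1 n'"
        using sj(4)[folded n'_def, THEN less_imp_le] A_1_pos[of n'] nn' elim
        unfolding f_def by (subst (asm) pos_divide_le_eq) linarith+
      also have "A 1 n' \<le> (1 + 1 / real Q) * A 1 n"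
      proof -
        have "real n' * real Q \<le> real n * (real Q + 1)"
        proof -
          have "n' * Q \<le> n * (Q + 1)"
          proof -
            have "n' * Q = s * 2 ^ j * Q + 2 ^ j * Q" by (simp add: n'_def algebra_simps)
            also have "\<dots> \<le> n * Q + s * 2 ^ j" using sj by (intro add_mono) auto
            also have "\<dots> \<le> n * Q + n" using sj by simp
            finally show ?thesis by simp
          qed
          then show ?thesis by (metis of_nat_1 of_nat_add of_nat_le_iff of_nat_mult)
        qed
        then have r: "real n' / real n \<le> 1 + 1 / real Q" using elim Q by (simp add: field_simps)
        have "A 1 n' \<le> real n' / real n * A 1 n"
          using A_1_concave[OF nn'] elim by (simp add: field_simps)
        also have "\<dots> \<le> (1 + 1 / real Q) * A 1 n"
          using r A_nonneg by (intro mult_right_mono) auto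
        finally show ?thesis .
      qed
      finally have "real (N (thr w n) n) \<le> (exp (- v) + 1 / real Q) * ((1 + 1 / real Q) * A 1 n)"
        by (simp add: mult_left_mono)
      then show ?case using A_1_pos[of n] elim by (simp add: f_def pos_divide_le_eq mult_ac)
    qed
  qed
  \<comment> \<open>The counterpart with v > w and the left endpoint n' <= n, where n' / n >= Q / (Q
    + 1) = 1 - 1 / (Q + 1). The sign condition \<open>pos\<close> allows this factor to be
    multiplied in.\<close>
  have lower: "eventually (\<lambda>n. f w n \<ge> (1 - 1 / (real Q + 1)) * (exp (- v) - 1 / real Q)) sequentially"
    if v: "v \<in> \<rat>" "w < v" and Q: "Q \<ge> 1" and pos: "exp (- v) - 1 / real Q \<ge> 0" for v and Q :: nat
  proof -
    have v0: "v \<ge> 0" using v w by simp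
    have P: "eventually (\<lambda>j. f v (s * 2 ^ j) > exp (- v) - 1 / real Q \<and>
        w * (ln (real (s * 2 ^ j)) + ln 2) \<le> v * ln (real (s * 2 ^ j))) sequentially" if s: "s \<ge> 1" for s
    proof (intro eventually_conj)
      show "eventually (\<lambda>j. f v (s * 2 ^ j) > exp (- v) - 1 / real Q) sequentially"
        using lim[OF s v(1) v0] Q unfolding f_def by (intro order_tendstoD(1)) auto
      have "j \<le> s * 2 ^ j" for j using s less_exp[of j] mult_le_mono1[of 1 s "2 ^ j"] by linarith
      then have "filterlim (\<lambda>j. s * 2 ^ j) at_top sequentially"
        by (intro filterlim_at_top_mono[OF filterlim_ident] always_eventually) auto
      then show "eventually (\<lambda>j. w * (ln (real (s * 2 ^ j)) + ln 2) \<le> v * ln (real (s * 2 ^ j))) sequentially"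
        using eventually_compose_filterlim[OF ln_cmp[OF v(2)]] by blast
    qed
    let ?P = "\<lambda>n. f v n > exp (- v) - 1 / real Q \<and> w * (ln (real n) + ln 2) \<le> v * ln (real n)"
    have "eventually (\<lambda>n. \<exists>s j. Q \<le> s \<and> s * 2 ^ j \<le> n \<and> n < (s + 1) * 2 ^ j \<and>
        ?P (s * 2 ^ j) \<and> ?P ((s + 1) * 2 ^ j)) sequentially"
      by (rule block[where P = ?P]) (fact P, fact Q)
    then show ?thesis
      using eventually_ge_at_top[of 1]
    proof eventually_elim
      case (elim n)
      then obtain s j where sj: "Q \<le> s" "s * 2 ^ j \<le> n" "n < (s + 1) * 2 ^ j"
        "f v (s * 2 ^ j) > exp (- v) - 1 / real Q"
        "w * (ln (real (s * 2 ^ j)) + ln 2) \<le> v * ln (real (s * 2 ^ j))" by blast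
      define n' where "n' = s * 2 ^ j"
      have nn': "n' \<le> n" using sj by (simp add: n'_def)
      have n'1: "1 \<le> n'" using sj Q by (simp add: n'_def)
      have "(s + 1) * 2 ^ j \<le> 2 * s * 2 ^ j" using sj Q by (intro mult_le_mono1) auto
      then have n'2: "n \<le> 2 * n'" using sj unfolding n'_def by linarith
      have "w * ln (real n) \<le> w * (ln (real n') + ln 2)"
        using w elim n'1 n'2 by (intro mult_left_mono ln2) auto
      then have thr: "thr w n \<le> thr v n'" using sj(5) by (intro thr_mono) (simp add: n'_def)
      have "(1 - 1 / (real Q + 1)) * A 1 n \<le> A 1 n'"
      proof -
        have "n * Q \<le> n' * (Q + 1)"
        proof -
          have "n * Q \<le> (n' + 2 ^ j) * Q" using sj by (intro mult_le_mono1) (simp add: n'_def)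
          also have "\<dots> = n' * Q + 2 ^ j * Q" by (simp add: algebra_simps)
          also have "\<dots> \<le> n' * Q + n'" using sj by (simp add: n'_def)
          finally show ?thesis by simp
        qed
        then have "real n * real Q \<le> real n' * (real Q + 1)"
          by (metis of_nat_1 of_nat_add of_nat_le_iff of_nat_mult)
        then have r: "1 - 1 / (real Q + 1) \<le> real n' / real n" using elim Q by (simp add: field_simps)
        have "(1 - 1 / (real Q + 1)) * A 1 n \<le> real n' / real n * A 1 n"
          using r A_nonneg by (intro mult_right_mono) auto
        also have "\<dots> \<le> A 1 n'"
          using A_1_concave[OF nn'] elim by (simp add: field_simps)
        finally show ?thesis .
      qed
      then have "(exp (- v) - 1 / real Q) * ((1 - 1 / (real Q + 1)) * A 1 n) \<le> (exp (- v) - 1 / real Q) * A 1 n'"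
        using pos by (rule mult_left_mono)
      also have "\<dots> \<le> real (N (thr v n') n')"
        using sj(4)[folded n'_def, THEN less_imp_le] A_1_pos[of n'] n'1
        unfolding f_def by (subst (asm) pos_le_divide_eq) linarith+
      also have "\<dots> \<le> real (N (thr w n) n)"
        using anti[OF thr_ge_1 thr, of n'] mono[OF thr_ge_1 nn', of w n] by linarith
      finally show ?case using A_1_pos[of n] elim by (simp add: f_def pos_le_divide_eq mult_ac)
    qed
  qed
  have Q0: "(\<lambda>Q. 1 / real Q) \<longlonglongrightarrow> 0" "(\<lambda>Q. 1 / (real Q + 1)) \<longlonglongrightarrow> 0" by real_asymp+
  show ?thesis
    unfolding f_def[symmetric]
  proof (rule order_tendstoI)
    fix a assume a: "exp (- w) < a"
    then have a0: "a > 0" using exp_gt_zero[of "- w"] by linarith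
    have w': "- ln a < w" using ln_less_cancel_iff[of "exp (- w)" a] a a0 by simp
    obtain v where v: "v \<in> \<rat>" "v \<ge> 0" "v < w \<or> v = 0" "exp (- v) < a"
    proof (cases "w = 0")
      case True
      then show ?thesis using that[of 0] a by simp
    next
      case False
      then have "max 0 (- ln a) < w" using w w' by simp
      then obtain v where v: "v \<in> \<rat>" "max 0 (- ln a) < v" "v < w" using Rats_dense_in_real by blast
      then have "exp (- v) < exp (ln a)" by simp
      then show ?thesis using that[of v] v a0 by simp
    qed
    have "(\<lambda>Q. (1 + 1 / real Q) * (exp (- v) + 1 / real Q)) \<longlonglongrightarrow> (1 + 0) * (exp (- v) + 0)"
      by (intro tendsto_intros Q0)
    then have "eventually (\<lambda>Q. (1 + 1 / real Q) * (exp (- v) + 1 / real Q) < a) sequentially"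
      using v(4) by (intro order_tendstoD(2)) auto
    then have "eventually (\<lambda>Q. Q \<ge> 1 \<and> (1 + 1 / real Q) * (exp (- v) + 1 / real Q) < a) sequentially"
      using eventually_ge_at_top[of 1] by eventually_elim simp
    then obtain Q where Q: "Q \<ge> 1" "(1 + 1 / real Q) * (exp (- v) + 1 / real Q) < a"
      unfolding eventually_sequentially by blast
    show "eventually (\<lambda>n. f w n < a) sequentially"
      using upper[OF v(1-3) Q(1)] by eventually_elim (use Q(2) in linarith)
  next
    fix a assume a: "a < exp (- w)"
    obtain v where v: "v \<in> \<rat>" "w < v" "a < exp (- v)"
    proof (cases "a \<le> 0")
      case True
      obtain v where "v \<in> \<rat>" "w < v" "v < w + 1" using Rats_dense_in_real[of w "w + 1"] by auto
      then show ?thesis using that[of v] True exp_gt_zero[of "- v"] by simp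
    next
      case False
      then have "w < - ln a" using ln_less_cancel_iff[of a "exp (- w)"] a by simp
      then obtain v where v: "v \<in> \<rat>" "w < v" "v < - ln a" using Rats_dense_in_real by blast
      then have "exp (ln a) < exp (- v)" by simp
      then show ?thesis using that[of v] v False by simp
    qed
    have "(\<lambda>Q. (1 - 1 / (real Q + 1)) * (exp (- v) - 1 / real Q)) \<longlonglongrightarrow> (1 - 0) * (exp (- v) - 0)"
      by (intro tendsto_intros Q0)
    then have "eventually (\<lambda>Q. (1 - 1 / (real Q + 1)) * (exp (- v) - 1 / real Q) > a) sequentially"
      using v(3) by (intro order_tendstoD(1)) auto
    moreover have "eventually (\<lambda>Q. 1 / real Q < exp (- v)) sequentially"
      by (rule order_tendstoD(2)[OF Q0(1)]) simp
    ultimately have "eventually (\<lambda>Q. (1 - 1 / (real Q + 1)) * (exp (- v) - 1 / real Q) > a \<and> 1 / real Q < exp (- v) \<and> Q \<ge> 1) sequentially"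
      using eventually_ge_at_top[of 1] by eventually_elim auto
    then obtain Q where Q: "Q \<ge> 1" "(1 - 1 / (real Q + 1)) * (exp (- v) - 1 / real Q) > a" "1 / real Q < exp (- v)"
      unfolding eventually_sequentially by blast
    have "exp (- v) - 1 / real Q \<ge> 0" using Q(3) by simp
    from lower[OF v(1,2) Q(1) this] show "eventually (\<lambda>n. a < f w n) sequentially"
      by eventually_elim (use Q(2) in linarith)
  qed
qed

end

section \<open>The walk on a probability space\<close>

locale iid_walk = prob_space M for M :: "'w measure" +
  fixes X :: "nat \<Rightarrow> 'w \<Rightarrow> int ^ 'd" and mu :: "(int ^ 'd) pmf"
  assumes indep: "indep_vars (\<lambda>_. count_space UNIV) X {1..}"
    and law: "j \<ge> 1 \<Longrightarrow> distr M (count_space UNIV) (X j) = measure_pmf mu"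
begin

definition increments :: "nat \<Rightarrow> 'w \<Rightarrow> (int ^ 'd) list" where
  "increments n \<omega> = map (\<lambda>j. X j \<omega>) [1..<Suc n]"

lemma X_measurable: "j \<ge> 1 \<Longrightarrow> X j \<in> M \<rightarrow>\<^sub>M count_space UNIV"
  using indep by (simp add: indep_vars_def)

lemma increments_eq_iff: "increments n \<omega> = es \<longleftrightarrow> length es = n \<and> (\<forall>i<n. X (Suc i) \<omega> = es ! i)"
  by (auto simp: increments_def list_eq_iff_nth_eq simp del: upt_Suc)

lemma increments_Suc: "increments (Suc n) \<omega> = increments n \<omega> @ [X (Suc n) \<omega>]"
  by (simp add: increments_def)

lemma length_increments [simp]: "length (increments n \<omega>) = n"
  by (simp add: increments_def)

lemma sum_list_increments: "sum_list (increments n \<omega>) = walk X n \<omega>"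
  by (induction n) (simp_all add: increments_Suc walk_def, simp add: increments_def)

lemma visits_increments: "visits (increments n \<omega>) x = local_time X n x \<omega>"
proof (induction n)
  case (Suc n)
  have "local_time X (Suc n) x \<omega> = local_time X n x \<omega> + of_bool (walk X (Suc n) \<omega> = x)"
    by (simp add: local_time_def)
  then show ?case using Suc
    by (auto simp: increments_Suc visits_snoc sum_list_increments walk_def)
qed (simp add: increments_def local_time_def)

lemma walk_range_eq: "walk_range X n \<omega> = {x. visits (increments n \<omega>) x \<ge> 1}"
proof -
  have "local_time X n x \<omega> = 0 \<longleftrightarrow> (\<forall>j\<in>{1..n}. walk X j \<omega> \<noteq> x)" for x
    unfolding local_time_def by (subst sum_eq_0_iff) auto
  then show ?thesis
    unfolding visits_increments walk_range_def by (auto simp: Suc_le_eq image_iff neq0_conv[symmetric] simp del: neq0_conv)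
qed

lemma card_walk_range: "card (walk_range X n \<omega>) = popular 1 (increments n \<omega>)"
  by (simp add: walk_range_eq popular_def)

lemma space_walk_algebra: "space (walk_algebra M X) = space M"
  unfolding walk_algebra_def by (rule space_measure_of) auto

lemma sets_walk_algebra:
  "sets (walk_algebra M X) = sigma_sets (space M) {X j -` A \<inter> space M | j A. j \<ge> 1}"
  unfolding walk_algebra_def by (rule sets_measure_of) auto

lemma subalgebra_walk: "subalgebra M (walk_algebra M X)"
  unfolding subalgebra_def space_walk_algebra sets_walk_algebra
  by (auto intro!: sets.sigma_sets_subset measurable_sets[OF X_measurable])

lemma X_measurable_walk_algebra: "j \<ge> 1 \<Longrightarrow> X j \<in> walk_algebra M X \<rightarrow>\<^sub>M count_space UNIV"
  unfolding measurable_def space_walk_algebra sets_walk_algebra by auto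

lemma increments_measurable_walk_algebra: "increments n \<in> walk_algebra M X \<rightarrow>\<^sub>M count_space UNIV"
proof (subst measurable_count_space_eq2_countable, intro conjI ballI)
  fix es :: "(int ^ 'd) list"
  have "increments n -` {es} \<inter> space (walk_algebra M X) =
     (if length es = n then {\<omega> \<in> space (walk_algebra M X). \<forall>i\<in>{..<n}. X (Suc i) \<omega> = es ! i} else {})"
    by (auto simp: increments_eq_iff)
  moreover have "{\<omega> \<in> space (walk_algebra M X). \<forall>i\<in>{..<n}. X (Suc i) \<omega> = es ! i} \<in> sets (walk_algebra M X)"
  proof (rule sets.sets_Collect_finite_All)
    fix i
    have "X (Suc i) -` {es ! i} \<inter> space (walk_algebra M X) \<in> sets (walk_algebra M X)"
      by (rule measurable_sets[OF X_measurable_walk_algebra]) auto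
    moreover have "X (Suc i) -` {es ! i} \<inter> space (walk_algebra M X)
        = {\<omega> \<in> space (walk_algebra M X). X (Suc i) \<omega> = es ! i}" by auto
    ultimately show "{\<omega> \<in> space (walk_algebra M X). X (Suc i) \<omega> = es ! i} \<in> sets (walk_algebra M X)" by simp
  qed simp
  ultimately show "increments n -` {es} \<inter> space (walk_algebra M X) \<in> sets (walk_algebra M X)" by simp
qed simp

lemma increments_measurable: "increments n \<in> M \<rightarrow>\<^sub>M count_space UNIV"
  using measurable_from_subalg[OF subalgebra_walk increments_measurable_walk_algebra] .

lemma distr_increments: "distr M (count_space UNIV) (increments n) = measure_pmf (replicate_pmf n mu)"
proof (rule measure_eqI_countable[where A = UNIV])
  fix es :: "(int ^ 'd) list"
  have pr: "prob (increments n -` {es} \<inter> space M) = pmf (replicate_pmf n mu) es"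
  \<comment> \<open>Lists of the wrong length and the empty walk are set apart; the product formula
    for independent variables is applied to a nonempty index set.\<close>
  proof (cases "length es = n \<and> n > 0")
    case False
    then show ?thesis
      by (cases "length es = n") (auto simp: pmf_replicate_pmf increments_eq_iff vimage_def prob_space)
  next
    case True
    have step: "prob (X j -` {x} \<inter> space M) = pmf mu x" if "j \<ge> 1" for j x
    proof -
      have "prob (X j -` {x} \<inter> space M) = measure (distr M (count_space UNIV) (X j)) {x}"
        by (rule measure_distr[symmetric]) (use X_measurable that in auto)
      then show ?thesis using law[OF that] by (simp add: pmf.rep_eq)
    qed
    have "increments n -` {es} \<inter> space M = (\<Inter>j\<in>{1..n}. X j -` {es ! (j - 1)} \<inter> space M)"
    proof (intro equalityI subsetI)
      fix \<omega> assume \<omega>: "\<omega> \<in> (\<Inter>j\<in>{1..n}. X j -` {es ! (j - 1)} \<inter> space M)"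
      have "X (Suc i) \<omega> = es ! i" if "i < n" for i
        using \<omega> that by (auto dest!: bspec[of _ _ "Suc i"])
      moreover have "\<omega> \<in> space M" using \<omega> True by auto
      ultimately show "\<omega> \<in> increments n -` {es} \<inter> space M" using True by (simp add: increments_eq_iff)
    next
      fix \<omega> assume \<omega>: "\<omega> \<in> increments n -` {es} \<inter> space M"
      have "X j \<omega> = es ! (j - 1)" if "j \<in> {1..n}" for j
        using \<omega> that by (cases j) (auto simp: increments_eq_iff)
      then show "\<omega> \<in> (\<Inter>j\<in>{1..n}. X j -` {es ! (j - 1)} \<inter> space M)" using \<omega> by auto
    qed
    then have "prob (increments n -` {es} \<inter> space M) = (\<Prod>j\<in>{1..n}. prob (X j -` {es ! (j - 1)} \<inter> space M))"
      using True by (simp only:) (rule indep_varsD[OF indep], auto)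
    also have "\<dots> = (\<Prod>j\<in>{1..n}. pmf mu (es ! (j - 1)))"
      by (intro prod.cong refl step) auto
    also have "\<dots> = (\<Prod>i<n. pmf mu (es ! i))"
      by (rule prod.reindex_bij_witness[of _ Suc "\<lambda>j. j - 1"]) auto
    finally show ?thesis using True by (simp add: pmf_replicate_pmf)
  qed
  show "emeasure (distr M (count_space UNIV) (increments n)) {es} = emeasure (measure_pmf (replicate_pmf n mu)) {es}"
    by (subst emeasure_distr[OF increments_measurable]) (simp_all add: emeasure_eq_measure pr emeasure_pmf_single)
qed simp_all

lemma nn_integral_increments:
  "(\<integral>\<^sup>+\<omega>. f (increments n \<omega>) \<partial>M) = (\<integral>\<^sup>+es. f es \<partial>measure_pmf (replicate_pmf n mu))"
  unfolding distr_increments[symmetric] by (rule nn_integral_distr[OF increments_measurable, symmetric]) simp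

end

locale iid_walk_log = iid_walk M X mu + random_walk_log mu C c
  for M :: "'w measure" and X :: "nat \<Rightarrow> 'w \<Rightarrow> int ^ 'd" and mu C c
begin

text \<open>An L^2 form of Borel-Cantelli: the squared normalised deviations \<open>Z j\<close> have
  summable expectations, so their sum is almost surely finite and they tend to 0.
  \<open>A_ratio\<close> gives the limit of the means.\<close>

lemma AE_subsequence:
  assumes s: "s \<ge> 1" and v: "v \<ge> 0"
  shows "AE \<omega> in M. (\<lambda>j. real (popular (thr v (s * 2 ^ j)) (increments (s * 2 ^ j) \<omega>)) / A 1 (s * 2 ^ j)) \<longlonglongrightarrow> exp (- v)"
proof -
  define n where "n j = s * 2 ^ j" for j :: nat
  define m where "m j = thr v (n j)" for j
  define Z where "Z j es = ((real (popular (m j) es) - A (m j) (n j)) / A 1 (n j))\<^sup>2" for j and es :: "(int ^ 'd) list"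
  obtain b where b: "summable b" "\<And>j k. k \<ge> 1 \<Longrightarrow> V k (n j) / (A 1 (n j))\<^sup>2 \<le> b j"
    using V_ratio_summable[OF s] unfolding n_def by blast
  have b0: "b j \<ge> 0" for j using order.trans[OF _ b(2)[of 1 j]] V_nonneg by simp
  have Z: "(\<integral>\<^sup>+\<omega>. ennreal (Z j (increments (n j) \<omega>)) \<partial>M) \<le> ennreal (b j)" for j
  proof -
    have m1: "m j \<ge> 1" unfolding m_def by (rule thr_ge_1)
    have int: "integrable (measure_pmf (replicate_pmf (n j) mu)) (Z j)"
    proof (rule integrable_walk[where B = "(real (n j) / A 1 (n j))\<^sup>2"])
      fix es :: "(int ^ 'd) list" assume es: "length es = n j"
      have "\<bar>(real (popular (m j) es) - A (m j) (n j)) / A 1 (n j)\<bar> \<le> real (n j) / A 1 (n j)"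
        using popular_dev_le[OF m1 es] A_nonneg[of 1 "n j"] by (simp add: divide_right_mono)
      from power_mono[OF this abs_ge_zero, of 2, unfolded power2_abs] show "\<bar>Z j es\<bar> \<le> (real (n j) / A 1 (n j))\<^sup>2" by (simp add: Z_def)
    qed
    have "(\<integral>\<^sup>+\<omega>. ennreal (Z j (increments (n j) \<omega>)) \<partial>M) = ennreal (E (n j) (Z j))"
      by (subst nn_integral_increments[where f = "\<lambda>es. ennreal (Z j es)"], rule nn_integral_eq_integral[OF int])
         (simp add: Z_def)
    also have "E (n j) (Z j) = V (m j) (n j) / (A 1 (n j))\<^sup>2"
      by (simp add: Z_def[abs_def] V_def power_divide)
    finally show ?thesis using b(2)[OF m1] by (simp add: ennreal_leI)
  qed
  have meas: "(\<lambda>\<omega>. ennreal (Z j (increments (n j) \<omega>))) \<in> borel_measurable M" for j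
    by (rule measurable_compose[OF increments_measurable]) simp
  have "(\<integral>\<^sup>+\<omega>. (\<Sum>j. ennreal (Z j (increments (n j) \<omega>))) \<partial>M) = (\<Sum>j. \<integral>\<^sup>+\<omega>. ennreal (Z j (increments (n j) \<omega>)) \<partial>M)"
    by (rule nn_integral_suminf) (rule meas)
  also have "\<dots> \<le> (\<Sum>j. ennreal (b j))"
    by (intro suminf_le Z) auto
  also have "\<dots> = ennreal (\<Sum>j. b j)" by (rule suminf_ennreal2[OF b0 b(1)])
  finally have "(\<integral>\<^sup>+\<omega>. (\<Sum>j. ennreal (Z j (increments (n j) \<omega>))) \<partial>M) \<noteq> \<infinity>" by (auto simp: top_unique)
  then have "AE \<omega> in M. (\<Sum>j. ennreal (Z j (increments (n j) \<omega>))) \<noteq> \<infinity>"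
    by (intro nn_integral_PInf_AE borel_measurable_suminf_order meas)
  then show ?thesis
  proof eventually_elim
    case (elim \<omega>)
    have "summable (\<lambda>j. Z j (increments (n j) \<omega>))"
      by (rule summable_suminf_not_top) (use elim in \<open>auto simp: Z_def\<close>)
    then have "(\<lambda>j. sqrt (Z j (increments (n j) \<omega>))) \<longlonglongrightarrow> sqrt 0"
      by (intro tendsto_real_sqrt summable_LIMSEQ_zero)
    then have "(\<lambda>j. \<bar>(real (popular (m j) (increments (n j) \<omega>)) - A (m j) (n j)) / A 1 (n j)\<bar>) \<longlonglongrightarrow> 0"
      by (simp add: Z_def)
    then have 1: "(\<lambda>j. (real (popular (m j) (increments (n j) \<omega>)) - A (m j) (n j)) / A 1 (n j)) \<longlonglongrightarrow> 0"
      by (rule tendsto_rabs_zero_cancel)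
    have "j \<le> n j" for j
      using s less_exp[of j] mult_le_mono1[of 1 s "2 ^ j"] unfolding n_def by linarith
    then have top: "filterlim n at_top sequentially"
      by (intro filterlim_at_top_mono[OF filterlim_ident] always_eventually) auto
    have 2: "(\<lambda>j. A (m j) (n j) / A 1 (n j)) \<longlonglongrightarrow> exp (- v)"
      unfolding m_def by (rule filterlim_compose[OF A_ratio[OF v] top])
    from tendsto_add[OF 1 2] show ?case
      by (simp add: diff_divide_distrib m_def n_def)
  qed
qed

text \<open>One null set serves all s and all rational v; off it
  \<open>exp_limit_interpolation\<close> applies path by path. Dividing by its instance v = 0, where
  the threshold is 1, replaces \<open>A 1 n\<close> by the size of the range.\<close>

lemma AE_popular_ratio:
  assumes "w \<ge> 0"
  shows "AE \<omega> in M. (\<lambda>n. real (popular (thr w n) (increments n \<omega>)) / real (popular 1 (increments n \<omega>))) \<longlonglongrightarrow> exp (- w)"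
proof -
  have "AE \<omega> in M. \<forall>s\<in>{1..}. \<forall>v\<in>{v\<in>\<rat>. v \<ge> 0}.
    (\<lambda>j. real (popular (thr v (s * 2 ^ j)) (increments (s * 2 ^ j) \<omega>)) / A 1 (s * 2 ^ j)) \<longlonglongrightarrow> exp (- v)"
    using AE_subsequence
    by (intro AE_ball_countable' countable_subset[OF _ countable_rat]) auto
  then show ?thesis
  proof eventually_elim
    case (elim \<omega>)
    let ?N = "\<lambda>m n. popular m (increments n \<omega>)"
    have mono: "?N m n \<le> ?N m n'" if "m \<ge> 1" "n \<le> n'" for m n n'
      using that(2) by (induction n' rule: dec_induct)
        (auto intro: order.trans popular_append_mono[OF that(1)] simp: increments_Suc)
    have lim: "(\<lambda>n. real (?N (thr v n) n) / A 1 n) \<longlonglongrightarrow> exp (- v)" if "v \<ge> 0" for v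
      by (rule exp_limit_interpolation) (use elim mono popular_antimono that in auto)
    have "(\<lambda>n. (real (?N (thr w n) n) / A 1 n) / (real (?N (thr 0 n) n) / A 1 n)) \<longlonglongrightarrow> exp (- w) / exp (- 0)"
      by (intro tendsto_divide lim assms) auto
    moreover have "eventually (\<lambda>n. (real (?N (thr w n) n) / A 1 n) / (real (?N (thr 0 n) n) / A 1 n)
        = real (?N (thr w n) n) / real (?N 1 n)) sequentially"
      using eventually_ge_at_top[of 1]
      by eventually_elim (use A_1_pos in \<open>force simp: thr_0\<close>)
    ultimately show ?case by (simp add: tendsto_cong)
  qed
qed

end

section \<open>Conditional law of a uniformly chosen point of the range\<close>

context iid_walk
begin

text \<open>\<open>uniform_on_range\<close> speaks of fixed points x only, while here the event
  depends on the random point and the path together. It is split over the countably many values x of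
  \<open>Y n\<close>; what then remains of the predicate depends on the path alone.\<close>

lemma cond_probability_uniform:
  assumes Y: "uniform_on_range M X Y" and n: "n \<ge> 1"
  shows "AE \<omega> in M. cond_probability M (walk_algebra M X) (\<lambda>\<omega>'. P (Y n \<omega>') (increments n \<omega>')) \<omega>
    = real (card {x \<in> walk_range X n \<omega>. P x (increments n \<omega>)}) / real (card (walk_range X n \<omega>))"
proof -
  let ?F = "walk_algebra M X"
  interpret F: finite_measure_subalgebra M ?F
    by unfold_locales (rule subalgebra_walk)
  have Ym: "Y n \<in> M \<rightarrow>\<^sub>M count_space UNIV"
    and Yc: "\<And>x. AE \<omega> in M. cond_probability M ?F (\<lambda>\<omega>'. Y n \<omega>' = x) \<omega> =
          indicator (walk_range X n \<omega>) x / real (card (walk_range X n \<omega>))"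
    using Y n unfolding uniform_on_range_def by auto
  define R :: "(int ^ 'd) list \<Rightarrow> (int ^ 'd) set" where "R es = {x. visits es x \<ge> 1}" for es
  define h where "h es = real (card {x \<in> R es. P x es}) / real (card (R es))" for es
  have R: "walk_range X n \<omega> = R (increments n \<omega>)" for \<omega> by (simp add: walk_range_eq R_def)
  have finR: "finite (R es)" for es unfolding R_def by (rule finite_popular) simp
  have h: "0 \<le> h es" "h es \<le> 1" for es
    using card_mono[OF finR[of es], of "{x \<in> R es. P x es}"] by (auto simp: h_def divide_le_eq_1)
  define Ev where "Ev = {\<omega> \<in> space M. P (Y n \<omega>) (increments n \<omega>)}"
  have incF: "{\<omega> \<in> space M. Q (increments n \<omega>)} \<in> sets ?F" for Q
    using measurable_sets[OF increments_measurable_walk_algebra, of "{es. Q es}" n]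
    by (simp add: vimage_def Int_def space_walk_algebra conj_commute)
  have FM: "A \<in> sets ?F \<Longrightarrow> A \<in> sets M" for A
    using subalgebra_walk by (auto simp: subalgebra_def)
  have Yx: "{\<omega> \<in> space M. Y n \<omega> = x} \<in> sets M" for x
    using measurable_sets[OF Ym, of "{x}"] by (simp add: vimage_def Int_def conj_commute)
  have Ev: "Ev \<in> sets M"
  proof -
    have "Ev = (\<Union>x. {\<omega> \<in> space M. Y n \<omega> = x} \<inter> {\<omega> \<in> space M. P x (increments n \<omega>)})"
      by (auto simp: Ev_def)
    also have "\<dots> \<in> sets M"
      by (rule sets.countable_UN') (use Yx FM[OF incF] in auto)
    finally show ?thesis .
  qed
  have gF: "(\<lambda>\<omega>. h (increments n \<omega>)) \<in> borel_measurable ?F"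
    by (rule measurable_compose[OF increments_measurable_walk_algebra]) simp
  then have gM: "(\<lambda>\<omega>. h (increments n \<omega>)) \<in> borel_measurable M"
    by (rule measurable_from_subalg[OF subalgebra_walk])
  have gint: "integrable M (\<lambda>\<omega>. h (increments n \<omega>))"
    by (rule integrable_const_bound[where B = 1]) (use h gM in auto)
  have "AE \<omega> in M. real_cond_exp M ?F (indicator Ev) \<omega> = h (increments n \<omega>)"
  proof (rule F.real_cond_exp_charact[OF _ _ gint gF])
    show "integrable M (indicator Ev :: _ \<Rightarrow> real)"
      using Ev by (simp add: integrable_indicator_iff emeasure_eq_measure)
    fix A assume A: "A \<in> sets ?F"
    \<comment> \<open>The part of \<open>A\<close> where x satisfies the predicate. It belongs to
      the walk algebra, so the conditional probability of \<open>Y n = x\<close> may be integrated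
      over it.\<close>
    define B where "B x = A \<inter> {\<omega> \<in> space M. P x (increments n \<omega>)}" for x
    have B: "B x \<in> sets ?F" for x unfolding B_def by (intro sets.Int A incF)
    have single: "emeasure M (B x \<inter> {\<omega> \<in> space M. Y n \<omega> = x})
       = (\<integral>\<^sup>+\<omega>. indicator (B x) \<omega> * ennreal (indicator (R (increments n \<omega>)) x / real (card (R (increments n \<omega>)))) \<partial>M)" for x
    proof -
      let ?I = "indicator {\<omega> \<in> space M. Y n \<omega> = x} :: 'w \<Rightarrow> real"
      let ?k = "\<lambda>es. indicator (R es) x / real (card (R es))"
      have k: "0 \<le> ?k es" "?k es \<le> 1" for es
        by (auto simp: indicator_def divide_le_eq_1 Suc_le_eq card_gt_0_iff finR)
      have kM: "(\<lambda>\<omega>. ?k (increments n \<omega>)) \<in> borel_measurable M"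
        by (rule measurable_compose[OF increments_measurable]) simp
      have "measure M (B x \<inter> {\<omega> \<in> space M. Y n \<omega> = x}) = (\<integral>\<omega>\<in>B x. ?I \<omega> \<partial>M)"
      proof -
        have "(\<integral>\<omega>\<in>B x. ?I \<omega> \<partial>M) = (\<integral>\<omega>. indicator (B x \<inter> {\<omega> \<in> space M. Y n \<omega> = x}) \<omega> \<partial>M)"
          unfolding set_lebesgue_integral_def
          by (intro Bochner_Integration.integral_cong) (auto simp: indicator_def)
        then show ?thesis using FM[OF B] Yx by simp
      qed
      also have "\<dots> = (\<integral>\<omega>\<in>B x. real_cond_exp M ?F ?I \<omega> \<partial>M)"
        by (rule F.real_cond_exp_intA[OF _ B]) (use Yx in \<open>simp add: integrable_indicator_iff emeasure_eq_measure\<close>)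
      also have "\<dots> = (\<integral>\<omega>\<in>B x. ?k (increments n \<omega>) \<partial>M)"
        unfolding set_lebesgue_integral_def
      proof (rule integral_cong_AE)
        have "indicator (B x) \<in> borel_measurable M" for x using FM[OF B] by simp
        then show "(\<lambda>\<omega>. indicator (B x) \<omega> *\<^sub>R ?k (increments n \<omega>)) \<in> borel_measurable M"
          unfolding real_scaleR_def using kM by (rule borel_measurable_times)
        show "(\<lambda>\<omega>. indicator (B x) \<omega> *\<^sub>R real_cond_exp M ?F ?I \<omega>) \<in> borel_measurable M"
          using FM[OF B] by simp
      qed (use Yc[of x] in \<open>auto simp: cond_probability_def R elim!: eventually_mono\<close>)
      finally have "emeasure M (B x \<inter> {\<omega> \<in> space M. Y n \<omega> = x})
          = ennreal (\<integral>\<omega>. indicator (B x) \<omega> * ?k (increments n \<omega>) \<partial>M)"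
        by (simp add: emeasure_eq_measure set_lebesgue_integral_def)
      also have "\<dots> = (\<integral>\<^sup>+\<omega>. ennreal (indicator (B x) \<omega> * ?k (increments n \<omega>)) \<partial>M)"
      proof (rule nn_integral_eq_integral[symmetric])
        show "integrable M (\<lambda>\<omega>. indicator (B x) \<omega> * ?k (increments n \<omega>))"
        proof (rule integrable_const_bound[where B = 1])
          show "AE \<omega> in M. norm (indicator (B x) \<omega> * ?k (increments n \<omega>)) \<le> 1"
          proof (intro AE_I2)
            fix \<omega>
            show "norm (indicator (B x) \<omega> * ?k (increments n \<omega>)) \<le> 1"
              using k[of "increments n \<omega>"] by (cases "\<omega> \<in> B x") simp_all
          qed
          show "(\<lambda>\<omega>. indicator (B x) \<omega> * ?k (increments n \<omega>)) \<in> borel_measurable M"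
            by (intro borel_measurable_times borel_measurable_indicator FM B kM)
        qed
      qed (use k in auto)
      also have "\<dots> = (\<integral>\<^sup>+\<omega>. indicator (B x) \<omega> * ennreal (?k (increments n \<omega>)) \<partial>M)"
        by (intro nn_integral_cong) (auto simp: indicator_def)
      finally show ?thesis .
    qed
    have "emeasure M (A \<inter> Ev) = (\<integral>\<^sup>+\<omega>. indicator (A \<inter> Ev) \<omega> \<partial>M)"
      using FM[OF A] Ev by simp
    also have "\<dots> = (\<integral>\<^sup>+\<omega>. (\<integral>\<^sup>+x. indicator (B x \<inter> {\<omega> \<in> space M. Y n \<omega> = x}) \<omega> \<partial>count_space UNIV) \<partial>M)"
    proof (intro nn_integral_cong)
      fix \<omega> assume \<omega>: "\<omega> \<in> space M"
      have "(\<integral>\<^sup>+x. indicator (B x \<inter> {\<omega> \<in> space M. Y n \<omega> = x}) \<omega> \<partial>count_space UNIV)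
          = (\<integral>\<^sup>+x. indicator (A \<inter> Ev) \<omega> * indicator {Y n \<omega>} x \<partial>count_space UNIV)"
        using \<omega> by (intro nn_integral_cong) (auto simp: indicator_def B_def Ev_def)
      then show "indicator (A \<inter> Ev) \<omega> = (\<integral>\<^sup>+x. indicator (B x \<inter> {\<omega> \<in> space M. Y n \<omega> = x}) \<omega> \<partial>count_space UNIV)"
        by (simp add: nn_integral_cmult)
    qed
    also have "\<dots> = (\<integral>\<^sup>+x. (\<integral>\<^sup>+\<omega>. indicator (B x \<inter> {\<omega> \<in> space M. Y n \<omega> = x}) \<omega> \<partial>M) \<partial>count_space UNIV)"
      by (rule nn_integral_count_space_nn_integral) (use sets.Int[OF FM[OF B] Yx] in auto)
    also have "\<dots> = (\<integral>\<^sup>+x. (\<integral>\<^sup>+\<omega>. indicator (B x) \<omega> * ennreal (indicator (R (increments n \<omega>)) x / real (card (R (increments n \<omega>)))) \<partial>M) \<partial>count_space UNIV)"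
      using FM[OF B] Yx by (simp add: single)
    also have "\<dots> = (\<integral>\<^sup>+\<omega>. (\<integral>\<^sup>+x. indicator (B x) \<omega> * ennreal (indicator (R (increments n \<omega>)) x / real (card (R (increments n \<omega>)))) \<partial>count_space UNIV) \<partial>M)"
    proof (rule nn_integral_count_space_nn_integral[symmetric])
      fix x
      have "(\<lambda>\<omega>. ennreal (indicator (R (increments n \<omega>)) x / real (card (R (increments n \<omega>))))) \<in> borel_measurable M"
        by (rule measurable_compose[OF increments_measurable]) simp
      then show "(\<lambda>\<omega>. indicator (B x) \<omega> * ennreal (indicator (R (increments n \<omega>)) x / real (card (R (increments n \<omega>))))) \<in> borel_measurable M"
        by (intro borel_measurable_times_ennreal borel_measurable_indicator FM B)
    qed simp
    also have "\<dots> = (\<integral>\<^sup>+\<omega>. ennreal (indicator A \<omega> * h (increments n \<omega>)) \<partial>M)"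
    proof (intro nn_integral_cong)
      fix \<omega> assume \<omega>: "\<omega> \<in> space M"
      define es where "es = increments n \<omega>"
      have "(\<integral>\<^sup>+x. indicator (B x) \<omega> * ennreal (indicator (R es) x / real (card (R es))) \<partial>count_space UNIV)
         = (\<integral>\<^sup>+x. ennreal (indicator A \<omega> / real (card (R es))) * indicator {x \<in> R es. P x es} x \<partial>count_space UNIV)"
        using \<omega> by (intro nn_integral_cong) (auto simp: indicator_def B_def es_def)
      also have "\<dots> = ennreal (indicator A \<omega> / real (card (R es))) * of_nat (card {x \<in> R es. P x es})"
        using finR[of es] by (simp add: nn_integral_cmult)
      also have "\<dots> = ennreal (indicator A \<omega> * h es)"
        by (simp add: h_def ennreal_of_nat_eq_real_of_nat ennreal_mult'[symmetric])
      finally show "(\<integral>\<^sup>+x. indicator (B x) \<omega> * ennreal (indicator (R (increments n \<omega>)) x / real (card (R (increments n \<omega>)))) \<partial>count_space UNIV)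
         = ennreal (indicator A \<omega> * h (increments n \<omega>))" by (simp add: es_def)
    qed
    also have "\<dots> = ennreal (\<integral>\<omega>. indicator A \<omega> * h (increments n \<omega>) \<partial>M)"
    proof (rule nn_integral_eq_integral)
      show "integrable M (\<lambda>\<omega>. indicator A \<omega> * h (increments n \<omega>))"
        using integrable_mult_indicator[OF FM[OF A] gint] by simp
    qed (use h in auto)
    finally have "ennreal (measure M (A \<inter> Ev)) = ennreal (\<integral>\<omega>. indicator A \<omega> * h (increments n \<omega>) \<partial>M)"
      by (simp add: emeasure_eq_measure)
    then have "measure M (A \<inter> Ev) = (\<integral>\<omega>. indicator A \<omega> * h (increments n \<omega>) \<partial>M)"
      by (rule ennreal_inj[THEN iffD1, rotated 2]) (auto intro!: Bochner_Integration.integral_nonneg simp: h)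
    moreover have "(\<integral>\<omega>\<in>A. (indicator Ev \<omega> :: real) \<partial>M) = measure M (A \<inter> Ev)"
    proof -
      have "(\<integral>\<omega>\<in>A. indicator Ev \<omega> \<partial>M) = (\<integral>\<omega>. (indicator (A \<inter> Ev) \<omega> :: real) \<partial>M)"
        unfolding set_lebesgue_integral_def
        by (intro Bochner_Integration.integral_cong) (auto simp: indicator_def)
      then show ?thesis using FM[OF A] Ev by simp
    qed
    ultimately show "(\<integral>\<omega>\<in>A. indicator Ev \<omega> \<partial>M) = (\<integral>\<omega>\<in>A. h (increments n \<omega>) \<partial>M)"
      by (simp add: set_lebesgue_integral_def)
  qed
  then show ?thesis
    by (simp add: cond_probability_def Ev_def h_def R)
qed

end

context iid_walk_log
begin

text \<open>For n >= 2, so that ln n > 0, the points of the range satisfying the inequality are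
  exactly those with at least \<open>thr w n\<close> visits. The conditional probability is
  therefore the quotient treated in \<open>AE_popular_ratio\<close>.\<close>

theorem cond_probability_tendsto:
  assumes Y: "uniform_on_range M X Y" and w: "w \<ge> 0"
  shows "AE \<omega> in M. (\<lambda>n. cond_probability M (walk_algebra M X)
      (\<lambda>\<omega>'. c * (real (local_time X n (Y n \<omega>') \<omega>') / ln (real n)) \<ge> w) \<omega>) \<longlonglongrightarrow> exp (- w)"
proof -
  have "AE \<omega> in M. \<forall>n\<in>{1..}. cond_probability M (walk_algebra M X)
      (\<lambda>\<omega>'. c * (real (visits (increments n \<omega>') (Y n \<omega>')) / ln (real n)) \<ge> w) \<omega>
      = real (card {x \<in> walk_range X n \<omega>. c * (real (visits (increments n \<omega>) x) / ln (real n)) \<ge> w})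
        / real (card (walk_range X n \<omega>))"
    using cond_probability_uniform[OF Y, where P = "\<lambda>x es. c * (real (visits es x) / ln (real n)) \<ge> w" for n]
    by (intro AE_ball_countable') auto
  with AE_popular_ratio[OF w] show ?thesis
  proof eventually_elim
    case (elim \<omega>)
    have "eventually (\<lambda>n. real (popular (thr w n) (increments n \<omega>)) / real (popular 1 (increments n \<omega>))
      = cond_probability M (walk_algebra M X)
          (\<lambda>\<omega>'. c * (real (local_time X n (Y n \<omega>') \<omega>') / ln (real n)) \<ge> w) \<omega>) sequentially"
      using eventually_ge_at_top[of 2]
    proof eventually_elim
      case (elim n)
      have ln: "ln (real n) > 0" using elim by simp
      have "(c * (real k / ln (real n)) \<ge> w) = (w * ln (real n) / c \<le> real k)" for k
        using ln c_pos by (simp add: field_simps)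
      \<comment> \<open>The condition k >= 1 stands for membership in the range and matches the
        maximum with 1 in \<open>thr\<close>.\<close>
      then have iff: "(k \<ge> 1 \<and> c * (real k / ln (real n)) \<ge> w) = (thr w n \<le> k)" for k
        unfolding thr_def by (auto simp: nat_le_iff ceiling_le_iff)
      have "{x \<in> walk_range X n \<omega>. c * (real (visits (increments n \<omega>) x) / ln (real n)) \<ge> w}
          = {x. thr w n \<le> visits (increments n \<omega>) x}"
        unfolding walk_range_eq using iff by auto
      then show ?case
        using \<open>\<forall>n\<in>{1..}. _ n\<close> elim by (simp add: visits_increments[symmetric] card_walk_range popular_def[of "thr w n"])
    qed
    then show ?case using elim(1) by (simp add: tendsto_cong)
  qed
qed

end

section \<open>Fourier inversion and the local limit theorem\<close>

lemma Basis_vec_real: "(Basis :: (real ^ 'd) set) = range (\<lambda>i. axis i 1)"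
  by (auto simp: Basis_vec_def)

lemma prod_Basis_vec: "(\<Prod>b\<in>(Basis :: (real ^ 'd) set). h b) = (\<Prod>i\<in>UNIV. h (axis i 1))"
  unfolding Basis_vec_real by (subst prod.reindex) (auto simp: inj_on_def axis_eq_axis)

lemma
  fixes f :: "'d::finite \<Rightarrow> real \<Rightarrow> 'c::{real_normed_field,banach,second_countable_topology}"
  assumes f: "\<And>i. integrable lborel (f i)"
  shows integrable_lborel_prod_vec: "integrable lborel (\<lambda>t :: real ^ 'd. \<Prod>i\<in>UNIV. f i (t $ i))"
    and integral_lborel_prod_vec: "(\<integral>t. (\<Prod>i\<in>UNIV. f i (t $ i)) \<partial>(lborel :: (real ^ 'd) measure)) = (\<Prod>i\<in>UNIV. \<integral>s. f i s \<partial>lborel)"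
proof -
  \<comment> \<open>Recovers a coordinate index from its basis vector, because \<open>lborel\<close>
    on vectors is a product indexed by \<open>Basis\<close>.\<close>
  define idx where "idx b = (SOME i. b = axis i (1 :: real))" for b :: "real ^ 'd"
  have idx: "idx (axis i 1) = i" for i
    unfolding idx_def by (rule some_equality) (auto simp: axis_eq_axis)
  interpret product_sigma_finite "\<lambda>_ :: real ^ 'd. lborel :: real measure" ..
  define T where "T x = (\<Sum>b\<in>Basis. x b *\<^sub>R b)" for x :: "real ^ 'd \<Rightarrow> real"
  have T: "T \<in> (\<Pi>\<^sub>M b\<in>Basis. lborel) \<rightarrow>\<^sub>M borel" unfolding T_def[abs_def] by measurable
  have comp: "(\<Prod>i\<in>UNIV. f i (T x $ i)) = (\<Prod>b\<in>Basis. f (idx b) (x b))" for x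
  proof -
    have "T x $ i = x (axis i 1)" for i
      using inner_sum_left_Basis[of "axis i 1" x] inner_axis[of "T x" i 1] by (simp add: T_def Basis_vec_real)
    then show ?thesis unfolding prod_Basis_vec idx by simp
  qed
  have meas: "(\<lambda>t :: real ^ 'd. \<Prod>i\<in>UNIV. f i (t $ i)) \<in> borel_measurable borel"
  proof (rule borel_measurable_prod)
    fix i
    have "f i \<in> borel_measurable borel" using borel_measurable_integrable[OF f[of i]] by simp
    then show "(\<lambda>t :: real ^ 'd. f i (t $ i)) \<in> borel_measurable borel"
      by (rule measurable_compose[rotated]) simp
  qed
  have int: "integrable (\<Pi>\<^sub>M b\<in>Basis. lborel) (\<lambda>x. \<Prod>b\<in>Basis. f (idx b) (x b))"
    by (rule product_integrable_prod) (auto intro: f)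
  have lb: "(lborel :: (real ^ 'd) measure) = distr (\<Pi>\<^sub>M b\<in>Basis. lborel) borel T"
    unfolding T_def[abs_def] by (rule lborel_eq)
  show "integrable lborel (\<lambda>t :: real ^ 'd. \<Prod>i\<in>UNIV. f i (t $ i))"
    unfolding lb by (subst integrable_distr_eq[OF T meas]) (simp add: comp int)
  have "(\<integral>t. (\<Prod>i\<in>UNIV. f i (t $ i)) \<partial>(lborel :: (real ^ 'd) measure)) = (\<integral>x. (\<Prod>b\<in>Basis. f (idx b) (x b)) \<partial>(\<Pi>\<^sub>M b\<in>Basis. lborel))"
    unfolding lb by (subst integral_distr[OF T meas]) (simp add: comp)
  also have "\<dots> = (\<Prod>b\<in>Basis. \<integral>s. f (idx b) s \<partial>lborel)"
    by (rule product_integral_prod) (auto intro: f)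
  also have "\<dots> = (\<Prod>i\<in>UNIV. \<integral>s. f i s \<partial>lborel)"
    unfolding prod_Basis_vec idx ..
  finally show "(\<integral>t. (\<Prod>i\<in>UNIV. f i (t $ i)) \<partial>(lborel :: (real ^ 'd) measure)) = (\<Prod>i\<in>UNIV. \<integral>s. f i s \<partial>lborel)" .
qed

lemma
  fixes f :: "real ^ 'd \<Rightarrow> 'c::{banach, second_countable_topology}"
  assumes f: "f \<in> borel_measurable borel" and r: "r > 0"
  shows integral_lborel_scale: "(\<integral>t. f t \<partial>lborel) = r ^ CARD('d) *\<^sub>R (\<integral>s. f (r *\<^sub>R s) \<partial>lborel)"
proof -
  have m: "(\<lambda>x :: real ^ 'd. 0 + r *\<^sub>R x) \<in> lborel \<rightarrow>\<^sub>M borel" by simp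
  have "(\<integral>t. f t \<partial>lborel) = (\<integral>t. f t \<partial>density (distr lborel borel (\<lambda>x. 0 + r *\<^sub>R x)) (\<lambda>_. ennreal (r ^ CARD('d))))"
    using lborel_affine[of r "0 :: real ^ 'd"] r by simp
  also have "\<dots> = (\<integral>t. r ^ CARD('d) *\<^sub>R f t \<partial>distr lborel borel (\<lambda>x. 0 + r *\<^sub>R x))"
    by (rule integral_density) (use f r in auto)
  also have "\<dots> = (\<integral>s. r ^ CARD('d) *\<^sub>R f (0 + r *\<^sub>R s) \<partial>lborel)"
    by (rule integral_distr[OF m]) (use f in auto)
  finally show ?thesis by simp
qed

lemma has_bochner_integral_exp_abs:
  assumes a: "a > 0"
  shows "has_bochner_integral lborel (\<lambda>s :: real. exp (- a * \<bar>s\<bar>)) (2 / a)"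
proof (rule has_bochner_integral_nn_integral)
  let ?g = "\<lambda>s :: real. ennreal (exp (- a * s)) * indicator {0..} s"
  have half: "(\<integral>\<^sup>+s. ?g s \<partial>lborel) = ennreal (0 - (- exp (- a * 0) / a))"
  proof (rule nn_integral_FTC_atLeast)
    show "((\<lambda>s. - exp (- a * s) / a) \<longlongrightarrow> 0) at_top" using a by real_asymp
    show "((\<lambda>s. - exp (- a * s) / a) has_real_derivative exp (- a * s)) (at s)" for s
      using a by (auto intro!: derivative_eq_intros)
  qed auto
  \<comment> \<open>The two half-line integrands overlap at s = 0, so this splitting holds only
    almost everywhere.\<close>
  have "(\<integral>\<^sup>+s. ennreal (exp (- a * \<bar>s\<bar>)) \<partial>lborel) = (\<integral>\<^sup>+s. ?g s + ?g (0 + (- 1) * s) \<partial>lborel)"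
    by (rule nn_integral_cong_AE, rule eventually_mono[OF AE_lborel_singleton[of 0]])
       (auto simp: indicator_def)
  also have "\<dots> = (\<integral>\<^sup>+s. ?g s \<partial>lborel) + (\<integral>\<^sup>+s. ?g (0 + (- 1) * s) \<partial>lborel)"
    by (rule nn_integral_add) auto
  also have "(\<integral>\<^sup>+s. ?g (0 + (- 1) * s) \<partial>lborel) = (\<integral>\<^sup>+s. ?g s \<partial>lborel)"
    by (subst (2) nn_integral_real_affine[where c = "- 1" and t = 0]) auto
  also have "(\<integral>\<^sup>+s. ?g s \<partial>lborel) + (\<integral>\<^sup>+s. ?g s \<partial>lborel) = ennreal (2 / a)"
    unfolding half using a by (simp add: ennreal_plus[symmetric] del: ennreal_plus)
  finally show "(\<integral>\<^sup>+s. ennreal (exp (- a * \<bar>s\<bar>)) \<partial>lborel) = ennreal (2 / a)" .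
qed (use a in auto)

lemma has_bochner_integral_exp_int:
  fixes m :: int
  shows "has_bochner_integral lborel (\<lambda>s. indicator {- pi..pi} s *\<^sub>R exp (\<i> * of_real (s * of_int m)))
    (if m = 0 then of_real (2 * pi) else 0)"
proof (cases "m = 0")
  case True
  have "has_bochner_integral lborel (\<lambda>s. indicator {- pi..pi} s *\<^sub>R (1 :: complex)) (measure lborel {- pi..pi} *\<^sub>R 1)"
    by (rule has_bochner_integral_scaleR_left, rule has_bochner_integral_real_indicator) auto
  then show ?thesis using True by (simp add: scaleR_conv_of_real)
next
  case False
  define F where "F s = exp (\<i> * of_real (s * of_int m)) / (\<i> * of_int m)" for s :: real
  have "has_bochner_integral lborel (\<lambda>s. indicator {- pi..pi} s *\<^sub>R exp (\<i> * of_real (s * of_int m))) (F pi - F (- pi))"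
  proof (rule has_bochner_integral_FTC_Icc)
    fix s assume "- pi \<le> s" "s \<le> pi"
    show "(F has_vector_derivative exp (\<i> * of_real (s * of_int m))) (at s within {- pi..pi})"
      unfolding F_def using False
      by (auto intro!: derivative_eq_intros has_vector_derivative_real_field simp: field_simps)
  qed (auto intro!: continuous_intros)
  also have "F pi - F (- pi) = 0"
  proof -
    have "sin (pi * of_int m) = 0" by (auto simp: sin_zero_iff_int2)
    then have "exp (\<i> * of_real (pi * of_int m)) = exp (\<i> * of_real (- pi * of_int m))"
      unfolding cis_conv_exp[symmetric] by (simp add: complex_eq_iff)
    then show ?thesis by (simp add: F_def)
  qed
  finally show ?thesis using False by simp
qed

definition cf :: "(int ^ 'd) pmf \<Rightarrow> real ^ 'd \<Rightarrow> complex" where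
  "cf \<nu> t = (\<integral>x. exp (\<i> * of_real (t \<bullet> real_vec x)) \<partial>measure_pmf \<nu>)"

text \<open>The torus dual to the lattice, as a closed box so that compactness is available in
  \<open>cf_decay\<close>.\<close>

definition pibox :: "(real ^ 'd) set" where
  "pibox = cbox (\<chi> i. - pi) (\<chi> i. pi)"

lemma mem_pibox: "t \<in> pibox \<longleftrightarrow> (\<forall>i. \<bar>t $ i\<bar> \<le> pi)"
  unfolding pibox_def mem_box_cart by (auto simp: abs_le_iff; smt (verit))

lemma compact_pibox: "compact pibox"
  by (simp add: pibox_def)

lemma pibox_borel [measurable]: "pibox \<in> sets borel"
  by (simp add: pibox_def)

lemma emeasure_pibox: "emeasure lborel pibox < \<infinity>"
  unfolding pibox_def by (rule emeasure_lborel_cbox_finite)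

text \<open>Orthogonality of characters; the integral factors over the coordinates, and a single
  coordinate with nonzero frequency makes it vanish.\<close>

lemma integral_pibox_exp:
  fixes k :: "int ^ 'd"
  shows "(\<integral>t. indicator pibox t *\<^sub>R exp (\<i> * of_real (t \<bullet> real_vec k)) \<partial>lborel)
    = (if k = 0 then of_real ((2 * pi) ^ CARD('d)) else 0)"
proof -
  let ?f = "\<lambda>i s. indicator {- pi..pi} s *\<^sub>R exp (\<i> * of_real (s * of_int (k $ i)))"
  have "indicator pibox t *\<^sub>R exp (\<i> * of_real (t \<bullet> real_vec k)) = (\<Prod>i\<in>UNIV. ?f i (t $ i))" for t :: "real ^ 'd"
  proof -
    have "(\<Prod>i\<in>UNIV. indicator {- pi..pi} (t $ i) :: real) = indicator pibox t"
    proof (cases "t \<in> pibox")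
      case False
      then obtain i where "\<not> \<bar>t $ i\<bar> \<le> pi" by (auto simp: mem_pibox)
      then have "t $ i \<notin> {- pi..pi}" by auto
      then show ?thesis using False by (auto intro!: prod_zero simp: indicator_def)
    next
      case True
      then have "t $ i \<in> {- pi..pi}" for i using spec[of _ i] by (simp add: mem_pibox abs_le_iff minus_le_iff)
      then show ?thesis using True by simp
    qed
    moreover have "(\<Prod>i\<in>UNIV. exp (\<i> * of_real (t $ i * of_int (k $ i)))) = exp (\<i> * of_real (t \<bullet> real_vec k))"
      by (simp add: exp_sum[symmetric] inner_vec_def real_vec_def sum_distrib_left)
    ultimately show ?thesis
      by (simp add: scaleR_conv_of_real prod.distrib of_real_prod[symmetric] del: of_real_prod)
  qed
  then have "(\<integral>t. indicator pibox t *\<^sub>R exp (\<i> * of_real (t \<bullet> real_vec k)) \<partial>lborel)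
      = (\<integral>t. (\<Prod>i\<in>UNIV. ?f i (t $ i)) \<partial>lborel)"
    by (intro Bochner_Integration.integral_cong) auto
  also have "\<dots> = (\<Prod>i\<in>UNIV. \<integral>s. ?f i s \<partial>lborel)"
    by (rule integral_lborel_prod_vec) (rule integrable.intros, rule has_bochner_integral_exp_int)
  also have "\<dots> = (\<Prod>i\<in>UNIV. if k $ i = 0 then of_real (2 * pi) else 0)"
    by (intro prod.cong refl has_bochner_integral_integral_eq has_bochner_integral_exp_int)
  also have "\<dots> = (if k = 0 then of_real ((2 * pi) ^ CARD('d)) else 0)"
    by (auto simp: vec_eq_iff)
  finally show ?thesis .
qed

lemma norm_exp_ii [simp]: "norm (exp (\<i> * of_real x)) = 1"
  by (simp add: norm_exp_eq_Re)

lemma norm_cf_le: "norm (cf \<nu> t) \<le> 1"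
proof -
  have "norm (cf \<nu> t) \<le> (\<integral>x. norm (exp (\<i> * of_real (t \<bullet> real_vec x))) \<partial>measure_pmf \<nu>)"
    unfolding cf_def by (rule integral_norm_bound)
  then show ?thesis by simp
qed

lemma continuous_cf:
  fixes \<nu> :: "(int ^ 'd) pmf"
  shows "continuous_on UNIV (cf \<nu>)"
proof (rule continuous_on_sequentiallyI)
  fix t :: "nat \<Rightarrow> real ^ 'd" and a assume "t \<longlonglongrightarrow> a"
  then show "(\<lambda>n. cf \<nu> (t n)) \<longlonglongrightarrow> cf \<nu> a"
    unfolding cf_def
    by (intro integral_dominated_convergence[where w = "\<lambda>_. 1"]) (auto intro!: tendsto_intros)
qed

lemma cf_measurable [measurable]: "cf \<nu> \<in> borel_measurable borel"
  by (rule borel_measurable_continuous_onI[OF continuous_cf])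

lemma real_vec_diff: "real_vec (x - y) = real_vec x - real_vec y"
  and real_vec_add: "real_vec (x + y) = real_vec x + real_vec y"
  and real_vec_0: "real_vec 0 = 0"
  by (simp_all add: real_vec_def vec_eq_iff)

text \<open>Fubini applies because the box has finite measure and the exponentials have modulus 1;
  orthogonality then leaves only the term y = x.\<close>

lemma fourier_inversion:
  fixes \<nu> :: "(int ^ 'd) pmf"
  shows "(\<integral>t. indicator pibox t *\<^sub>R (cf \<nu> t * exp (- (\<i> * of_real (t \<bullet> real_vec x)))) \<partial>lborel)
    = of_real ((2 * pi) ^ CARD('d) * pmf \<nu> x)"
proof -
  interpret pair_sigma_finite "measure_pmf \<nu>" "lborel :: (real ^ 'd) measure" ..
  let ?g = "\<lambda>y t. exp (\<i> * of_real (t \<bullet> real_vec (y - x)))"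
  let ?f = "\<lambda>y t. indicator pibox t *\<^sub>R ?g y t"
  have rv: "(\<lambda>p. real_vec (fst p - x)) \<in> borel_measurable (measure_pmf \<nu> \<Otimes>\<^sub>M (lborel :: (real ^ 'd) measure))"
    by (rule measurable_compose[OF measurable_fst]) simp
  have gm: "(\<lambda>p. ?g (fst p) (snd p)) \<in> borel_measurable (measure_pmf \<nu> \<Otimes>\<^sub>M (lborel :: (real ^ 'd) measure))"
    using rv by measurable
  have int: "integrable (measure_pmf \<nu> \<Otimes>\<^sub>M lborel) (\<lambda>(y, t). ?f y t)"
  proof -
    have "integrable (measure_pmf \<nu> \<Otimes>\<^sub>M lborel) (\<lambda>p. indicator (UNIV \<times> pibox) p *\<^sub>R ?g (fst p) (snd p))"
    proof (rule integrableI_bounded_set_indicator[where B = 1])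
      show "emeasure (measure_pmf \<nu> \<Otimes>\<^sub>M lborel) (UNIV \<times> (pibox :: (real ^ 'd) set)) < \<infinity>"
        using emeasure_pibox by (subst lborel.emeasure_pair_measure_Times) (auto simp: ennreal_mult_less_top)
    qed (use gm in auto)
    then show ?thesis
      by (rule Bochner_Integration.integrable_cong[THEN iffD1, rotated 2]) (auto simp: indicator_def split: prod.splits)
  qed
  have "(\<integral>t. indicator pibox t *\<^sub>R (cf \<nu> t * exp (- (\<i> * of_real (t \<bullet> real_vec x)))) \<partial>lborel)
      = (\<integral>t. (\<integral>y. ?f y t \<partial>measure_pmf \<nu>) \<partial>lborel)"
  proof (intro Bochner_Integration.integral_cong refl)
    fix t :: "real ^ 'd"
    have "cf \<nu> t * exp (- (\<i> * of_real (t \<bullet> real_vec x))) = (\<integral>y. ?g y t \<partial>measure_pmf \<nu>)"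
      unfolding cf_def
      by (subst integral_mult_left_zero[symmetric])
         (auto intro!: Bochner_Integration.integral_cong simp: exp_add[symmetric] real_vec_diff inner_diff_right algebra_simps)
    then show "indicator pibox t *\<^sub>R (cf \<nu> t * exp (- (\<i> * of_real (t \<bullet> real_vec x)))) = (\<integral>y. ?f y t \<partial>measure_pmf \<nu>)"
      by simp
  qed
  also have "\<dots> = (\<integral>y. (\<integral>t. ?f y t \<partial>lborel) \<partial>measure_pmf \<nu>)"
    by (rule Fubini_integral[OF int])
  also have "\<dots> = (\<integral>y. of_real ((2 * pi) ^ CARD('d) * indicator {x} y) \<partial>measure_pmf \<nu>)"
    unfolding integral_pibox_exp by (intro Bochner_Integration.integral_cong) (auto simp: indicator_def)
  also have "\<dots> = of_real ((2 * pi) ^ CARD('d) * pmf \<nu> x)"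
    by (subst integral_complex_of_real) (simp add: pmf.rep_eq)
  finally show ?thesis .
qed

lemma measure_pair_pmf:
  fixes \<mu> :: "'a::countable pmf" and \<nu> :: "'b::countable pmf"
  shows "measure_pmf (pair_pmf \<mu> \<nu>) = measure_pmf \<mu> \<Otimes>\<^sub>M measure_pmf \<nu>"
proof (rule measure_eqI)
  have "sets (measure_pmf \<mu> \<Otimes>\<^sub>M measure_pmf \<nu>) = sets (count_space (UNIV :: 'a set) \<Otimes>\<^sub>M count_space (UNIV :: 'b set))"
    by (rule sets_pair_measure_cong) auto
  then have sets: "sets (measure_pmf \<mu> \<Otimes>\<^sub>M measure_pmf \<nu>) = UNIV"
    by (simp only: pair_measure_countable[OF countableI_type countableI_type] sets_count_space
        UNIV_Times_UNIV Pow_UNIV)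
  then show "sets (measure_pmf (pair_pmf \<mu> \<nu>)) = sets (measure_pmf \<mu> \<Otimes>\<^sub>M measure_pmf \<nu>)" by simp
  fix X
  have "emeasure (measure_pmf (pair_pmf \<mu> \<nu>)) X = (\<integral>\<^sup>+x. indicator X x \<partial>measure_pmf (pair_pmf \<mu> \<nu>))" by simp
  also have "\<dots> = (\<integral>\<^sup>+x. \<integral>\<^sup>+y. indicator X (x, y) \<partial>measure_pmf \<nu> \<partial>measure_pmf \<mu>)"
    by (rule nn_integral_pair_pmf')
  also have "\<dots> = emeasure (measure_pmf \<mu> \<Otimes>\<^sub>M measure_pmf \<nu>) X"
    by (rule measure_pmf.emeasure_pair_measure[symmetric]) (simp add: sets)
  finally show "emeasure (measure_pmf (pair_pmf \<mu> \<nu>)) X = emeasure (measure_pmf \<mu> \<Otimes>\<^sub>M measure_pmf \<nu>) X" .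
qed

lemma cf_map_add:
  fixes \<mu> \<nu> :: "(int ^ 'd) pmf"
  shows "cf (map_pmf (\<lambda>(x, y). x + y) (pair_pmf \<mu> \<nu>)) t = cf \<mu> t * cf \<nu> t"
proof -
  interpret pair_sigma_finite "measure_pmf \<mu>" "measure_pmf \<nu>" ..
  let ?g = "\<lambda>x :: int ^ 'd. exp (\<i> * of_real (t \<bullet> real_vec x))"
  have int: "integrable (measure_pmf (pair_pmf \<mu> \<nu>)) (\<lambda>z. ?g (fst z) * ?g (snd z))"
    by (rule measure_pmf.integrable_const_bound[where B = 1]) (auto simp: norm_mult)
  have "cf (map_pmf (\<lambda>(x, y). x + y) (pair_pmf \<mu> \<nu>)) t = (\<integral>z. ?g (fst z) * ?g (snd z) \<partial>measure_pmf (pair_pmf \<mu> \<nu>))"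
    unfolding cf_def
    by (simp add: case_prod_unfold real_vec_add inner_add_right exp_add[symmetric] distrib_left)
  also have "\<dots> = (\<integral>x. (\<integral>y. ?g x * ?g y \<partial>measure_pmf \<nu>) \<partial>measure_pmf \<mu>)"
    using integral_fst'[OF int[unfolded measure_pair_pmf]] by (simp add: measure_pair_pmf)
  finally show ?thesis by (simp add: cf_def)
qed

lemma cf_sum_list: "cf (map_pmf sum_list (replicate_pmf n mu)) t = cf mu t ^ n"
proof (induction n)
  case 0
  then show ?case by (simp add: cf_def real_vec_0)
next
  case (Suc n)
  have "map_pmf sum_list (replicate_pmf (Suc n) mu)
      = map_pmf (\<lambda>(x, y). x + y) (pair_pmf mu (map_pmf sum_list (replicate_pmf n mu)))"
    by (simp add: pair_pmf_def map_pmf_def bind_assoc_pmf bind_return_pmf)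
  then show ?case using Suc by (simp only: cf_map_add power_Suc)
qed

lemma zero_power_card [simp]: "(0 :: real) ^ CARD('d::finite) = 0"
  by (simp add: power_0_left)

lemma harm_over_ln: "(\<lambda>n. harm n / ln (real n)) \<longlonglongrightarrow> (1 :: real)"
proof -
  have "(\<lambda>n. 1 / ln (real n)) \<longlonglongrightarrow> 0" by real_asymp
  then have "(\<lambda>n. (harm n - ln (real n)) * (1 / ln (real n)) + 1) \<longlonglongrightarrow> euler_mascheroni * 0 + (1 :: real)"
    using euler_mascheroni_LIMSEQ by (intro tendsto_intros) auto
  moreover have "eventually (\<lambda>n. (harm n - ln (real n)) * (1 / ln (real n)) + 1 = harm n / ln (real n)) sequentially"
    using eventually_ge_at_top[of 3] by eventually_elim (simp add: field_simps)
  ultimately show ?thesis by (simp add: tendsto_cong)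
qed

text \<open>Write a_j = L / j + e_j / j with e_j -> 0. The first part is L times a harmonic sum; in
  the second, finitely many terms are bounded and the others are a small multiple of the harmonic
  sum.\<close>

lemma sum_asymp_ln:
  fixes a :: "nat \<Rightarrow> real"
  assumes a: "(\<lambda>n. real n * a n) \<longlonglongrightarrow> L"
  shows "(\<lambda>n. (\<Sum>j\<le>n. a j) / ln (real n)) \<longlonglongrightarrow> L"
proof -
  define e where "e j = real j * a j - L" for j
  define R where "R n = (\<Sum>j\<in>{1..n}. \<bar>e j\<bar> / real j)" for n
  have e: "e \<longlonglongrightarrow> 0" using tendsto_diff[OF a tendsto_const[of L]] by (simp add: e_def[abs_def])
  have inv: "(\<lambda>n. 1 / ln (real n)) \<longlonglongrightarrow> 0" by real_asymp
  have R: "(\<lambda>n. R n / ln (real n)) \<longlonglongrightarrow> 0"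
  proof (rule order_tendstoI)
    fix x :: real assume "x < 0"
    have "R n / ln (real n) \<ge> 0" for n unfolding R_def
      by (cases "n = 0") (auto intro!: divide_nonneg_nonneg sum_nonneg)
    then show "eventually (\<lambda>n. x < R n / ln (real n)) sequentially"
      using \<open>x < 0\<close> by (intro always_eventually allI) (rule less_le_trans)
  next
    fix x :: real assume x: "0 < x"
    then obtain J where J: "\<And>j. j \<ge> J \<Longrightarrow> \<bar>e j\<bar> < x / 2"
      using LIMSEQ_D[OF e, of "x / 2"] by auto
    define K where "K = (\<Sum>j<J. \<bar>e j\<bar> / real j)"
    have bd: "R n \<le> K + x / 2 * harm n" for n
    proof -
      have "R n \<le> (\<Sum>j\<in>{1..n}. (if j < J then \<bar>e j\<bar> / real j else 0) + x / 2 * (1 / real j))"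
        unfolding R_def
      proof (rule sum_mono)
        fix j assume j: "j \<in> {1..n}"
        show "\<bar>e j\<bar> / real j \<le> (if j < J then \<bar>e j\<bar> / real j else 0) + x / 2 * (1 / real j)"
        proof (cases "j < J")
          case False
          then have "\<bar>e j\<bar> / real j \<le> (x / 2) / real j" using J[of j] by (intro divide_right_mono) auto
          then show ?thesis using False by simp
        qed (use x in simp)
      qed
      also have "\<dots> = (\<Sum>j\<in>{1..n}. if j < J then \<bar>e j\<bar> / real j else 0) + x / 2 * harm n"
        by (simp add: sum.distrib sum_distrib_left harm_def inverse_eq_divide)
      also have "(\<Sum>j\<in>{1..n}. if j < J then \<bar>e j\<bar> / real j else 0) \<le> K"
      proof -
        have "(\<Sum>j\<in>{1..n}. if j < J then \<bar>e j\<bar> / real j else 0) = (\<Sum>j\<in>{1..n} \<inter> {..<J}. \<bar>e j\<bar> / real j)"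
          by (subst sum.inter_restrict) (auto intro!: sum.cong)
        also have "\<dots> \<le> K" unfolding K_def by (intro sum_mono2) auto
        finally show ?thesis .
      qed
      finally show ?thesis by simp
    qed
    have "(\<lambda>n. K * (1 / ln (real n)) + x / 2 * (harm n / ln (real n))) \<longlonglongrightarrow> K * 0 + x / 2 * 1"
      by (intro tendsto_add tendsto_mult tendsto_const inv harm_over_ln)
    then have "eventually (\<lambda>n. K * (1 / ln (real n)) + x / 2 * (harm n / ln (real n)) < x) sequentially"
      by (rule order_tendstoD) (use x in simp)
    then show "eventually (\<lambda>n. R n / ln (real n) < x) sequentially"
      using eventually_ge_at_top[of 3]
    proof eventually_elim
      case (elim n)
      have "R n / ln (real n) \<le> (K + x / 2 * harm n) / ln (real n)"
        using elim by (intro divide_right_mono bd) auto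
      then show ?case using elim by (simp add: add_divide_distrib)
    qed
  qed
  have split: "(\<Sum>j\<le>n. a j) = a 0 + L * harm n + (\<Sum>j\<in>{1..n}. e j / real j)" for n
  proof -
    have "(\<Sum>j\<le>n. a j) = a 0 + (\<Sum>j\<in>{1..n}. a j)"
      by (simp add: atMost_atLeast0 sum.atLeast_Suc_atMost)
    also have "(\<Sum>j\<in>{1..n}. a j) = (\<Sum>j\<in>{1..n}. L * (1 / real j) + e j / real j)"
      by (intro sum.cong refl) (simp add: e_def field_simps)
    finally show ?thesis by (simp add: sum.distrib sum_distrib_left harm_def inverse_eq_divide)
  qed
  have E: "(\<lambda>n. (\<Sum>j\<in>{1..n}. e j / real j) / ln (real n)) \<longlonglongrightarrow> 0"
  proof (rule Lim_null_comparison[OF _ R])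
    have bd: "\<bar>\<Sum>j\<in>{1..n}. e j / real j\<bar> \<le> R n" for n
      unfolding R_def by (rule order.trans[OF sum_abs]) simp
    show "eventually (\<lambda>n. norm ((\<Sum>j\<in>{1..n}. e j / real j) / ln (real n)) \<le> R n / ln (real n)) sequentially"
      using eventually_ge_at_top[of 3]
    proof eventually_elim
      case (elim n)
      then have "\<bar>\<Sum>j\<in>{1..n}. e j / real j\<bar> / ln (real n) \<le> R n / ln (real n)"
        by (intro divide_right_mono bd) simp
      then show ?case using elim by simp
    qed
  qed
  have "(\<lambda>n. a 0 * (1 / ln (real n)) + L * (harm n / ln (real n)) + (\<Sum>j\<in>{1..n}. e j / real j) / ln (real n))
      \<longlonglongrightarrow> a 0 * 0 + L * 1 + 0"
    by (intro tendsto_add tendsto_mult tendsto_const inv harm_over_ln E)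
  then show ?thesis by (simp add: split add_divide_distrib)
qed

text \<open>In each coordinate |s_i| - 1 <= |s|^d. Averaging this over the d coordinates dominates
  the function by a product of one-dimensional exponentials exp(\<kappa> / d - (\<kappa> / d)
  |s_i|).\<close>

lemma integrable_exp_norm:
  assumes \<kappa>: "\<kappa> > 0"
  shows "integrable lborel (\<lambda>s :: real ^ 'd. exp (- \<kappa> * norm s ^ CARD('d)))"
proof (rule Bochner_Integration.integrable_bound)
  let ?d = "CARD('d)"
  let ?f = "\<lambda>(i :: 'd) s :: real. exp (\<kappa> / ?d) * exp (- (\<kappa> / ?d) * \<bar>s\<bar>)"
  have "integrable lborel (?f i)" for i
    using \<kappa> by (intro integrable_mult_right integrable.intros[OF has_bochner_integral_exp_abs]) simp
  then show "integrable lborel (\<lambda>s :: real ^ 'd. \<Prod>i\<in>UNIV. ?f i (s $ i))"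
    by (rule integrable_lborel_prod_vec)
  show "AE s in lborel. norm (exp (- \<kappa> * norm s ^ ?d)) \<le> norm (\<Prod>i\<in>UNIV. ?f i ((s :: real ^ 'd) $ i))"
  proof (rule AE_I2)
    fix s :: "real ^ 'd"
    have "\<bar>s $ i\<bar> - 1 \<le> norm s ^ ?d" for i
    proof (cases "\<bar>s $ i\<bar> \<ge> 1")
      case True
      then have "\<bar>s $ i\<bar> \<le> \<bar>s $ i\<bar> ^ ?d" by (intro self_le_power) auto
      also have "\<dots> \<le> norm s ^ ?d" by (intro power_mono component_le_norm_cart) auto
      finally show ?thesis by simp
    qed (smt (verit) zero_le_power norm_ge_zero)
    then have "(\<Sum>i\<in>(UNIV :: 'd set). \<bar>s $ i\<bar> - 1) \<le> (\<Sum>i\<in>(UNIV :: 'd set). norm s ^ ?d)"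
      by (intro sum_mono)
    then have "\<kappa> / ?d * (\<Sum>i\<in>UNIV. \<bar>s $ i\<bar> - 1) \<le> \<kappa> / ?d * (real ?d * norm s ^ ?d)"
      using \<kappa> by (intro mult_left_mono) auto
    then have "exp (- \<kappa> * norm s ^ ?d) \<le> exp (- (\<kappa> / ?d * (\<Sum>i\<in>UNIV. \<bar>s $ i\<bar> - 1)))" by simp
    also have "- (\<kappa> / ?d * (\<Sum>i\<in>UNIV. \<bar>s $ i\<bar> - 1)) = (\<Sum>i\<in>UNIV. \<kappa> / ?d + - (\<kappa> / ?d) * \<bar>s $ i\<bar>)"
      by (simp add: sum_distrib_left sum_negf[symmetric] algebra_simps sum_subtractf)
    also have "exp \<dots> = (\<Prod>i\<in>UNIV. ?f i (s $ i))" by (simp only: exp_sum finite exp_add)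
    finally have "exp (- \<kappa> * norm s ^ ?d) \<le> (\<Prod>i\<in>UNIV. ?f i (s $ i))" .
    then show "norm (exp (- \<kappa> * norm s ^ ?d)) \<le> norm (\<Prod>i\<in>UNIV. ?f i (s $ i))" by simp
  qed
qed auto

text \<open>Common frame of A1 with Q(t) = \<gamma> |t| in dimension 1 and of A2 with Q half the
  covariance form in dimension 2. In both the degree of homogeneity equals the dimension, which
  makes return probabilities of order 1 / n.\<close>

locale lattice_cf = random_walk mu for mu :: "(int ^ 'd) pmf" +
  fixes Q :: "real ^ 'd \<Rightarrow> real" and q q' :: real
  assumes aperiodic: "\<And>L x. additive_subgroup L \<Longrightarrow> (\<forall>y\<in>set_pmf mu. y - x \<in> L) \<Longrightarrow> L = UNIV"
    and Q_measurable [measurable]: "Q \<in> borel_measurable borel"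
    and Q_hom: "\<And>r s. r \<ge> 0 \<Longrightarrow> Q (r *\<^sub>R s) = r ^ CARD('d) * Q s"
    and q_pos: "q > 0"
    and Q_ge: "\<And>s. q * norm s ^ CARD('d) \<le> Q s"
    and Q_le: "\<And>s. Q s \<le> q' * norm s ^ CARD('d)"
    and expansion: "((\<lambda>t. (cf mu t - (1 - of_real (Q t))) / of_real (norm t ^ CARD('d))) \<longlongrightarrow> 0) (at 0)"
begin

abbreviation N :: "real ^ 'd \<Rightarrow> real" where
  "N t \<equiv> norm t ^ CARD('d)"

lemma Q_nonneg: "0 \<le> Q s"
  using Q_ge[of s] q_pos by (smt (verit) mult_nonneg_nonneg norm_ge_zero zero_le_power)

text \<open>Modulus 1 is equality in the triangle inequality, so the character of \<open>t\<close>
  is constant on the support of the step. All differences of steps then lie in the kernel of this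
  character, which by aperiodicity is the whole lattice.\<close>

lemma cf_norm_less_1:
  assumes t: "t \<in> pibox" "t \<noteq> 0"
  shows "norm (cf mu t) < 1"
proof (rule ccontr)
  let ?e = "\<lambda>x. exp (\<i> * of_real (t \<bullet> real_vec x))"
  define z where "z = cf mu t"
  assume "\<not> norm (cf mu t) < 1"
  then have z: "norm z = 1" using norm_cf_le[of mu t] by (simp add: z_def)
  have zz: "z * cnj z = 1" using z by (simp add: complex_norm_square[symmetric])
  have int: "integrable (measure_pmf mu) ?e"
    by (rule measure_pmf.integrable_const_bound[where B = 1]) auto
  have int': "integrable (measure_pmf mu) (\<lambda>x. 1 - Re (cnj z * ?e x))"
    using int by (intro Bochner_Integration.integrable_diff integrable_Re integrable_mult_right) auto
  have "(\<integral>x. 1 - Re (cnj z * ?e x) \<partial>measure_pmf mu) = 1 - Re (cnj z * z)"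
    using int by (simp add: z_def cf_def Bochner_Integration.integral_diff integrable_Re del: times_complex.sel)
  also have "\<dots> = 0" using zz by (simp add: mult.commute del: times_complex.sel)
  finally have zero: "(\<integral>x. 1 - Re (cnj z * ?e x) \<partial>measure_pmf mu) = 0" .
  have nonneg: "0 \<le> 1 - Re (cnj z * ?e x)" for x
    using complex_Re_le_cmod[of "cnj z * ?e x"] z by (simp add: norm_mult del: times_complex.sel)
  have "AE x in measure_pmf mu. 1 - Re (cnj z * ?e x) = 0"
    using integral_nonneg_eq_0_iff_AE[OF int'] nonneg zero by simp
  then have re: "Re (cnj z * ?e x) = 1" if "x \<in> set_pmf mu" for x
    using that by (simp add: AE_measure_pmf_iff del: times_complex.sel)
  have ez: "?e x = z" if "x \<in> set_pmf mu" for x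
  proof -
    have "norm (cnj z * ?e x) = 1" using z by (simp add: norm_mult)
    then have "(Re (cnj z * ?e x))\<^sup>2 + (Im (cnj z * ?e x))\<^sup>2 = 1"
      by (simp only: cmod_power2[symmetric]) simp
    then have "Im (cnj z * ?e x) = 0" using re[OF that] by (simp del: times_complex.sel)
    then have "cnj z * ?e x = 1" using re[OF that] by (simp add: complex_eq_iff del: times_complex.sel)
    then have "z * cnj z * ?e x = z" by (simp add: mult.assoc)
    then show ?thesis using zz by simp
  qed
  obtain x0 where x0: "x0 \<in> set_pmf mu" using set_pmf_not_empty[of mu] by auto
  \<comment> \<open>The kernel of the character, a subgroup of the lattice.\<close>
  define L where "L = {y. ?e y = 1}"
  have "additive_subgroup L"
    unfolding additive_subgroup_def
  proof (intro conjI ballI)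
    fix x y assume "x \<in> L" "y \<in> L"
    then show "x + y \<in> L" by (simp add: L_def real_vec_add inner_add_right distrib_left exp_add)
  next
    fix x assume "x \<in> L"
    moreover have "real_vec (- x) = - real_vec x" by (simp add: real_vec_def vec_eq_iff)
    ultimately show "- x \<in> L" by (simp add: L_def exp_minus)
  qed (simp add: L_def real_vec_0)
  moreover have "y - x0 \<in> L" if "y \<in> set_pmf mu" for y
    using ez[OF that] ez[OF x0] z
    by (simp add: L_def real_vec_diff inner_diff_right right_diff_distrib exp_diff) (metis norm_zero zero_neq_one)
  ultimately have "L = UNIV" by (intro aperiodic[of L x0]) auto
  have "t $ i = 0" for i
  proof -
    have "axis i 1 \<in> L" using \<open>L = UNIV\<close> by simp
    moreover have "real_vec (axis i 1 :: int ^ 'd) = axis i 1"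
      by (simp add: real_vec_def vec_eq_iff axis_def)
    ultimately have "exp (\<i> * of_real (t $ i)) = 1" by (simp add: L_def inner_axis)
    then obtain n :: int where n: "t $ i = of_int (2 * n) * pi" by (auto simp: exp_eq_1)
    \<comment> \<open>Each coordinate is a multiple of 2 pi, and in the box only the multiple 0
      remains.\<close>
    have "\<bar>t $ i\<bar> \<le> pi" using t by (simp add: mem_pibox)
    then have "2 * \<bar>real_of_int n\<bar> * pi \<le> 1 * pi" unfolding n by (simp add: abs_mult)
    then have "2 * \<bar>real_of_int n\<bar> \<le> 1" using pi_gt_zero by (simp only: mult_le_cancel_right_pos)
    then have "n = 0" by linarith
    then show ?thesis using n by simp
  qed
  then show False using t by (simp add: vec_eq_iff)
qed

text \<open>Near 0 the expansion holds up to an error (q / 2) |t|^d, which takes half of the lower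
  bound q |t|^d for Q. Away from 0 the modulus attains a maximum below 1 on a compact set.\<close>

lemma cf_decay: "\<exists>\<kappa>>0. \<forall>t\<in>pibox. norm (cf mu t) \<le> exp (- \<kappa> * N t)"
proof -
  have N0: "((\<lambda>t. q' * N t) \<longlongrightarrow> q' * N 0) (at 0)" by (intro tendsto_intros)
  have "eventually (\<lambda>t. q' * N t < 1) (at 0)"
    by (rule order_tendstoD(2)[OF N0]) simp
  moreover have "eventually (\<lambda>t. norm ((cf mu t - (1 - of_real (Q t))) / of_real (N t)) < q / 2) (at 0)"
    using tendstoD[OF expansion, of "q / 2"] q_pos by simp
  ultimately have "eventually (\<lambda>t. norm (cf mu t) \<le> exp (- (q / 2) * N t)) (at 0)"
    using eventually_neq_at_within[of 0]
  proof eventually_elim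
    case (elim t)
    have Nt: "N t > 0" using elim by simp
    have "norm (cf mu t - (1 - of_real (Q t))) < q / 2 * N t"
      using elim Nt by (simp add: norm_divide pos_divide_less_eq norm_power)
    moreover have "norm (1 - of_real (Q t) :: complex) = 1 - Q t"
    proof -
      have "norm (1 - of_real (Q t) :: complex) = \<bar>1 - Q t\<bar>"
        by (metis norm_of_real of_real_1 of_real_diff)
      then show ?thesis using Q_le[of t] elim by simp
    qed
    ultimately have "norm (cf mu t) \<le> 1 - Q t + q / 2 * N t"
      using norm_triangle_ineq[of "cf mu t - (1 - of_real (Q t))" "1 - of_real (Q t)"] by simp
    also have "\<dots> \<le> 1 + - (q / 2) * N t" using Q_ge[of t] by simp
    also have "\<dots> \<le> exp (- (q / 2) * N t)" by (rule exp_ge_add_one_self)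
    finally show ?case .
  qed
  then obtain \<delta> where \<delta>: "\<delta> > 0" "\<And>t. t \<noteq> 0 \<Longrightarrow> norm t < \<delta> \<Longrightarrow> norm (cf mu t) \<le> exp (- (q / 2) * N t)"
    unfolding eventually_at by (auto simp: dist_norm)
  define K where "K = pibox - ball (0 :: real ^ 'd) \<delta>"
  have K: "compact K" unfolding K_def by (intro compact_diff compact_pibox) auto
  obtain B where B: "B > 0" "\<And>t :: real ^ 'd. t \<in> pibox \<Longrightarrow> norm t \<le> B"
    using compact_imp_bounded[OF compact_pibox] unfolding bounded_pos by blast
  have "\<exists>\<rho><1. \<forall>t\<in>K. norm (cf mu t) \<le> \<rho>"
  proof (cases "K = {}")
    case True
    then show ?thesis by (intro exI[of _ 0]) auto
  next
    case False
    have "continuous_on K (\<lambda>t. norm (cf mu t))"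
      using continuous_on_subset[OF continuous_cf] by (intro continuous_on_norm) auto
    from continuous_attains_sup[OF K False this] obtain t0
      where t0: "t0 \<in> K" "\<forall>t\<in>K. norm (cf mu t) \<le> norm (cf mu t0)" by blast
    have "norm (cf mu t0) < 1" using t0(1) \<delta>(1) by (intro cf_norm_less_1) (auto simp: K_def)
    then show ?thesis using t0(2) by blast
  qed
  then obtain \<rho> where \<rho>: "\<rho> < 1" "\<And>t. t \<in> K \<Longrightarrow> norm (cf mu t) \<le> \<rho>" by blast
  \<comment> \<open>The second entry serves the compact part: there the modulus is at most \<rho> <=
    exp(-(1 - \<rho>)), and |t| <= B.\<close>
  define \<kappa> where "\<kappa> = min (q / 2) ((1 - \<rho>) / B ^ CARD('d))"
  have "\<kappa> > 0" using q_pos \<rho>(1) B(1) by (simp add: \<kappa>_def)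
  moreover have "norm (cf mu t) \<le> exp (- \<kappa> * N t)" if t: "t \<in> pibox" for t
  proof -
    consider "t = 0" | "t \<noteq> 0" "norm t < \<delta>" | "norm t \<ge> \<delta>" by linarith
    then show ?thesis
    proof cases
      case 1
      then show ?thesis using norm_cf_le[of mu t] by simp
    next
      case 2
      then have "norm (cf mu t) \<le> exp (- (q / 2) * N t)" by (rule \<delta>(2))
      also have "\<dots> \<le> exp (- \<kappa> * N t)"
      proof -
        have "\<kappa> * N t \<le> q / 2 * N t" unfolding \<kappa>_def by (intro mult_right_mono min.cobounded1) simp
        then show ?thesis by (simp only: mult_minus_left exp_le_cancel_iff neg_le_iff_le)
      qed
      finally show ?thesis .
    next
      case 3
      then have "t \<in> K" using t by (simp add: K_def)
      then have "norm (cf mu t) \<le> 1 + (\<rho> - 1)" using \<rho>(2) by simp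
      also have "\<dots> \<le> exp (\<rho> - 1)" by (rule exp_ge_add_one_self)
      also have "\<dots> \<le> exp (- \<kappa> * N t)"
      proof -
        have "\<kappa> * N t \<le> (1 - \<rho>) / B ^ CARD('d) * B ^ CARD('d)"
          using \<rho>(1) B t by (intro mult_mono power_mono) (auto simp: \<kappa>_def)
        then show ?thesis using B(1) by simp
      qed
      finally show ?thesis .
    qed
  qed
  ultimately show ?thesis by blast
qed

text \<open>The scale n^(-1/d), for which n Q(\<open>rate n\<close> s) = Q(s) when n >= 1, and whose
  Jacobian is 1 / n.\<close>

definition rate :: "nat \<Rightarrow> real" where
  "rate n = root CARD('d) (1 / real n)"

lemma rate_power: "rate n ^ CARD('d) = 1 / real n"
  unfolding rate_def by (rule real_root_pow_pos2) auto

lemma rate_pos: "n \<ge> 1 \<Longrightarrow> rate n > 0"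
  by (simp add: rate_def)

lemma N_rate: "N (rate n *\<^sub>R s) = N s / real n"
proof -
  have "0 \<le> rate n" by (simp add: rate_def)
  then show ?thesis by (simp add: power_mult_distrib rate_power)
qed

lemma u_fourier:
  "of_real ((2 * pi) ^ CARD('d) * u n x)
    = (\<integral>t. indicator pibox t *\<^sub>R (cf mu t ^ n * exp (- (\<i> * of_real (t \<bullet> real_vec x)))) \<partial>lborel)"
  unfolding u_eq_pmf fourier_inversion[symmetric] cf_sum_list ..

text \<open>The modulus removes the phase containing x, hence the uniformity in x. Extending
  exp(-\<kappa> n |t|^d) from the box to the whole space and rescaling yields the factor 1 /
  n.\<close>

lemma u_bound: "\<exists>C. \<forall>n\<ge>1. \<forall>x. u n x \<le> C / real n"
proof -
  obtain \<kappa> where \<kappa>: "\<kappa> > 0" "\<And>t. t \<in> pibox \<Longrightarrow> norm (cf mu t) \<le> exp (- \<kappa> * N t)"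
    using cf_decay by blast
  define I where "I = (\<integral>s. exp (- \<kappa> * N s) \<partial>lborel)"
  have "u n x \<le> (I / (2 * pi) ^ CARD('d)) / real n" if n: "n \<ge> 1" for n x
  proof -
    let ?g = "\<lambda>t. indicator pibox t *\<^sub>R (cf mu t ^ n * exp (- (\<i> * of_real (t \<bullet> real_vec x))))"
    have int: "integrable lborel (\<lambda>t :: real ^ 'd. exp (- (\<kappa> * real n) * N t))"
      using \<kappa>(1) n by (intro integrable_exp_norm) simp
    have bd: "norm (?g t) \<le> exp (- (\<kappa> * real n) * N t)" for t
    proof (cases "t \<in> pibox")
      case True
      have "norm (cf mu t) ^ n \<le> exp (- \<kappa> * N t) ^ n"
        using \<kappa>(2)[OF True] by (intro power_mono) auto
      also have "\<dots> = exp (- (\<kappa> * real n) * N t)"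
        by (simp add: exp_of_nat_mult[symmetric] mult_ac)
      moreover have "norm (exp (- (\<i> * of_real (t \<bullet> real_vec x)))) = 1"
        using norm_exp_ii[of "- (t \<bullet> real_vec x)"] by simp
      ultimately show ?thesis using True by (simp add: norm_mult norm_power)
    qed simp
    have "(2 * pi) ^ CARD('d) * u n x = norm (of_real ((2 * pi) ^ CARD('d) * u n x) :: complex)"
      using u_bounds(1)[of n x] by (simp only: norm_of_real) simp
    also have "\<dots> \<le> (\<integral>t. norm (?g t) \<partial>lborel)"
      unfolding u_fourier by (rule integral_norm_bound)
    also have "\<dots> \<le> (\<integral>t. exp (- (\<kappa> * real n) * N t) \<partial>lborel)"
    proof (rule integral_mono)
      show "integrable lborel (\<lambda>t. norm (?g t))"
        by (rule Bochner_Integration.integrable_bound[OF int]) (use bd in auto)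
    qed (use int bd in auto)
    also have "\<dots> = rate n ^ CARD('d) *\<^sub>R (\<integral>s. exp (- (\<kappa> * real n) * N (rate n *\<^sub>R s)) \<partial>lborel)"
      by (rule integral_lborel_scale) (use n rate_pos in auto)
    also have "\<dots> = I / real n"
      using n by (simp add: rate_power N_rate I_def del: norm_scaleR)
    finally have "u n x \<le> I / real n / (2 * pi) ^ CARD('d)"
      by (subst pos_le_divide_eq) (auto simp: mult.commute)
    then show ?thesis by (simp add: mult.commute)
  qed
  then show ?thesis by blast
qed

text \<open>Fourier inversion at the scale \<open>rate n\<close>, then dominated convergence with
  the majorant from \<open>cf_decay\<close>.\<close>

lemma local_limit: "(\<lambda>n. real n * u n 0) \<longlonglongrightarrow> (\<integral>s. exp (- Q s) \<partial>lborel) / (2 * pi) ^ CARD('d)"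
proof -
  obtain \<kappa> where \<kappa>: "\<kappa> > 0" "\<And>t. t \<in> pibox \<Longrightarrow> norm (cf mu t) \<le> exp (- \<kappa> * N t)"
    using cf_decay by blast
  define g where "g n s = (indicator pibox (rate n *\<^sub>R s) :: real) *\<^sub>R cf mu (rate n *\<^sub>R s) ^ n" for n s
  have eq: "of_real ((2 * pi) ^ CARD('d) * (real n * u n 0)) = (\<integral>s. g n s \<partial>lborel)" if n: "n \<ge> 1" for n
  proof -
    have "of_real ((2 * pi) ^ CARD('d) * u n 0) = (\<integral>t. (indicator pibox t :: real) *\<^sub>R cf mu t ^ n \<partial>lborel)"
      unfolding u_fourier by (simp add: real_vec_0)
    also have "\<dots> = rate n ^ CARD('d) *\<^sub>R (\<integral>s. g n s \<partial>lborel)"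
      unfolding g_def by (rule integral_lborel_scale) (use n rate_pos in auto)
    also have "\<dots> = (\<integral>s. g n s \<partial>lborel) / of_nat n"
      by (simp add: rate_power scaleR_conv_of_real)
    finally have "of_real ((2 * pi) ^ CARD('d) * u n 0) * of_nat n = (\<integral>s. g n s \<partial>lborel)"
      using n by (simp add: field_simps)
    then show ?thesis by (simp add: mult_ac)
  qed
  have rate0: "rate \<longlonglongrightarrow> 0"
  proof -
    have "(\<lambda>n. root CARD('d) (1 / real n)) \<longlonglongrightarrow> root CARD('d) 0"
      by (intro tendsto_real_root) real_asymp
    then show ?thesis by (simp add: rate_def[abs_def])
  qed
  have pt: "(\<lambda>n. g n s) \<longlonglongrightarrow> of_real (exp (- Q s))" for s
  proof (cases "s = 0")
    case True
    have "Q 0 = 0" using Q_hom[of 0 0] by simp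
    moreover have "(0 :: real ^ 'd) \<in> pibox" by (simp add: mem_pibox)
    moreover have "cf mu 0 = 1" by (simp add: cf_def)
    ultimately show ?thesis using True by (simp add: g_def)
  next
    case s: False
    have t0: "(\<lambda>n. rate n *\<^sub>R s) \<longlonglongrightarrow> 0" using tendsto_scaleR[OF rate0 tendsto_const[of s]] by simp
    have Qr: "Q (rate n *\<^sub>R s) = Q s / real n" for n
      using Q_hom[of "rate n" s] by (simp add: rate_power) (simp add: rate_def)
    have at0: "filterlim (\<lambda>n. rate n *\<^sub>R s) (at 0) sequentially"
    proof (unfold filterlim_at, intro conjI t0)
      show "eventually (\<lambda>n. rate n *\<^sub>R s \<in> UNIV \<and> rate n *\<^sub>R s \<noteq> 0) sequentially"
        using eventually_ge_at_top[of 1]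
      proof eventually_elim
        case (elim n)
        then show ?case using rate_pos[of n] s by simp
      qed
    qed
    have lim1: "(\<lambda>n. norm ((cf mu (rate n *\<^sub>R s) - (1 - of_real (Q s / real n))) / of_real (N s / real n)) * N s) \<longlonglongrightarrow> norm (0 :: complex) * N s"
      using filterlim_compose[OF expansion at0] unfolding N_rate Qr by (intro tendsto_intros) simp
    have evQ: "eventually (\<lambda>n. Q s / real n \<le> 1) sequentially"
    proof -
      have "eventually (\<lambda>n. real n \<ge> Q s + 1) sequentially" by real_asymp
      then show ?thesis by eventually_elim (use Q_nonneg[of s] in \<open>simp add: field_simps\<close>)
    qed
    have ev: "eventually (\<lambda>n. rate n *\<^sub>R s \<in> pibox) sequentially"
    proof -
      have "eventually (\<lambda>n. norm (rate n *\<^sub>R s) < pi) sequentially"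
        using tendstoD[OF t0, of pi] by simp
      then show ?thesis
      proof eventually_elim
        case (elim n)
        have "\<bar>(rate n *\<^sub>R s) $ i\<bar> \<le> pi" for i
          using component_le_norm_cart[of "rate n *\<^sub>R s" i] elim by linarith
        then show ?case by (simp add: mem_pibox)
      qed
    qed
    \<comment> \<open>For numbers of modulus at most 1, |a^n - b^n| <= n |a - b|. The factor n
      cancels against |t|^d = |s|^d / n in the expansion, so the n-th power may be replaced by (1 -
      Q(s) / n)^n.\<close>
    have diff: "(\<lambda>n. g n s - (1 - of_real (Q s / real n)) ^ n) \<longlonglongrightarrow> 0"
    proof (rule Lim_null_comparison)
      show "(\<lambda>n. norm ((cf mu (rate n *\<^sub>R s) - (1 - of_real (Q s / real n))) / of_real (N s / real n)) * N s) \<longlonglongrightarrow> 0"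
        using lim1 by simp
      show "eventually (\<lambda>n. norm (g n s - (1 - of_real (Q s / real n)) ^ n)
          \<le> norm ((cf mu (rate n *\<^sub>R s) - (1 - of_real (Q s / real n))) / of_real (N s / real n)) * N s) sequentially"
        using ev evQ eventually_ge_at_top[of 1]
      proof eventually_elim
        case (elim n)
        let ?w = "1 - of_real (Q s / real n) :: complex"
        have w: "norm ?w \<le> 1"
        proof -
          have "norm ?w = \<bar>1 - Q s / real n\<bar>"
            by (metis norm_of_real of_real_1 of_real_diff)
          then show ?thesis using elim Q_nonneg[of s] by simp
        qed
        have "norm (g n s - ?w ^ n) \<le> real n * norm (cf mu (rate n *\<^sub>R s) - ?w)"
          using norm_power_diff[OF norm_cf_le w, of mu "rate n *\<^sub>R s" n] elim by (simp add: g_def)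
        also have "\<dots> = norm ((cf mu (rate n *\<^sub>R s) - ?w) / of_real (N s / real n)) * N s"
          using s elim by (simp add: norm_divide norm_power norm_mult)
        finally show ?case .
      qed
    qed
    have "(\<lambda>n. of_real ((1 + (- Q s) / real n) ^ n) :: complex) \<longlonglongrightarrow> of_real (exp (- Q s))"
      by (intro tendsto_of_real tendsto_exp_limit_sequentially)
    from tendsto_add[OF diff this] show ?thesis by simp
  qed
  \<comment> \<open>The shift to \<open>Suc n\<close> avoids n = 0, where \<open>rate\<close> is 0
    and the integrand is the constant 1, which the majorant does not bound.\<close>
  have dom: "(\<lambda>n. \<integral>s. g (Suc n) s \<partial>lborel) \<longlonglongrightarrow> (\<integral>s. of_real (exp (- Q s)) \<partial>lborel)"
  proof (rule integral_dominated_convergence[where w = "\<lambda>s. exp (- \<kappa> * N s)"])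
    show "integrable lborel (\<lambda>s :: real ^ 'd. exp (- \<kappa> * N s))" by (rule integrable_exp_norm[OF \<kappa>(1)])
    show "AE s in lborel. (\<lambda>n. g (Suc n) s) \<longlonglongrightarrow> of_real (exp (- Q s))"
      using pt by (intro AE_I2) (rule LIMSEQ_Suc)
    show "(\<lambda>s. g (Suc n) s) \<in> borel_measurable lborel" for n
    proof -
      have "(\<lambda>t. (indicator pibox t :: real) *\<^sub>R cf mu t ^ Suc n) \<in> borel_measurable borel" by measurable
      from measurable_compose[OF _ this, of "\<lambda>s. rate (Suc n) *\<^sub>R s" lborel] show ?thesis
        unfolding g_def by simp
    qed
    show "AE s in lborel. norm (g (Suc n) s) \<le> exp (- \<kappa> * N s)" for n
    proof (rule AE_I2)
      fix s :: "real ^ 'd"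
      let ?t = "rate (Suc n) *\<^sub>R s"
      show "norm (g (Suc n) s) \<le> exp (- \<kappa> * N s)"
      proof (cases "?t \<in> pibox")
        case True
        have "norm (cf mu ?t) ^ Suc n \<le> exp (- \<kappa> * N ?t) ^ Suc n"
          using \<kappa>(2)[OF True] by (intro power_mono) auto
        also have "\<dots> = exp (- \<kappa> * N s)"
          unfolding N_rate by (simp add: exp_of_nat_mult[symmetric] del: power_Suc of_nat_Suc)
        finally show ?thesis using True by (simp add: g_def norm_power norm_mult)
      qed (simp add: g_def)
    qed
  qed auto
  then have dom: "(\<lambda>n. \<integral>s. g n s \<partial>lborel) \<longlonglongrightarrow> (\<integral>s. of_real (exp (- Q s)) \<partial>lborel)"
    by (rule LIMSEQ_imp_Suc)
  have "(\<lambda>n. of_real ((2 * pi) ^ CARD('d) * (real n * u n 0)) :: complex) \<longlonglongrightarrow> of_real (\<integral>s. exp (- Q s) \<partial>lborel)"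
  proof (rule Lim_transform_eventually)
    show "(\<lambda>n. \<integral>s. g n s \<partial>lborel) \<longlonglongrightarrow> of_real (\<integral>s. exp (- Q s) \<partial>lborel)"
      using dom by simp
    show "eventually (\<lambda>n. (\<integral>s. g n s \<partial>lborel) = of_real ((2 * pi) ^ CARD('d) * (real n * u n 0))) sequentially"
      using eventually_ge_at_top[of 1] by eventually_elim (rule eq[symmetric])
  qed
  then have "(\<lambda>n. (2 * pi) ^ CARD('d) * (real n * u n 0)) \<longlonglongrightarrow> (\<integral>s. exp (- Q s) \<partial>lborel)"
    by (simp only: tendsto_of_real_iff)
  from tendsto_divide[OF this tendsto_const[of "(2 * pi) ^ CARD('d)"]] show ?thesis by simp
qed

lemma G_over_ln: "(\<lambda>n. G n 0 / ln (real n)) \<longlonglongrightarrow> (\<integral>s. exp (- Q s) \<partial>lborel) / (2 * pi) ^ CARD('d)"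
  unfolding G_def by (rule sum_asymp_ln[OF local_limit])

end

section \<open>Steps of the three kinds\<close>

lemma exists_pmf_of_measure:
  fixes N :: "'a::countable measure"
  assumes "prob_space N" and sets: "sets N = UNIV"
  shows "\<exists>mu. N = measure_pmf mu"
proof -
  interpret prob_space N by fact
  have "AE x in N. \<forall>y\<in>{y. measure N {y} = 0}. x \<noteq> y"
  proof (rule AE_ball_countable')
    fix y assume "y \<in> {y. measure N {y} = 0}"
    then have "{y} \<in> null_sets N" by (auto simp: null_sets_def sets emeasure_eq_measure)
    then show "AE x in N. x \<noteq> y" by (rule AE_I') auto
  qed simp
  then have "AE x in N. measure N {x} \<noteq> 0" by eventually_elim auto
  then have "N \<in> {M. prob_space M \<and> sets M = UNIV \<and> (AE x in M. measure M {x} \<noteq> 0)}"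
    using assms by simp
  from Abs_pmf_inverse[OF this] show ?thesis by metis
qed

lemma det_doubleton:
  fixes A :: "real ^ 'd ^ 'd"
  assumes U: "(UNIV :: 'd set) = {i, j}" "i \<noteq> j"
  shows "det A = A $ i $ i * A $ j $ j - A $ i $ j * A $ j $ i"
proof -
  have perms: "{p. p permutes (UNIV :: 'd set)} = {id, Transposition.transpose i j}"
    unfolding U(1) by (auto simp: permutes_doubleton_iff)
  have "id \<noteq> Transposition.transpose i j"
    using U(2) by (metis id_apply transpose_apply_first)
  then show ?thesis
    unfolding det_def perms using U(2)
    by (simp add: U(1) sign_id sign_swap_id transpose_apply_first transpose_apply_second)
qed

lemma nn_integral_lborel_doubleton:
  fixes g :: "real \<Rightarrow> real \<Rightarrow> ennreal"
  assumes U: "(UNIV :: 'd::finite set) = {i, j}" "i \<noteq> j"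
    and g: "case_prod g \<in> borel_measurable (borel \<Otimes>\<^sub>M borel)"
  shows "(\<integral>\<^sup>+t. g (t $ i) (t $ j) \<partial>(lborel :: (real ^ 'd) measure)) = (\<integral>\<^sup>+y. (\<integral>\<^sup>+x. g y x \<partial>lborel) \<partial>lborel)"
proof -
  interpret product_sigma_finite "\<lambda>_ :: real ^ 'd. lborel :: real measure" ..
  let ?b1 = "axis i 1 :: real ^ 'd" and ?b2 = "axis j 1 :: real ^ 'd"
  have B: "(Basis :: (real ^ 'd) set) = insert ?b1 {?b2}" unfolding Basis_vec_real U(1) by auto
  have ne: "?b1 \<notin> {?b2}" using U(2) by (simp add: axis_eq_axis)
  define T where "T x = (\<Sum>b\<in>Basis. x b *\<^sub>R b)" for x :: "real ^ 'd \<Rightarrow> real"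
  have T: "T \<in> (\<Pi>\<^sub>M b\<in>Basis. lborel) \<rightarrow>\<^sub>M borel" unfolding T_def[abs_def] by measurable
  have Tc: "T x $ k = x (axis k 1)" for x k
    using inner_sum_left_Basis[of "axis k 1" x] inner_axis[of "T x" k 1] by (simp add: T_def Basis_vec_real)
  have gm: "(\<lambda>p. g (fst p) (snd p)) \<in> borel_measurable (borel \<Otimes>\<^sub>M borel)"
    using g by (simp add: case_prod_unfold)
  have m1: "(\<lambda>t :: real ^ 'd. g (t $ i) (t $ j)) \<in> borel_measurable borel"
    using measurable_compose[OF _ gm, of "\<lambda>t :: real ^ 'd. (t $ i, t $ j)" borel] by simp
  have m2: "(\<lambda>x. g (x ?b1) (x ?b2)) \<in> borel_measurable (\<Pi>\<^sub>M b\<in>insert ?b1 {?b2}. lborel)"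
    using measurable_compose[OF _ gm, of "\<lambda>x. (x ?b1, x ?b2)" "\<Pi>\<^sub>M b\<in>insert ?b1 {?b2}. lborel"] by simp
  have "(\<integral>\<^sup>+t. g (t $ i) (t $ j) \<partial>(lborel :: (real ^ 'd) measure))
      = (\<integral>\<^sup>+t. g (t $ i) (t $ j) \<partial>distr (\<Pi>\<^sub>M b\<in>Basis. lborel) borel T)"
    unfolding T_def[abs_def] by (simp only: lborel_eq[symmetric])
  also have "\<dots> = (\<integral>\<^sup>+x. g (x ?b1) (x ?b2) \<partial>(\<Pi>\<^sub>M b\<in>Basis. lborel))"
    by (subst nn_integral_distr[OF T]) (use m1 in \<open>simp_all add: Tc\<close>)
  also have "\<dots> = (\<integral>\<^sup>+y. (\<integral>\<^sup>+x. g ((x(?b1 := y)) ?b1) ((x(?b1 := y)) ?b2) \<partial>(\<Pi>\<^sub>M b\<in>{?b2}. lborel)) \<partial>lborel)"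
    unfolding B by (rule product_nn_integral_insert_rev) (use ne m2 in auto)
  also have "\<dots> = (\<integral>\<^sup>+y. (\<integral>\<^sup>+x. g y x \<partial>lborel) \<partial>lborel)"
  proof (intro nn_integral_cong)
    fix y :: real
    have "g y \<in> borel_measurable borel"
      using measurable_compose[OF _ gm, of "\<lambda>x. (y, x)" borel] by simp
    then have "(\<integral>\<^sup>+x. g y (x ?b2) \<partial>(\<Pi>\<^sub>M b\<in>{?b2}. lborel)) = (\<integral>\<^sup>+x. g y x \<partial>lborel)"
      by (intro product_nn_integral_singleton) simp
    then show "(\<integral>\<^sup>+x. g ((x(?b1 := y)) ?b1) ((x(?b1 := y)) ?b2) \<partial>(\<Pi>\<^sub>M b\<in>{?b2}. lborel)) = (\<integral>\<^sup>+x. g y x \<partial>lborel)"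
      using ne by (simp add: fun_upd_def)
  qed
  finally show ?thesis .
qed

lemma nn_integral_gaussian:
  assumes e: "e > 0"
  shows "(\<integral>\<^sup>+x. ennreal (exp (- (e / 2) * (x - m)\<^sup>2)) \<partial>lborel) = ennreal (sqrt (2 * pi / e))"
proof -
  define \<sigma> where "\<sigma> = 1 / sqrt e"
  have \<sigma>: "\<sigma> > 0" "\<sigma>\<^sup>2 = 1 / e" using e by (simp_all add: \<sigma>_def power_divide)
  interpret prob_space "density lborel (normal_density m \<sigma>)"
    by (rule prob_space_normal_density[OF \<sigma>(1)])
  have nd: "exp (- (e / 2) * (x - m)\<^sup>2) = sqrt (2 * pi / e) * normal_density m \<sigma> x" for x
    using e by (simp add: normal_density_def \<sigma> field_simps)
  have "(\<integral>\<^sup>+x. ennreal (exp (- (e / 2) * (x - m)\<^sup>2)) \<partial>lborel)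
      = (\<integral>\<^sup>+x. ennreal (sqrt (2 * pi / e)) * ennreal (normal_density m \<sigma> x) \<partial>lborel)"
    unfolding nd using e by (simp add: ennreal_mult)
  also have "\<dots> = ennreal (sqrt (2 * pi / e)) * (\<integral>\<^sup>+x. ennreal (normal_density m \<sigma> x) \<partial>lborel)"
    by (rule nn_integral_cmult) simp
  also have "(\<integral>\<^sup>+x. ennreal (normal_density m \<sigma> x) \<partial>lborel) = 1"
    using emeasure_space_1 by (simp add: emeasure_density)
  finally show ?thesis by simp
qed

lemma integral_gaussian_doubleton:
  assumes U: "(UNIV :: 'd::finite set) = {i, j}" "i \<noteq> j" and e: "e > 0" and D: "a * e - b\<^sup>2 > 0"
  shows "(\<integral>t. exp (- ((a * (t $ i)\<^sup>2 + 2 * b * (t $ i) * (t $ j) + e * (t $ j)\<^sup>2) / 2)) \<partial>(lborel :: (real ^ 'd) measure))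
    = 2 * pi / sqrt (a * e - b\<^sup>2)"
proof -
  let ?g = "\<lambda>y x. exp (- ((a * y\<^sup>2 + 2 * b * y * x + e * x\<^sup>2) / 2)) :: real"
  \<comment> \<open>The Schur complement: what remains of the coefficient of y^2 after completing
    the square in x.\<close>
  define k where "k = (a * e - b\<^sup>2) / e"
  have k: "k > 0" using e D by (simp add: k_def)
  have sq: "?g y x = exp (- (k / 2) * (y - 0)\<^sup>2) * exp (- (e / 2) * (x - (- b * y / e))\<^sup>2)" for x y
  proof -
    have "e * (x - (- b * y / e))\<^sup>2 = e * x\<^sup>2 + 2 * b * y * x + b\<^sup>2 * y\<^sup>2 / e"
      using e by (simp add: power2_eq_square field_simps)
    moreover have "k * y\<^sup>2 = a * y\<^sup>2 - b\<^sup>2 * y\<^sup>2 / e"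
      using e by (simp add: k_def field_simps)
    ultimately have "- ((a * y\<^sup>2 + 2 * b * y * x + e * x\<^sup>2) / 2)
        = - (k / 2) * (y - 0)\<^sup>2 + - (e / 2) * (x - (- b * y / e))\<^sup>2"
      by (simp add: field_simps)
    then show ?thesis by (simp only: exp_add)
  qed
  have "(\<integral>\<^sup>+t. ennreal (?g (t $ i) (t $ j)) \<partial>(lborel :: (real ^ 'd) measure))
      = (\<integral>\<^sup>+y. (\<integral>\<^sup>+x. ennreal (?g y x) \<partial>lborel) \<partial>lborel)"
    by (rule nn_integral_lborel_doubleton[OF U]) simp
  also have "\<dots> = (\<integral>\<^sup>+y. ennreal (exp (- (k / 2) * (y - 0)\<^sup>2)) * ennreal (sqrt (2 * pi / e)) \<partial>lborel)"
  proof (intro nn_integral_cong)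
    fix y :: real
    have "(\<integral>\<^sup>+x. ennreal (?g y x) \<partial>lborel)
        = (\<integral>\<^sup>+x. ennreal (exp (- (k / 2) * (y - 0)\<^sup>2)) * ennreal (exp (- (e / 2) * (x - (- b * y / e))\<^sup>2)) \<partial>lborel)"
      unfolding sq by (intro nn_integral_cong ennreal_mult) auto
    also have "\<dots> = ennreal (exp (- (k / 2) * (y - 0)\<^sup>2)) * (\<integral>\<^sup>+x. ennreal (exp (- (e / 2) * (x - (- b * y / e))\<^sup>2)) \<partial>lborel)"
      by (rule nn_integral_cmult) simp
    finally show "(\<integral>\<^sup>+x. ennreal (?g y x) \<partial>lborel) = ennreal (exp (- (k / 2) * (y - 0)\<^sup>2)) * ennreal (sqrt (2 * pi / e))"
      unfolding nn_integral_gaussian[OF e] .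
  qed
  also have "\<dots> = ennreal (sqrt (2 * pi / k)) * ennreal (sqrt (2 * pi / e))"
    by (subst nn_integral_multc) (simp_all add: nn_integral_gaussian[OF k, of 0, simplified])
  also have "\<dots> = ennreal (2 * pi / sqrt (a * e - b\<^sup>2))"
  proof -
    have "sqrt (2 * pi / k) * sqrt (2 * pi / e) = sqrt ((2 * pi)\<^sup>2 / (a * e - b\<^sup>2))"
      unfolding real_sqrt_mult[symmetric] using e D by (simp add: k_def power2_eq_square)
    also have "\<dots> = 2 * pi / sqrt (a * e - b\<^sup>2)"
      by (simp only: real_sqrt_divide real_sqrt_abs) simp
    finally show ?thesis using k e by (simp only: ennreal_mult[symmetric] real_sqrt_ge_zero divide_nonneg_pos mult_nonneg_nonneg pi_ge_zero zero_le_numeral)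
  qed
  finally have "(\<integral>\<^sup>+t. ennreal (?g (t $ i) (t $ j)) \<partial>(lborel :: (real ^ 'd) measure)) = ennreal (2 * pi / sqrt (a * e - b\<^sup>2))" .
  then have "has_bochner_integral (lborel :: (real ^ 'd) measure) (\<lambda>t. ?g (t $ i) (t $ j)) (2 * pi / sqrt (a * e - b\<^sup>2))"
    using D by (intro has_bochner_integral_nn_integral) auto
  then show ?thesis by (rule has_bochner_integral_integral_eq)
qed

lemma integral_exp_norm_1:
  assumes d: "CARD('d::finite) = 1" and \<gamma>: "\<gamma> > 0"
  shows "(\<integral>s. exp (- (\<gamma> * norm s)) \<partial>(lborel :: (real ^ 'd) measure)) = 2 / \<gamma>"
proof -
  obtain i :: 'd where U: "UNIV = {i}" using d by (rule card_1_singletonE)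
  have "exp (- (\<gamma> * norm s)) = (\<Prod>k\<in>UNIV. exp (- \<gamma> * \<bar>s $ k\<bar>))" for s :: "real ^ 'd"
    by (simp add: U norm_vec_def L2_set_def)
  then have "(\<integral>s. exp (- (\<gamma> * norm s)) \<partial>(lborel :: (real ^ 'd) measure)) = (\<Prod>k\<in>(UNIV :: 'd set). \<integral>s. exp (- \<gamma> * \<bar>s\<bar>) \<partial>lborel)"
    by (simp only:) (rule integral_lborel_prod_vec, rule integrable.intros, rule has_bochner_integral_exp_abs[OF \<gamma>])
  also have "\<dots> = (\<Prod>k\<in>(UNIV :: 'd set). 2 / \<gamma>)"
    by (intro prod.cong refl has_bochner_integral_integral_eq has_bochner_integral_exp_abs[OF \<gamma>])
  finally show ?thesis by (simp add: d)
qed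

section \<open>Assumptions A1 and A2 as Fourier hypotheses\<close>

locale lattice_walk = prob_space M for M :: "'w measure" +
  fixes \<xi> :: "'w \<Rightarrow> int ^ 'd" and mu :: "(int ^ 'd) pmf"
  assumes \<xi>: "\<xi> \<in> M \<rightarrow>\<^sub>M count_space UNIV" and law: "distr M (count_space UNIV) \<xi> = measure_pmf mu"
begin

lemma integral_law:
  fixes f :: "int ^ 'd \<Rightarrow> 'b::{banach, second_countable_topology}"
  shows "(\<integral>\<omega>. f (\<xi> \<omega>) \<partial>M) = (\<integral>x. f x \<partial>measure_pmf mu)"
  unfolding law[symmetric] by (rule integral_distr[symmetric, OF \<xi>]) simp

lemma integrable_law:
  fixes f :: "int ^ 'd \<Rightarrow> 'b::{banach, second_countable_topology}"
  shows "integrable M (\<lambda>\<omega>. f (\<xi> \<omega>)) \<longleftrightarrow> integrable (measure_pmf mu) f"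
  unfolding law[symmetric] by (rule integrable_distr_eq[symmetric, OF \<xi>]) simp

lemma measure_law: "measure M {\<omega> \<in> space M. P (\<xi> \<omega>)} = measure_pmf.prob mu {x. P x}"
proof -
  have "measure_pmf.prob mu {x. P x} = measure M (\<xi> -` {x. P x} \<inter> space M)"
    unfolding law[symmetric] by (rule measure_distr[OF \<xi>]) simp
  also have "\<xi> -` {x. P x} \<inter> space M = {\<omega> \<in> space M. P (\<xi> \<omega>)}" by auto
  finally show ?thesis by simp
qed

lemma char_fun_eq: "char_fun M \<xi> = cf mu"
  unfolding char_fun_def cf_def by (intro ext integral_law)

lemma mean_eq: "mean M \<xi> = (\<integral>x. real_vec x \<partial>measure_pmf mu)"
  unfolding mean_def by (rule integral_law)

lemma covariance_eq: "mean M \<xi> = 0 \<Longrightarrow> covariance_matrix M \<xi> $ i $ j = (\<integral>x. real_vec x $ i * real_vec x $ j \<partial>measure_pmf mu)"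
  unfolding covariance_matrix_def by (simp add: integral_law[where f = "\<lambda>x. real_vec x $ i * real_vec x $ j"])

lemma strongly_aperiodicD:
  assumes "strongly_aperiodic M \<xi>" "additive_subgroup L" "\<forall>y\<in>set_pmf mu. y - x \<in> L"
  shows "L = UNIV"
proof (rule ccontr)
  assume "L \<noteq> UNIV"
  moreover have "measure M {\<omega> \<in> space M. \<xi> \<omega> - x \<in> L} = 1"
    unfolding measure_law[where P = "\<lambda>y. y - x \<in> L"]
    by (rule measure_pmf.prob_eq_1[THEN iffD2]) (use assms(3) in \<open>auto simp: AE_measure_pmf_iff\<close>)
  ultimately show False using assms(1,2) unfolding strongly_aperiodic_def by blast
qed

lemma A1_lattice_cf:
  assumes "assumption_A1 M \<xi> \<gamma>"
  shows "lattice_cf mu (\<lambda>t. \<gamma> * norm t) \<gamma> \<gamma>"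
proof -
  have d: "CARD('d) = 1" and \<gamma>: "\<gamma> > 0" and sa: "strongly_aperiodic M \<xi>"
    and o: "(\<lambda>t. char_fun M \<xi> t - (1 - of_real (\<gamma> * norm t))) \<in> o[at 0](\<lambda>t. of_real (norm t))"
    using assms unfolding assumption_A1_def by auto
  show ?thesis
  proof
    show "((\<lambda>t. (cf mu t - (1 - of_real (\<gamma> * norm t))) / of_real (norm t ^ CARD('d))) \<longlongrightarrow> 0) (at 0)"
      using smalloD_tendsto[OF o] by (simp add: char_fun_eq d)
  qed (use d \<gamma> strongly_aperiodicD[OF sa] in auto)
qed

text \<open>As the mean is 0, Q is half the quadratic form of the covariance matrix. Non-singularity
  makes it positive definite, and its minimum on the unit sphere is the lower constant.\<close>

lemma A2_lattice_cf:
  assumes A2: "assumption_A2 M \<xi>"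
  shows "\<exists>q q'. lattice_cf mu (\<lambda>t. (\<integral>x. (t \<bullet> real_vec x)\<^sup>2 \<partial>measure_pmf mu) / 2) q q'"
    and "(\<integral>t. exp (- ((\<integral>x. (t \<bullet> real_vec x)\<^sup>2 \<partial>measure_pmf mu) / 2)) \<partial>lborel)
      = 2 * pi / sqrt (det (covariance_matrix M \<xi>))"
    and "det (covariance_matrix M \<xi>) > 0"
proof -
  let ?S = "covariance_matrix M \<xi>"
  define Q where "Q t = (\<integral>x. (t \<bullet> real_vec x)\<^sup>2 \<partial>measure_pmf mu) / 2" for t :: "real ^ 'd"
  define m2 where "m2 = (\<integral>x. (norm (real_vec x :: real ^ 'd))\<^sup>2 \<partial>measure_pmf mu)"
  have d: "CARD('d) = 2" and mean: "mean M \<xi> = 0" and inv: "invertible ?S" and sa: "strongly_aperiodic M \<xi>"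
    and "integrable M (\<lambda>\<omega>. (norm (real_vec (\<xi> \<omega>)))\<^sup>2)"
    using A2 unfolding assumption_A2_def by auto
  then have i2: "integrable (measure_pmf mu) (\<lambda>x. (norm (real_vec x :: real ^ 'd))\<^sup>2)"
    by (subst (asm) integrable_law[where f = "\<lambda>x. (norm (real_vec x))\<^sup>2"])
  obtain i j :: 'd where U: "UNIV = {i, j}" "i \<noteq> j"
    using d by (meson card_2_iff)
  have i1: "integrable (measure_pmf mu) (real_vec :: int ^ 'd \<Rightarrow> real ^ 'd)"
  proof (rule Bochner_Integration.integrable_bound)
    show "integrable (measure_pmf mu) (\<lambda>x. 1 + (norm (real_vec x :: real ^ 'd))\<^sup>2)" using i2 by simp
    have "y \<le> 1 + y\<^sup>2" for y :: real using zero_le_power2[of "y - 1 / 2"] by (simp add: power2_eq_square algebra_simps)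
    then show "AE x in measure_pmf mu. norm (real_vec x :: real ^ 'd) \<le> norm (1 + (norm (real_vec x :: real ^ 'd))\<^sup>2)"
      by (intro AE_I2) (simp add: abs_of_nonneg)
  qed simp
  have ij: "integrable (measure_pmf mu) (\<lambda>x. real_vec x $ k * real_vec x $ l)" for k l :: 'd
  proof (rule Bochner_Integration.integrable_bound[OF i2], simp)
    have "\<bar>real_vec x $ k * real_vec x $ l\<bar> \<le> (norm (real_vec x :: real ^ 'd))\<^sup>2" for x
      unfolding abs_mult power2_eq_square by (intro mult_mono component_le_norm_cart) auto
    then show "AE x in measure_pmf mu. norm (real_vec x $ k * real_vec x $ l) \<le> norm ((norm (real_vec x :: real ^ 'd))\<^sup>2)"
      by simp
  qed
  have it: "integrable (measure_pmf mu) (\<lambda>x. (t \<bullet> real_vec x)\<^sup>2)" for t :: "real ^ 'd"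
  proof (rule Bochner_Integration.integrable_bound)
    show "integrable (measure_pmf mu) (\<lambda>x. (norm t)\<^sup>2 * (norm (real_vec x :: real ^ 'd))\<^sup>2)" using i2 by simp
    have "(t \<bullet> real_vec x)\<^sup>2 \<le> (norm t)\<^sup>2 * (norm (real_vec x :: real ^ 'd))\<^sup>2" for x
      using power_mono[OF Cauchy_Schwarz_ineq2[of t "real_vec x"], of 2] by (simp add: power_mult_distrib)
    then show "AE x in measure_pmf mu. norm ((t \<bullet> real_vec x)\<^sup>2) \<le> norm ((norm t)\<^sup>2 * (norm (real_vec x :: real ^ 'd))\<^sup>2)"
      by simp
  qed simp
  have Q_form: "Q t = (?S $ i $ i * (t $ i)\<^sup>2 + 2 * ?S $ i $ j * (t $ i) * (t $ j) + ?S $ j $ j * (t $ j)\<^sup>2) / 2" for t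
  proof -
    have sq: "(t \<bullet> real_vec x)\<^sup>2 = (t $ i)\<^sup>2 * (real_vec x $ i * real_vec x $ i)
        + 2 * (t $ i) * (t $ j) * (real_vec x $ i * real_vec x $ j) + (t $ j)\<^sup>2 * (real_vec x $ j * real_vec x $ j)" for x
      using U(2) by (simp add: inner_vec_def U(1) power2_eq_square algebra_simps)
    have "(\<integral>x. (t \<bullet> real_vec x)\<^sup>2 \<partial>measure_pmf mu) = (t $ i)\<^sup>2 * ?S $ i $ i
        + 2 * (t $ i) * (t $ j) * ?S $ i $ j + (t $ j)\<^sup>2 * ?S $ j $ j"
      unfolding sq covariance_eq[OF mean] using ij by simp
    then show ?thesis unfolding Q_def by (simp add: mult_ac)
  qed
  have sym: "?S $ j $ i = ?S $ i $ j" by (simp add: covariance_eq[OF mean] mult.commute)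
  have Q_nonneg: "0 \<le> Q t" for t unfolding Q_def by simp
  have Q_hom: "Q (r *\<^sub>R t) = r\<^sup>2 * Q t" for r t
    unfolding Q_def by (simp add: power_mult_distrib)
  \<comment> \<open>If the form vanishes at t, then t is orthogonal to almost every step, hence the
    covariance matrix annihilates t, and invertibility forces t = 0.\<close>
  have Q_pos: "0 < Q t" if t: "t \<noteq> 0" for t
  proof (rule ccontr)
    assume "\<not> 0 < Q t"
    then have "Q t = 0" using Q_nonneg[of t] by linarith
    then have "(\<integral>x. (t \<bullet> real_vec x)\<^sup>2 \<partial>measure_pmf mu) = 0" by (simp add: Q_def)
    then have "AE x in measure_pmf mu. (t \<bullet> real_vec x)\<^sup>2 = 0"
      using integral_nonneg_eq_0_iff_AE[OF it[of t]] by simp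
    then have ae: "AE x in measure_pmf mu. t \<bullet> real_vec x = 0" by simp
    have "(?S *v t) $ k = 0" for k
    proof -
      have "(?S *v t) $ k = (\<Sum>l\<in>UNIV. t $ l * (\<integral>x. real_vec x $ k * real_vec x $ l \<partial>measure_pmf mu))"
        by (simp add: matrix_vector_mult_def covariance_eq[OF mean] mult.commute)
      also have "\<dots> = (\<integral>x. (\<Sum>l\<in>UNIV. t $ l * (real_vec x $ k * real_vec x $ l)) \<partial>measure_pmf mu)"
        using ij by (subst Bochner_Integration.integral_sum) auto
      also have "\<dots> = (\<integral>x. real_vec x $ k * (t \<bullet> real_vec x) \<partial>measure_pmf mu)"
        by (intro Bochner_Integration.integral_cong) (auto simp: inner_vec_def sum_distrib_left mult_ac)
      also have "\<dots> = (\<integral>x. 0 \<partial>measure_pmf mu)"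
        by (rule integral_cong_AE) (use ae in auto)
      finally show ?thesis by simp
    qed
    then have "?S *v t = 0" by (simp add: vec_eq_iff)
    moreover obtain S' where "S' ** ?S = mat 1" using inv unfolding invertible_def by blast
    ultimately have "t = 0"
      by (metis matrix_vector_mul_assoc matrix_vector_mul_lid matrix_vector_mult_0_right)
    then show False using t by simp
  qed
  have cont: "continuous_on UNIV Q" unfolding Q_form by (intro continuous_intros) auto
  obtain t0 where t0: "t0 \<in> sphere 0 1" "\<And>t. t \<in> sphere 0 1 \<Longrightarrow> Q t0 \<le> Q t"
  proof -
    have ne: "sphere (0 :: real ^ 'd) 1 \<noteq> {}"
      using norm_axis_1[of i] by (intro ex_in_conv[THEN iffD1] exI[of _ "axis i 1"]) simp
    show ?thesis
      using continuous_attains_inf[OF compact_sphere ne continuous_on_subset[OF cont]] that by blast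
  qed
  have Q_ge: "Q t0 * norm t ^ 2 \<le> Q t" for t
  proof (cases "t = 0")
    case False
    have "Q t0 \<le> Q ((1 / norm t) *\<^sub>R t)" using False by (intro t0(2)) simp
    also have "\<dots> = Q t / norm t ^ 2" unfolding Q_hom by (simp add: power_divide)
    finally show ?thesis using False by (simp add: pos_le_divide_eq)
  qed (use Q_nonneg in simp)
  have Q_le: "Q t \<le> m2 / 2 * norm t ^ 2" for t
  proof -
    have "(\<integral>x. (t \<bullet> real_vec x)\<^sup>2 \<partial>measure_pmf mu) \<le> (\<integral>x. (norm t)\<^sup>2 * (norm (real_vec x :: real ^ 'd))\<^sup>2 \<partial>measure_pmf mu)"
    proof (rule integral_mono)
      show "integrable (measure_pmf mu) (\<lambda>x. (norm t)\<^sup>2 * (norm (real_vec x :: real ^ 'd))\<^sup>2)" using i2 by simp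
      show "(t \<bullet> real_vec x)\<^sup>2 \<le> (norm t)\<^sup>2 * (norm (real_vec x :: real ^ 'd))\<^sup>2" for x
        using power_mono[OF Cauchy_Schwarz_ineq2[of t "real_vec x"], of 2] by (simp add: power_mult_distrib)
    qed (rule it)
    then show ?thesis by (simp add: Q_def m2_def mult.commute)
  qed
  have expansion: "((\<lambda>t. (cf mu t - (1 - of_real (Q t))) / of_real (norm t ^ 2)) \<longlongrightarrow> 0) (at 0)"
    unfolding tendsto_at_iff_sequentially comp_def
  proof (intro allI impI)
    fix T :: "nat \<Rightarrow> real ^ 'd"
    assume "\<forall>n. T n \<in> UNIV - {0}" and T0: "T \<longlonglongrightarrow> 0"
    then have Tn: "T n \<noteq> 0" for n by blast
    define r where "r y = exp (\<i> * of_real y) - 1 - \<i> * of_real y + of_real (y\<^sup>2 / 2)" for y :: real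
    have s3: "(\<Sum>k\<le>(2 :: nat). f k) = f 0 + f 1 + f 2" for f :: "nat \<Rightarrow> complex"
      by (simp add: numeral_2_eq_2)
    have r_sum: "r y = exp (\<i> * of_real y) - (\<Sum>k\<le>2. (\<i> * of_real y) ^ k / fact k)" for y
      unfolding s3 by (simp add: r_def power_mult_distrib)
    have r1: "norm (r y) \<le> \<bar>y\<bar> ^ 3 / 6" for y
    proof -
      have "norm (r y) \<le> \<bar>y\<bar> ^ Suc 2 / fact (Suc 2)" unfolding r_sum by (rule iexp_approx1)
      moreover have "fact (Suc 2) = (6 :: real)" by (simp add: fact_numeral)
      ultimately show ?thesis by simp
    qed
    have r2: "norm (r y) \<le> y\<^sup>2" for y
    proof -
      have "norm (r y) \<le> 2 * \<bar>y\<bar> ^ 2 / fact 2" unfolding r_sum by (rule iexp_approx2)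
      then show ?thesis by simp
    qed
    have e1: "integrable (measure_pmf mu) (\<lambda>x. exp (\<i> * of_real (t \<bullet> real_vec x)))" for t :: "real ^ 'd"
      by (rule measure_pmf.integrable_const_bound[where B = 1]) auto
    have i1t: "integrable (measure_pmf mu) (\<lambda>x. t \<bullet> real_vec x)" for t :: "real ^ 'd"
      using i1 by simp
    have m1: "(\<integral>x. t \<bullet> real_vec x \<partial>measure_pmf mu) = 0" for t :: "real ^ 'd"
    proof -
      have "(\<integral>x. t \<bullet> real_vec x \<partial>measure_pmf mu) = t \<bullet> (\<integral>x. real_vec x \<partial>measure_pmf mu)"
        by (rule integral_inner_right) (rule i1)
      also have "\<dots> = 0" unfolding mean[unfolded mean_eq] by (rule inner_zero_right)
      finally show ?thesis .
    qed
    have eq: "cf mu t - (1 - of_real (Q t)) = (\<integral>x. r (t \<bullet> real_vec x) \<partial>measure_pmf mu)" for t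
    proof -
      have iB: "integrable (measure_pmf mu) (\<lambda>x. \<i> * complex_of_real (t \<bullet> real_vec x))"
        by (intro integrable_mult_right integrable_of_real i1t)
      have iC: "integrable (measure_pmf mu) (\<lambda>x. complex_of_real ((t \<bullet> real_vec x)\<^sup>2 / 2))"
        by (rule integrable_of_real) (use it in simp)
      have "(\<integral>x. r (t \<bullet> real_vec x) \<partial>measure_pmf mu) = (\<integral>x. exp (\<i> * of_real (t \<bullet> real_vec x)) \<partial>measure_pmf mu)
          - (\<integral>x. 1 \<partial>measure_pmf mu) - (\<integral>x. \<i> * complex_of_real (t \<bullet> real_vec x) \<partial>measure_pmf mu)
          + (\<integral>x. complex_of_real ((t \<bullet> real_vec x)\<^sup>2 / 2) \<partial>measure_pmf mu)"
        unfolding r_def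
        by (intro trans[OF Bochner_Integration.integral_add] arg_cong2[where f = "(+)"] refl
            trans[OF Bochner_Integration.integral_diff] arg_cong2[where f = "(-)"]
            Bochner_Integration.integrable_diff e1 iB iC) simp_all
      also have "(\<integral>x. \<i> * complex_of_real (t \<bullet> real_vec x) \<partial>measure_pmf mu) = \<i> * of_real (\<integral>x. t \<bullet> real_vec x \<partial>measure_pmf mu)"
        by (simp only: integral_mult_right_zero integral_complex_of_real)
      also have "(\<integral>x. complex_of_real ((t \<bullet> real_vec x)\<^sup>2 / 2) \<partial>measure_pmf mu) = of_real (Q t)"
        by (simp only: integral_complex_of_real Q_def integral_divide_zero)
      finally show ?thesis by (simp add: m1 cf_def)
    qed
    \<comment> \<open>Only two moments exist. For the second-order Taylor remainder \<open>r\<close>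
      the cubic bound \<open>r1\<close> gives pointwise convergence, while the quadratic bound
      \<open>r2\<close> gives the integrable majorant |x|^2.\<close>
    have "(\<lambda>n. \<integral>x. r (T n \<bullet> real_vec x) / of_real (norm (T n) ^ 2) \<partial>measure_pmf mu) \<longlonglongrightarrow> (\<integral>x. 0 \<partial>measure_pmf mu)"
    proof (rule integral_dominated_convergence[OF _ _ i2])
      show "AE x in measure_pmf mu. (\<lambda>n. r (T n \<bullet> real_vec x) / of_real (norm (T n) ^ 2)) \<longlonglongrightarrow> 0"
      proof (rule AE_I2)
        fix x :: "int ^ 'd"
        show "(\<lambda>n. r (T n \<bullet> real_vec x) / of_real (norm (T n) ^ 2)) \<longlonglongrightarrow> 0"
        proof (rule Lim_null_comparison)
          have "norm (r (T n \<bullet> real_vec x) / of_real (norm (T n) ^ 2)) \<le> norm (T n) * norm (real_vec x) ^ 3 / 6" for n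
          proof -
            have "norm (r (T n \<bullet> real_vec x)) \<le> (norm (T n) * norm (real_vec x)) ^ 3 / 6"
            proof -
              have "\<bar>T n \<bullet> real_vec x\<bar> ^ 3 \<le> (norm (T n) * norm (real_vec x)) ^ 3"
                by (rule power_mono[OF Cauchy_Schwarz_ineq2]) simp
              then show ?thesis using r1[of "T n \<bullet> real_vec x"] by linarith
            qed
            then have "norm (r (T n \<bullet> real_vec x)) \<le> norm (T n) * norm (real_vec x) ^ 3 / 6 * norm (T n) ^ 2"
              by (simp add: power_mult_distrib power3_eq_cube power2_eq_square mult_ac)
            then show ?thesis using Tn[of n] by (simp add: norm_divide norm_power pos_divide_le_eq)
          qed
          then show "eventually (\<lambda>n. norm (r (T n \<bullet> real_vec x) / of_real (norm (T n) ^ 2)) \<le> norm (T n) * norm (real_vec x) ^ 3 / 6) sequentially"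
            by simp
          have "(\<lambda>n. norm (T n) * norm (real_vec x) ^ 3 / 6) \<longlonglongrightarrow> norm (0 :: real ^ 'd) * norm (real_vec x) ^ 3 / 6"
            by (intro tendsto_intros T0) simp
          then show "(\<lambda>n. norm (T n) * norm (real_vec x) ^ 3 / 6) \<longlonglongrightarrow> 0" by simp
        qed
      qed
      fix n
      show "AE x in measure_pmf mu. norm (r (T n \<bullet> real_vec x) / of_real (norm (T n) ^ 2)) \<le> (norm (real_vec x :: real ^ 'd))\<^sup>2"
      proof (rule AE_I2)
        fix x :: "int ^ 'd"
        have "norm (r (T n \<bullet> real_vec x)) \<le> (norm (real_vec x))\<^sup>2 * norm (T n) ^ 2"
        proof -
          have "\<bar>T n \<bullet> real_vec x\<bar> ^ 2 \<le> (norm (T n) * norm (real_vec x)) ^ 2"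
            by (rule power_mono[OF Cauchy_Schwarz_ineq2]) simp
          then show ?thesis using r2[of "T n \<bullet> real_vec x"]
            unfolding power_mult_distrib power2_abs by (simp add: mult.commute)
        qed
        then show "norm (r (T n \<bullet> real_vec x) / of_real (norm (T n) ^ 2)) \<le> (norm (real_vec x))\<^sup>2"
          using Tn[of n] by (simp add: norm_divide norm_power pos_divide_le_eq)
      qed
    qed auto
    then show "(\<lambda>n. (cf mu (T n) - (1 - of_real (Q (T n)))) / of_real (norm (T n) ^ 2)) \<longlonglongrightarrow> 0"
      unfolding eq by simp
  qed
  have "lattice_cf mu Q (Q t0) (m2 / 2)"
  proof
    show "Q \<in> borel_measurable borel" by (rule borel_measurable_continuous_onI[OF cont])
    show "0 < Q t0" using t0(1) by (intro Q_pos) auto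
  qed (use d Q_hom Q_ge Q_le expansion strongly_aperiodicD[OF sa] in simp_all)
  then show "\<exists>q q'. lattice_cf mu (\<lambda>t. (\<integral>x. (t \<bullet> real_vec x)\<^sup>2 \<partial>measure_pmf mu) / 2) q q'"
    unfolding Q_def[abs_def] by blast
  have det: "det ?S = ?S $ i $ i * ?S $ j $ j - (?S $ i $ j)\<^sup>2"
    unfolding det_doubleton[OF U] sym by (simp add: power2_eq_square)
  have Sii: "?S $ i $ i > 0"
    using Q_pos[of "axis i 1"] U(2) unfolding Q_form by (simp add: axis_def vec_eq_iff)
  have Sjj: "?S $ j $ j > 0"
    using Q_pos[of "axis j 1"] U(2) unfolding Q_form by (simp add: axis_def vec_eq_iff)
  show D: "det ?S > 0"
  proof -
    \<comment> \<open>The vector (- S_ij, S_ii) makes the quadratic form equal to S_ii times the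
      determinant, so positivity of Q gives positivity of the determinant.\<close>
    define t where "t = (\<chi> k. if k = i then - ?S $ i $ j else ?S $ i $ i)"
    have "t $ j \<noteq> 0" using Sii U(2) by (simp add: t_def)
    then have "0 < Q t" by (intro Q_pos) auto
    also have "Q t = ?S $ i $ i * det ?S / 2"
      unfolding Q_form det using U(2) by (simp add: t_def power2_eq_square algebra_simps)
    finally show ?thesis using Sii by (simp add: zero_less_mult_iff)
  qed
  show "(\<integral>t. exp (- ((\<integral>x. (t \<bullet> real_vec x)\<^sup>2 \<partial>measure_pmf mu) / 2)) \<partial>lborel) = 2 * pi / sqrt (det ?S)"
    unfolding Q_def[symmetric] Q_form det
    by (rule integral_gaussian_doubleton[OF U Sjj]) (use D det in simp)
qed

end

text \<open>In the coordinates \<open>x + y\<close> and \<open>x - y\<close> the simple random walk of the plane splits into two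
  independent simple random walks on the integers.\<close>

definition binom_walk :: "nat \<Rightarrow> int \<Rightarrow> real" where
  "binom_walk n k =
    (if even (k + int n) \<and> 0 \<le> k + int n then real (n choose nat ((k + int n) div 2)) / 2 ^ n else 0)"

definition central :: "nat \<Rightarrow> real" where
  "central m = real (2 * m choose m) / 4 ^ m"

lemma binom_walk_0: "binom_walk 0 k = of_bool (k = 0)"
  by (auto simp: binom_walk_def elim!: evenE)

text \<open>Pascal's rule, with \<open>l\<close> the number of upward steps; l = 0 is the edge at
  which one of the two terms is missing.\<close>

lemma binom_walk_Suc: "binom_walk (Suc n) k = (binom_walk n (k - 1) + binom_walk n (k + 1)) / 2"
proof (cases "even (k + int (Suc n)) \<and> 0 \<le> k + int (Suc n)")
  case True
  then have "k + int (Suc n) = 2 * int (nat ((k + int (Suc n)) div 2))" by auto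
  then obtain l where l: "k + int (Suc n) = 2 * int l" by blast
  have k1: "k + 1 + int n = 2 * int l" using l by simp
  have k2: "k - 1 + int n = 2 * (int l - 1)" using l by simp
  show ?thesis
  proof (cases l)
    case 0
    then show ?thesis unfolding binom_walk_def l k1 k2 by simp
  next
    case (Suc m)
    moreover have "nat (1 + int m) = Suc m" by linarith
    ultimately show ?thesis unfolding binom_walk_def l k1 k2 by (simp add: add_divide_distrib)
  qed
next
  case False
  then consider "odd (k + int (Suc n))" | "k + int (Suc n) < 0" by linarith
  then show ?thesis
  proof cases
    case 1
    then have "odd (k - 1 + int n)" "odd (k + 1 + int n)" by (simp_all add: algebra_simps)
    then show ?thesis using 1 by (simp add: binom_walk_def)
  next
    case 2
    then show ?thesis by (simp add: binom_walk_def)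
  qed
qed

lemma binom_walk_nonneg: "0 \<le> binom_walk n k"
  by (simp add: binom_walk_def)

lemma binom_walk_even_0: "binom_walk (2 * m) 0 = central m"
  by (simp add: binom_walk_def central_def power_mult)

lemma binom_walk_odd_0: "odd n \<Longrightarrow> binom_walk n 0 = 0"
  by (simp add: binom_walk_def)

text \<open>At even times the central binomial coefficient is the largest; a value at an odd time is
  the mean of two values at the even time before.\<close>

lemma binom_walk_le_central: "binom_walk n k \<le> central (n div 2)"
proof -
  have even: "binom_walk (2 * m) k \<le> central m" for m k
    using binomial_maximum'[of m] by (auto simp: binom_walk_def central_def power_mult divide_right_mono)
  show ?thesis
  proof (cases "even n")
    case True
    then show ?thesis using even[of "n div 2" k] by simp
  next
    case False
    then obtain m where n: "n = Suc (2 * m)" by (metis oddE Suc_eq_plus1)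
    show ?thesis using even[of m "k - 1"] even[of m "k + 1"] unfolding n binom_walk_Suc by simp
  qed
qed

lemma central_Suc: "central (Suc m) = central m * (2 * real m + 1) / (2 * real m + 2)"
proof -
  have "real (2 * Suc m choose Suc m) = fact (2 * Suc m) / (fact (Suc m) * fact (Suc m))"
    by (subst binomial_fact) auto
  also have "\<dots> = (2 * real m + 2) * (2 * real m + 1) * fact (2 * m) / (((real m + 1) * fact m) * ((real m + 1) * fact m))"
    by (simp add: algebra_simps)
  also have "\<dots> = (fact (2 * m) / (fact m * fact m)) * (4 * (2 * real m + 1) / (2 * real m + 2))"
  proof -
    have "(2 * a) * b * F / ((a * f) * (a * f)) = (F / (f * f)) * (4 * b / (2 * a))" if "a \<noteq> 0" for a b f F :: real
      using that by (cases "f = 0") (simp_all add: field_simps)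
    from this[of "real m + 1" "2 * real m + 1"] show ?thesis by (simp add: distrib_left)
  qed
  also have "fact (2 * m) / (fact m * fact m) = real (2 * m choose m)"
    by (subst binomial_fact) auto
  finally have choose: "real (2 * Suc m choose Suc m) = real (2 * m choose m) * (4 * (2 * real m + 1) / (2 * real m + 2))" .
  have "central (Suc m) = real (2 * Suc m choose Suc m) / (4 * 4 ^ m)" by (simp only: central_def power_Suc)
  also have "\<dots> = central m * (2 * real m + 1) / (2 * real m + 2)"
  proof -
    have cancel: "x * (4 * y / z) / (4 * v) = x / v * y / z" if "z \<noteq> 0" "v \<noteq> 0" for x y z v :: real
      using that by (simp add: field_simps)
    show ?thesis unfolding choose central_def by (rule cancel) auto
  qed
  finally show ?thesis .
qed

text \<open>With a = m + 1, the squared ratio of consecutive central probabilities is ((2a - 1) /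
  (2a))^2, and the next Wallis factor is 4a^2 / ((2a - 1)(2a + 1)); they cancel against the change
  of the linear factor.\<close>

lemma central_wallis: "(central m)\<^sup>2 * (2 * real m + 1) * (\<Prod>k=1..m. (4 * real k ^ 2) / (4 * real k ^ 2 - 1)) = 1"
proof (induction m)
  case (Suc m)
  define a where "a = real m + 1"
  let ?P = "\<Prod>k=1..m. (4 * real k ^ 2) / (4 * real k ^ 2 - 1)"
  have a: "a \<ge> 1" by (simp add: a_def)
  have c: "central (Suc m) = central m * (2 * a - 1) / (2 * a)"
    unfolding central_Suc by (simp add: a_def algebra_simps)
  have f: "4 * a\<^sup>2 - 1 = (2 * a - 1) * (2 * a + 1)" by (simp add: power2_eq_square algebra_simps)
  have "(central (Suc m))\<^sup>2 * (2 * a + 1) * (?P * (4 * a\<^sup>2 / (4 * a\<^sup>2 - 1)))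
      = (central m)\<^sup>2 * (2 * a - 1) * ?P"
    unfolding c f using a by (simp add: power_divide power_mult_distrib power2_eq_square)
  also have "2 * a - 1 = 2 * real m + 1" by (simp add: a_def)
  also note Suc.IH
  finally have "(central (Suc m))\<^sup>2 * (2 * a + 1) * (?P * (4 * a\<^sup>2 / (4 * a\<^sup>2 - 1))) = 1" .
  moreover have "(\<Prod>k=1..Suc m. (4 * real k ^ 2) / (4 * real k ^ 2 - 1)) = ?P * (4 * a\<^sup>2 / (4 * a\<^sup>2 - 1))"
    by (simp add: a_def add.commute)
  moreover have "2 * real (Suc m) + 1 = 2 * a + 1" by (simp add: a_def)
  ultimately show ?case by (simp only:)
qed (simp add: central_def)

lemma central_sq_le: "(central m)\<^sup>2 \<le> 1 / (2 * real m + 1)"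
proof -
  let ?P = "\<Prod>k=1..m. (4 * real k ^ 2) / (4 * real k ^ 2 - 1)"
  have "1 \<le> (4 * real k ^ 2) / (4 * real k ^ 2 - 1)" if "k \<in> {1..m}" for k
  proof -
    have "1 \<le> real k ^ 2" using that by simp
    then show ?thesis by (simp add: le_divide_eq)
  qed
  then have P: "1 \<le> ?P" by (rule prod_ge_1)
  have "(central m)\<^sup>2 * (2 * real m + 1) * 1 \<le> (central m)\<^sup>2 * (2 * real m + 1) * ?P"
    using P by (intro mult_left_mono) auto
  then show ?thesis unfolding central_wallis by (simp add: pos_le_divide_eq)
qed

lemma central_asymp: "(\<lambda>m. real m * (central m)\<^sup>2) \<longlonglongrightarrow> 1 / pi"
proof -
  have "(central m)\<^sup>2 * (2 * real m + 1) = inverse (\<Prod>k=1..m. (4 * real k ^ 2) / (4 * real k ^ 2 - 1))" for m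
    by (rule inverse_unique[symmetric]) (use central_wallis[of m] in \<open>simp only: mult.commute\<close>)
  moreover have "(\<lambda>m. inverse (\<Prod>k=1..m. (4 * real k ^ 2) / (4 * real k ^ 2 - 1))) \<longlonglongrightarrow> inverse (pi / 2)"
    by (intro tendsto_inverse wallis) simp
  ultimately have 1: "(\<lambda>m. (central m)\<^sup>2 * (2 * real m + 1)) \<longlonglongrightarrow> 2 / pi" by simp
  have 2: "(\<lambda>m. real m / (2 * real m + 1)) \<longlonglongrightarrow> 1 / 2" by real_asymp
  have "real m / (2 * real m + 1) * ((central m)\<^sup>2 * (2 * real m + 1)) = real m * (central m)\<^sup>2" for m
  proof -
    have "2 * real m + 1 \<noteq> 0" by linarith
    then show ?thesis by simp
  qed
  with tendsto_mult[OF 2 1] show ?thesis by simp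
qed

text \<open>The steps change the parity of the coordinate sum, so their differences stay in a proper
  sublattice and \<open>lattice_cf\<close> does not apply. Point probabilities are computed
  explicitly instead.\<close>

locale planar_simple_walk = random_walk mu for mu :: "(int ^ 'd) pmf" +
  fixes i j :: 'd
  assumes U: "(UNIV :: 'd set) = {i, j}" "i \<noteq> j"
    and quarter: "\<And>e. norm (real_vec e) = 1 \<Longrightarrow> pmf mu e = 1 / 4"
begin

text \<open>The four unit vectors already carry total mass 1, so the support contains nothing
  else.\<close>

lemma expectation_four:
  fixes f :: "int ^ 'd \<Rightarrow> 'b::{banach, second_countable_topology}"
  shows "(\<integral>x. f x \<partial>measure_pmf mu) = (1/4) *\<^sub>R (f (axis i 1) + f (axis i (- 1)) + f (axis j 1) + f (axis j (- 1)))"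
proof -
  define S where "S = {axis i 1, axis i (- 1), axis j 1, axis j (- 1) :: int ^ 'd}"
  have dist: "axis i 1 \<noteq> (axis i (- 1) :: int ^ 'd)" "axis i 1 \<noteq> (axis j 1 :: int ^ 'd)"
    "axis i 1 \<noteq> (axis j (- 1) :: int ^ 'd)" "axis i (- 1) \<noteq> (axis j 1 :: int ^ 'd)"
    "axis i (- 1) \<noteq> (axis j (- 1) :: int ^ 'd)" "axis j 1 \<noteq> (axis j (- 1) :: int ^ 'd)"
    using U(2) by (auto simp: axis_eq_axis)
  have rv: "real_vec (axis k c :: int ^ 'd) = axis k (of_int c)" for k c
    by (simp add: real_vec_def axis_def vec_eq_iff)
  have neg: "axis k (- 1) = - axis k (1 :: real)" for k :: 'd
    by (simp add: axis_def vec_eq_iff)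
  have p: "pmf mu e = 1 / 4" if "e \<in> S" for e
    using that by (intro quarter) (auto simp: S_def rv neg norm_axis_1)
  have "measure_pmf.prob mu S = sum (pmf mu) S"
    by (rule measure_measure_pmf_finite) (simp add: S_def)
  also have "\<dots> = (\<Sum>e\<in>S. 1 / 4)" by (rule sum.cong[OF refl p])
  also have "\<dots> = 1" unfolding S_def using dist by simp
  finally have "AE x in measure_pmf mu. x \<in> S"
    by (subst measure_pmf.AE_in_set_eq_1) auto
  then have sub: "set_pmf mu \<subseteq> S" by (auto simp: AE_measure_pmf_iff)
  have "(\<integral>x. f x \<partial>measure_pmf mu) = (\<Sum>e\<in>S. pmf mu e *\<^sub>R f e)"
    by (rule integral_measure_pmf) (use sub in \<open>auto simp: S_def\<close>)
  also have "\<dots> = (\<Sum>e\<in>S. (1/4) *\<^sub>R f e)" by (intro sum.cong refl) (simp add: p)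
  also have "\<dots> = (1/4) *\<^sub>R (f (axis i 1) + f (axis i (- 1)) + f (axis j 1) + f (axis j (- 1)))"
    unfolding S_def using dist by (simp add: scaleR_add_right add_ac)
  finally show ?thesis .
qed

text \<open>Each step changes both rotated coordinates by 1 in absolute value, and the four pairs of
  signs are equally likely; the one-step average is therefore a product of two averages.\<close>

lemma u_eq_product: "u n x = binom_walk n (x $ i + x $ j) * binom_walk n (x $ i - x $ j)"
proof (induction n arbitrary: x)
  case 0
  have "x = 0 \<longleftrightarrow> (\<forall>k\<in>{i, j}. x $ k = 0)" unfolding U(1)[symmetric] by (auto simp: vec_eq_iff)
  then show ?case by (auto simp: u_0 binom_walk_0)
next
  case (Suc n)
  define s where "s = x $ i + x $ j"
  define t where "t = x $ i - x $ j"
  let ?b = "binom_walk n"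
  have "u (Suc n) x = (1/4) * (?b (s - 1) * ?b (t - 1) + ?b (s + 1) * ?b (t + 1) + ?b (s - 1) * ?b (t + 1) + ?b (s + 1) * ?b (t - 1))"
    unfolding u_Suc expectation_four Suc.IH using U(2) by (simp add: axis_def s_def t_def algebra_simps)
  also have "\<dots> = ((?b (s - 1) + ?b (s + 1)) / 2) * ((?b (t - 1) + ?b (t + 1)) / 2)"
    by (simp add: algebra_simps)
  finally show ?case unfolding binom_walk_Suc s_def t_def .
qed

lemma u_le_inverse:
  assumes n: "n \<ge> 1"
  shows "u n x \<le> 1 / real n"
proof -
  have "u n x \<le> central (n div 2) * central (n div 2)"
    unfolding u_eq_product by (intro mult_mono binom_walk_le_central binom_walk_nonneg) (simp add: central_def)
  also have "\<dots> \<le> 1 / (2 * real (n div 2) + 1)" using central_sq_le[of "n div 2"] by (simp add: power2_eq_square)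
  also have "\<dots> \<le> 1 / real n"
  proof -
    have "n \<le> 2 * (n div 2) + 1" by linarith
    then have "real n \<le> 2 * real (n div 2) + 1" by linarith
    then show ?thesis using n by (intro divide_left_mono) auto
  qed
  finally show ?thesis .
qed

lemma G_eq_central: "G n 0 = (\<Sum>m\<le>n div 2. (central m)\<^sup>2)"
proof -
  have "G n 0 = (\<Sum>k\<le>n. (binom_walk k 0)\<^sup>2)"
    by (simp add: G_def u_eq_product power2_eq_square)
  also have "\<dots> = (\<Sum>k\<in>(\<lambda>m. 2 * m) ` {..n div 2}. (binom_walk k 0)\<^sup>2)"
  proof (rule sum.mono_neutral_right)
    show "\<forall>k\<in>{..n} - (\<lambda>m. 2 * m) ` {..n div 2}. (binom_walk k 0)\<^sup>2 = 0"
    proof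
      fix k assume k: "k \<in> {..n} - (\<lambda>m. 2 * m) ` {..n div 2}"
      have "odd k"
      proof
        assume "even k"
        then have "k = 2 * (k div 2)" "k div 2 \<le> n div 2" using k by (auto intro: div_le_mono)
        then show False using k by blast
      qed
      then show "(binom_walk k 0)\<^sup>2 = 0" by (simp add: binom_walk_odd_0)
    qed
  qed auto
  also have "\<dots> = (\<Sum>m\<le>n div 2. (central m)\<^sup>2)"
    by (subst sum.reindex) (auto simp: inj_on_def binom_walk_even_0)
  finally show ?thesis .
qed

text \<open>Returns happen at even times 2m only, with probability ~ 1 / (pi m). The sum runs up to
  n / 2, and halving n does not affect ln n asymptotically.\<close>

lemma G_over_ln: "(\<lambda>n. G n 0 / ln (real n)) \<longlonglongrightarrow> 1 / pi"
proof -
  have top: "filterlim (\<lambda>n::nat. n div 2) at_top sequentially"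
  proof (unfold filterlim_at_top, intro allI)
    fix Z :: nat
    show "eventually (\<lambda>n. Z \<le> n div 2) sequentially"
      using eventually_ge_at_top[of "2 * Z"] by eventually_elim linarith
  qed
  have 1: "(\<lambda>n. G n 0 / ln (real (n div 2))) \<longlonglongrightarrow> 1 / pi"
    unfolding G_eq_central by (rule filterlim_compose[OF sum_asymp_ln[OF central_asymp] top])
  have 2: "(\<lambda>n. ln (real (n div 2)) / ln (real n)) \<longlonglongrightarrow> 1"
  proof (rule tendsto_sandwich[where f = "\<lambda>n. ln ((real n - 1) / 2) / ln (real n)" and h = "\<lambda>_. 1"])
    show "(\<lambda>n. ln ((real n - 1) / 2) / ln (real n)) \<longlonglongrightarrow> 1" by real_asymp
    show "eventually (\<lambda>n. ln ((real n - 1) / 2) / ln (real n) \<le> ln (real (n div 2)) / ln (real n)) sequentially"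
      using eventually_ge_at_top[of 4]
    proof eventually_elim
      case (elim n)
      have "n \<le> 2 * (n div 2) + 1" by linarith
      then have "real n \<le> 2 * real (n div 2) + 1" by linarith
      then have "(real n - 1) / 2 \<le> real (n div 2)" by simp
      then have "ln ((real n - 1) / 2) \<le> ln (real (n div 2))" using elim by (subst ln_le_cancel_iff) auto
      then show ?case using elim by (intro divide_right_mono) auto
    qed
    show "eventually (\<lambda>n. ln (real (n div 2)) / ln (real n) \<le> 1) sequentially"
      using eventually_ge_at_top[of 4]
    proof eventually_elim
      case (elim n)
      have "ln (real (n div 2)) \<le> ln (real n)" using elim by (subst ln_le_cancel_iff) auto
      moreover have "0 < ln (real n)" using elim by simp
      ultimately show ?case by (simp only: pos_divide_le_eq)
    qed
  qed simp
  have "eventually (\<lambda>n. G n 0 / ln (real (n div 2)) * (ln (real (n div 2)) / ln (real n)) = G n 0 / ln (real n)) sequentially"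
    using eventually_ge_at_top[of 4]
  proof eventually_elim
    case (elim n)
    have "1 < real (n div 2)" using elim by linarith
    then have "ln (real (n div 2)) \<noteq> 0" using ln_gt_zero by fastforce
    then show ?case by simp
  qed
  from Lim_transform_eventually[OF tendsto_mult[OF 1 2] this] show ?thesis by simp
qed

end

context lattice_walk
begin

lemma A2'_planar:
  assumes "assumption_A2' M \<xi>"
  shows "\<exists>i j. planar_simple_walk mu i j" and "det (covariance_matrix M \<xi>) = 1 / 4"
proof -
  have d: "CARD('d) = 2" and q: "\<And>e. norm (real_vec e :: real ^ 'd) = 1 \<Longrightarrow> measure M {\<omega> \<in> space M. \<xi> \<omega> = e} = 1 / 4"
    using assms unfolding assumption_A2'_def by auto
  obtain i j :: 'd where U: "UNIV = {i, j}" "i \<noteq> j" using d by (meson card_2_iff)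
  interpret planar_simple_walk mu i j
  proof
    fix e :: "int ^ 'd" assume "norm (real_vec e) = 1"
    moreover have "pmf mu e = measure M {\<omega> \<in> space M. \<xi> \<omega> = e}"
      by (simp add: measure_law[of "\<lambda>x. x = e"] pmf.rep_eq)
    ultimately show "pmf mu e = 1 / 4" using q by metis
  qed (rule U)+
  show "\<exists>i j. planar_simple_walk mu i j" using planar_simple_walk_axioms by blast
  have rv: "real_vec (axis k c :: int ^ 'd) = axis k (of_int c)" for k c
    by (simp add: real_vec_def axis_def vec_eq_iff)
  have "mean M \<xi> = 0"
    unfolding mean_eq expectation_four rv by (simp add: vec_eq_iff axis_def)
  note cov = covariance_eq[OF this, unfolded expectation_four]
  show "det (covariance_matrix M \<xi>) = 1 / 4"
    unfolding det_doubleton[OF U] cov rv using U(2) by (simp add: axis_def)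
qed

end

context iid_walk
begin

lemma cond_probability_tendsto_exp:
  assumes u: "\<And>n x. n \<ge> 1 \<Longrightarrow> random_walk.u mu n x \<le> C / real n"
    and c: "c > 0" "(\<lambda>n. random_walk.G mu n 0 / ln (real n)) \<longlonglongrightarrow> 1 / c"
    and Y: "uniform_on_range M X Y" and w: "w \<ge> 0"
  shows "AE \<omega> in M. (\<lambda>n. cond_probability M (walk_algebra M X)
      (\<lambda>\<omega>'. c * (real (local_time X n (Y n \<omega>') \<omega>') / ln (real n)) \<ge> w) \<omega>) \<longlonglongrightarrow> exp (- w)"
proof -
  interpret iid_walk_log M X mu C c
    by unfold_locales (use u c in auto)
  show ?thesis by (rule cond_probability_tendsto[OF Y w])
qed

end

theorem theorem5:
  fixes M :: "'w measure"
    and \<xi> :: "'w \<Rightarrow> int ^ 'd"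
    and X Y :: "nat \<Rightarrow> 'w \<Rightarrow> int ^ 'd"
    and \<gamma> u :: real
  assumes "CARD('d) \<in> {1, 2}"
    and "prob_space M"
    and "\<xi> \<in> M \<rightarrow>\<^sub>M count_space UNIV"
    and "prob_space.indep_vars M (\<lambda>_. count_space UNIV) X {1..}"
    and "\<And>j. j \<ge> 1 \<Longrightarrow> distr M (count_space UNIV) (X j) = distr M (count_space UNIV) \<xi>"
    and "uniform_on_range M X Y"
    and "u \<ge> 0"
  shows "(assumption_A1 M \<xi> \<gamma> \<longrightarrow>
           (AE \<omega> in M.
             (\<lambda>n. cond_probability M (walk_algebra M X)
                    (\<lambda>\<omega>'. pi * \<gamma> * (real (local_time X n (Y n \<omega>') \<omega>') / ln (real n)) \<ge> u) \<omega>)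
             \<longlonglongrightarrow> exp (- u)))
       \<and> (assumption_A2 M \<xi> \<or> assumption_A2' M \<xi> \<longrightarrow>
           (AE \<omega> in M.
             (\<lambda>n. cond_probability M (walk_algebra M X)
                    (\<lambda>\<omega>'. 2 * pi * sqrt (det (covariance_matrix M \<xi>)) *
                           (real (local_time X n (Y n \<omega>') \<omega>') / ln (real n)) \<ge> u) \<omega>)
             \<longlonglongrightarrow> exp (- u)))"
proof -
  interpret prob_space M by fact
  have "prob_space (distr M (count_space UNIV) \<xi>)" by (rule prob_space_distr) fact
  then obtain mu where mu: "distr M (count_space UNIV) \<xi> = measure_pmf mu"
    using exists_pmf_of_measure[of "distr M (count_space UNIV) \<xi>"] by auto
  interpret lattice_walk M \<xi> mu by unfold_locales fact+
  interpret iid_walk M X mu by unfold_locales (use assms mu in auto)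
  note limit = cond_probability_tendsto_exp[OF _ _ _ \<open>uniform_on_range M X Y\<close> \<open>u \<ge> 0\<close>]
  show ?thesis
  proof (intro conjI impI)
    assume A1: "assumption_A1 M \<xi> \<gamma>"
    then have d: "CARD('d) = 1" and \<gamma>: "\<gamma> > 0" by (auto simp: assumption_A1_def)
    interpret lattice_cf mu "\<lambda>t. \<gamma> * norm t" \<gamma> \<gamma> by (rule A1_lattice_cf[OF A1])
    obtain C where C: "\<And>n x. n \<ge> 1 \<Longrightarrow> random_walk.u mu n x \<le> C / real n" using u_bound by blast
    \<comment> \<open>The integral 2 / \<gamma> divided by 2 pi is 1 / (pi \<gamma>).\<close>
    have "(\<lambda>n. random_walk.G mu n 0 / ln (real n)) \<longlonglongrightarrow> 1 / (pi * \<gamma>)"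
      using G_over_ln unfolding integral_exp_norm_1[OF d \<gamma>] by (simp add: d mult.commute)
    from limit[OF C _ this] show "AE \<omega> in M. (\<lambda>n. cond_probability M (walk_algebra M X)
        (\<lambda>\<omega>'. pi * \<gamma> * (real (local_time X n (Y n \<omega>') \<omega>') / ln (real n)) \<ge> u) \<omega>) \<longlonglongrightarrow> exp (- u)"
      using \<gamma> by simp
  next
    let ?D = "det (covariance_matrix M \<xi>)"
    assume "assumption_A2 M \<xi> \<or> assumption_A2' M \<xi>"
    then have "\<exists>C. (\<forall>n\<ge>1. \<forall>x. random_walk.u mu n x \<le> C / real n) \<and> ?D > 0 \<and>
      (\<lambda>n. random_walk.G mu n 0 / ln (real n)) \<longlonglongrightarrow> 1 / (2 * pi * sqrt ?D)"
    proof
      assume A2: "assumption_A2 M \<xi>"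
      then have d: "CARD('d) = 2" by (simp add: assumption_A2_def)
      obtain q q' where "lattice_cf mu (\<lambda>t. (\<integral>x. (t \<bullet> real_vec x)\<^sup>2 \<partial>measure_pmf mu) / 2) q q'"
        using A2_lattice_cf(1)[OF A2] by blast
      then interpret lattice_cf mu "\<lambda>t. (\<integral>x. (t \<bullet> real_vec x)\<^sup>2 \<partial>measure_pmf mu) / 2" q q' .
      \<comment> \<open>The Gaussian integral supplies one factor 2 pi, and inversion in dimension 2
        divides by (2 pi)^2.\<close>
      have "2 * pi / sqrt ?D / (2 * pi) ^ CARD('d) = 1 / (2 * pi * sqrt ?D)"
        by (simp add: d power2_eq_square)
      then show ?thesis
        using u_bound G_over_ln A2_lattice_cf(3)[OF A2] unfolding A2_lattice_cf(2)[OF A2] by auto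
    next
      assume A2': "assumption_A2' M \<xi>"
      obtain i j where "planar_simple_walk mu i j" using A2'_planar(1)[OF A2'] by blast
      then interpret planar_simple_walk mu i j .
      \<comment> \<open>The determinant is 1/4, so the constant of the statement reduces to the pi
        found through Wallis' product.\<close>
      have "2 * pi * sqrt ?D = pi" unfolding A2'_planar(2)[OF A2'] by (simp add: real_sqrt_divide)
      then have "(\<lambda>n. random_walk.G mu n 0 / ln (real n)) \<longlonglongrightarrow> 1 / (2 * pi * sqrt ?D)"
        using G_over_ln by (simp only:)
      moreover have "?D > 0" using A2'_planar(2)[OF A2'] by simp
      ultimately show ?thesis using u_le_inverse by blast
    qed
    then obtain C where C: "\<And>n x. n \<ge> 1 \<Longrightarrow> random_walk.u mu n x \<le> C / real n" and D: "?D > 0"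
      and G: "(\<lambda>n. random_walk.G mu n 0 / ln (real n)) \<longlonglongrightarrow> 1 / (2 * pi * sqrt ?D)" by blast
    from limit[OF C _ G] show "AE \<omega> in M. (\<lambda>n. cond_probability M (walk_algebra M X)
        (\<lambda>\<omega>'. 2 * pi * sqrt ?D * (real (local_time X n (Y n \<omega>') \<omega>') / ln (real n)) \<ge> u) \<omega>) \<longlonglongrightarrow> exp (- u)"
      using D by simp
  qed
qed

end
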